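(* Let $a>1$, $\sigma^2>0$, $Z_i$ i.i.d. $\mathcal{N}(0,\sigma^2)$, $U_0=0$, $U_i=aU_{i-1}+Z_i$. For any fixed $\epsilon\in(0,1)$ and $d\in(0,\frac{\sigma^2}{a^2-1})$, $$R(n,d,\epsilon)\ge\mathbb{R}_U(d)+\sqrt{\frac{\mathbb{V}_U(d)}n}\,Q^{-1}(\epsilon)-\frac{\log n}{2n}+O\!\left(\frac1n\right).$$
   Context: Distortion: $\mathsf{d}(x_1^n,y_1^n)=\frac1n\sum_{i=1}^n(x_i-y_i)^2$. An $(n,M,d,\epsilon)$ code consists of $f:\mathbb{R}^n\to\{1,\ldots,M\}$ and $g:\{1,\ldots,M\}\to\mathbb{R}^n$ with $\mathbb{P}[\mathsf{d}(U_1^n,g(f(U_1^n)))>d]\le\epsilon$; $R(n,d,\epsilon)=\frac1n\log\min\{M:\exists(n,M,d,\epsilon)\text{ code}\}$. $g(w)=1+a^2-2a\cos w$; $\theta>0$ solves $d=\frac1{2\pi}\int_{-\pi}^{\pi}\min(\theta,\sigma^2/g(w))dw$; $\mathbb{R}_U(d)=\frac1{2\pi}\int_{-\pi}^{\pi}\frac12\log\max(g(w),\sigma^2/\theta)dw$; $\mathbb{V}_U(d)=\frac1{4\pi}\int_{-\pi}^{\pi}\min[1,(\sigma^2/(\theta g(w)))^2]dw$. $Q^{-1}$ is the inverse standard Gaussian tail function. *)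

theory Defs
  imports "HOL-Probability.Probability"
begin

fun gm_source :: "real \<Rightarrow> (nat \<Rightarrow> real) \<Rightarrow> nat \<Rightarrow> real" where
  "gm_source a z 0 = 0"
| "gm_source a z (Suc i) = a * gm_source a z i + z (Suc i)"

definition innov_measure :: "real \<Rightarrow> nat \<Rightarrow> (nat \<Rightarrow> real) measure" where
  "innov_measure s2 n = PiM {1..n} (\<lambda>_. density lborel (normal_density 0 (sqrt s2)))"

definition source_block :: "real \<Rightarrow> nat \<Rightarrow> (nat \<Rightarrow> real) \<Rightarrow> (nat \<Rightarrow> real)" where
  "source_block a n z = restrict (gm_source a z) {1..n}"

definition mse_dist :: "nat \<Rightarrow> (nat \<Rightarrow> real) \<Rightarrow> (nat \<Rightarrow> real) \<Rightarrow> real" where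
  "mse_dist n x y = (1 / real n) * (\<Sum>i=1..n. (x i - y i)\<^sup>2)"

definition is_code :: "real \<Rightarrow> real \<Rightarrow> nat \<Rightarrow> nat \<Rightarrow> real \<Rightarrow> real
    \<Rightarrow> ((nat \<Rightarrow> real) \<Rightarrow> nat) \<Rightarrow> (nat \<Rightarrow> (nat \<Rightarrow> real)) \<Rightarrow> bool" where
  "is_code a s2 n M d eps f g \<longleftrightarrow>
     f \<in> measurable (PiM {1..n} (\<lambda>_. lborel)) (count_space UNIV) \<and>
     (\<forall>x. f x \<in> {1..M}) \<and>
     measure (innov_measure s2 n)
       {z \<in> space (innov_measure s2 n).
          mse_dist n (source_block a n z) (g (f (source_block a n z))) > d} \<le> eps"

definition min_code_size :: "real \<Rightarrow> real \<Rightarrow> nat \<Rightarrow> real \<Rightarrow> real \<Rightarrow> nat" where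
  "min_code_size a s2 n d eps = (LEAST M. \<exists>f g. is_code a s2 n M d eps f g)"

definition Rate :: "real \<Rightarrow> real \<Rightarrow> nat \<Rightarrow> real \<Rightarrow> real \<Rightarrow> real" where
  "Rate a s2 n d eps = ln (real (min_code_size a s2 n d eps)) / real n"

definition gfun :: "real \<Rightarrow> real \<Rightarrow> real" where
  "gfun a w = 1 + a\<^sup>2 - 2 * a * cos w"

definition RU :: "real \<Rightarrow> real \<Rightarrow> real \<Rightarrow> real" where
  "RU a s2 \<theta> = (1 / (2 * pi)) * (LBINT w=-pi..pi. (1/2) * ln (max (gfun a w) (s2 / \<theta>)))"

definition VU :: "real \<Rightarrow> real \<Rightarrow> real \<Rightarrow> real" where
  "VU a s2 \<theta> = (1 / (4 * pi)) * (LBINT w=-pi..pi. min 1 ((s2 / (\<theta> * gfun a w))\<^sup>2))"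

definition Qfun :: "real \<Rightarrow> real" where
  "Qfun x = (LBINT t=ereal x..\<infinity>. std_normal_density t)"

definition Qinv :: "real \<Rightarrow> real" where
  "Qinv eps = (THE x. Qfun x = eps)"

end

theory Submission
  imports Defs "HOL-Computational_Algebra.Polynomial"
begin

text \<open>
  Let $w$ be the discrete sine transform of the innovations, $g_k = g(k \pi/(n+1))$,
  $b_k = \min(1, \sigma^2/(\theta g_k))$ and $J = \sum_k b_k w_k^2 / (2\sigma^2)$. For every reproduction word
  $y$, the expectation of $\exp(J - |U - y|^2/(2\theta))$ is at most
  $C \prod_k \max(g_k, \sigma^2/\theta)^{-1/2}$ with $C$ independent of $n$ and $y$. The sine transform
  diagonalizes the covariance of the source only up to a rank-one term, which belongs to the unstable direction
  and is handled by bounding the density of one linear functional. Markov's inequality and a union bound over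
  the codewords give $P[J \ge t] \le \epsilon + M C \exp(n d/(2\theta) - t) \prod_k
  \max(g_k, \sigma^2/\theta)^{-1/2}$ for every $(n, M, d, \epsilon)$ code.

  Since the innovations are invariant under the orthogonal sine transform, $J$ is a weighted sum of independent
  squares of normal variables. Its characteristic function decays fast enough for the Levy inversion
  formula to give the normal approximation with error $O(n^{-1/2})$ directly, without smoothing. Choosing $t$
  such that the last term above is $C n^{-1/2}$ produces the term $-\log n/(2n)$. Mean and variance of $J$ and the
  product are Riemann sums of monotone functions, hence within $O(1)$ of $n$ times the corresponding
  integrals.
\<close>

text \<open>The obstacle is instability. With x_0 = 0 the innovation map is unit triangular, so its
  determinant is 1, whereas the sine eigenvalues g_k multiply to K = 1 + a^2 + ... + a^(2n), which
  is exponentially large. The rank-one direction has to repay this: after tilting it is a linear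
  functional with standard deviation of order at least K, while the distortion confines it at scale
  sqrt(K). The bounded density therefore yields a factor of order K^(-1/2), exactly the missing one.

  The weights come from reverse water-filling: component k receives distortion min(theta,
  sigma^2/g_k) = theta b_k. Completing the square in one component leaves (sigma^2 omega_k)^(-1/2)
  with omega_k = (1 - b_k)/sigma^2 + 1/(theta g_k), times the exponential of a nonpositive multiple
  of (1 - b_k) v_k^2, where v_k belongs to the word y. Hence b_k <= 1 gives uniformity in y, and
  sigma^2 omega_k g_k = max(g_k, sigma^2/theta).

  By the equation for theta the b_k sum to n d/theta + O(1). So the mean of J cancels n d/(2 theta),
  and the first-order rate is left to the product alone.\<close>

section \<open>The discrete sine transform\<close>

text \<open>The Chebyshev polynomials of the second kind in the variable $2 \cos x$; they are monic, with
  roots $2 \cos (k \pi / (n + 1))$.\<close>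

fun chebyshev_S :: "nat \<Rightarrow> real poly" where
  "chebyshev_S 0 = 1"
| "chebyshev_S (Suc 0) = [:0, 1:]"
| "chebyshev_S (Suc (Suc m)) = [:0, 1:] * chebyshev_S (Suc m) - chebyshev_S m"

lemma degree_lead_coeff_chebyshev_S:
  "degree (chebyshev_S m) = m \<and> lead_coeff (chebyshev_S m) = 1"
proof (induction m rule: chebyshev_S.induct)
  case (3 m)
  have ne: "chebyshev_S (Suc m) \<noteq> 0" using 3 by auto
  have deg: "degree ([:0, 1:] * chebyshev_S (Suc m)) = Suc (Suc m)"
    using 3 ne by (subst degree_mult_eq[OF _ ne]) (simp_all del: chebyshev_S.simps)
  have lc: "lead_coeff ([:0, 1:] * chebyshev_S (Suc m)) = 1"
    using 3 by (subst lead_coeff_mult) auto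
  have "degree (chebyshev_S m) < degree ([:0, 1:] * chebyshev_S (Suc m))"
    using 3 deg by simp
  then have "degree (chebyshev_S (Suc (Suc m))) = Suc (Suc m)"
    using degree_add_eq_left[of "- chebyshev_S m"] deg by (simp del: mult_pCons_left)
  moreover have "coeff (chebyshev_S (Suc (Suc m))) (Suc (Suc m)) = 1"
  proof -
    have "coeff (chebyshev_S m) (Suc (Suc m)) = 0"
      using 3 by (intro coeff_eq_0) simp
    then show ?thesis using lc deg by (simp del: mult_pCons_left)
  qed
  ultimately show ?case by simp
qed auto

text \<open>The defining recurrence is the addition formula for sin((m + 1) x). Multiplying by sin
  x, rather than dividing, keeps the identity valid at multiples of pi.\<close>

lemma chebyshev_S_cos:
  "poly (chebyshev_S m) (2 * cos x) * sin x = sin (real (Suc m) * x)"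
proof (induction m rule: chebyshev_S.induct)
  case (2)
  then show ?case using sin_double[of x] by (simp add: mult_ac)
next
  case (3 m)
  have "sin (real (Suc (Suc (Suc m))) * x) = 2 * cos x * sin (real (Suc (Suc m)) * x) - sin (real (Suc m) * x)"
  proof -
    have e: "real (Suc (Suc (Suc m))) * x = real (Suc (Suc m)) * x + x"
      "real (Suc m) * x = real (Suc (Suc m)) * x - x" by (auto simp: algebra_simps)
    show ?thesis unfolding e sin_add sin_diff by simp
  qed
  with 3 show ?case by (simp add: algebra_simps)
qed simp

text \<open>The point a + 1/a is 2 cos x for exp(i x) = a, so this continues the sine quotient to
  real exponentials. The factor a^m clears denominators and leaves a geometric sum.\<close>

lemma chebyshev_S_geometric:
  fixes a :: real
  assumes "a \<noteq> 0"
  shows "a ^ m * poly (chebyshev_S m) (a + 1 / a) = (\<Sum>i\<le>m. a ^ (2 * i))"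
proof (induction m rule: chebyshev_S.induct)
  case 2
  then show ?case using assms by (simp add: field_simps power2_eq_square)
next
  case (3 m)
  have "a ^ (Suc (Suc m)) * poly (chebyshev_S (Suc (Suc m))) (a + 1 / a)
      = (a\<^sup>2 + 1) * (a ^ Suc m * poly (chebyshev_S (Suc m)) (a + 1 / a))
        - a\<^sup>2 * (a ^ m * poly (chebyshev_S m) (a + 1 / a))"
    using assms by (simp add: field_simps power2_eq_square)
  also have "\<dots> = (a\<^sup>2 + 1) * (\<Sum>i\<le>Suc m. a ^ (2 * i)) - a\<^sup>2 * (\<Sum>i\<le>m. a ^ (2 * i))"
    by (simp only: 3)
  also have "\<dots> = (\<Sum>i\<le>Suc (Suc m). a ^ (2 * i))"
    by (simp add: algebra_simps power2_eq_square power_add)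
  finally show ?case .
qed simp

text \<open>Both sides are monic of degree n and vanish at the same n numbers, which are distinct
  because cos is injective on [0, pi]. Equal leading coefficients make n points of agreement
  enough.\<close>

lemma chebyshev_S_eq_prod:
  "chebyshev_S n = (\<Prod>k=1..n. [:- (2 * cos (pi * real k / real (Suc n))), 1:])"
    (is "_ = (\<Prod>k=1..n. [:- ?r k, 1:])")
proof (rule poly_eqI_degree_lead_coeff[where A = "?r ` {1..n}"])
  have inj: "inj_on ?r {1..n}"
  proof (rule inj_onI)
    fix k l assume kl: "k \<in> {1..n}" "l \<in> {1..n}" "?r k = ?r l"
    have r: "0 \<le> pi * real i / real (Suc n) \<and> pi * real i / real (Suc n) \<le> pi" if "i \<in> {1..n}" for i
    proof -
      have "real i \<le> real (Suc n)" using that by simp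
      then show ?thesis by (simp add: divide_le_eq del: of_nat_Suc)
    qed
    have "pi * real k / real (Suc n) = pi * real l / real (Suc n)"
    proof (rule cos_inj_pi)
      show "cos (pi * real k / real (Suc n)) = cos (pi * real l / real (Suc n))" using kl(3) by linarith
    qed (use r[OF kl(1)] r[OF kl(2)] in blast)+
    then have "pi * real k = pi * real l" by (simp add: field_simps del: of_nat_Suc)
    then show "k = l" by simp
  qed
  then show "card (?r ` {1..n}) \<ge> n" by (simp add: card_image)
  show "degree (chebyshev_S n) \<le> n" "degree (\<Prod>k=1..n. [:- ?r k, 1:]) \<le> n"
    using degree_lead_coeff_chebyshev_S[of n] by (auto simp: degree_prod_eq_sum_degree)
  have "degree (\<Prod>k=1..n. [:- ?r k, 1:]) = n" by (simp add: degree_prod_eq_sum_degree)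
  moreover have "lead_coeff (\<Prod>k=1..n. [:- ?r k, 1:]) = 1" by (simp add: lead_coeff_prod)
  ultimately show "coeff (chebyshev_S n) n = coeff (\<Prod>k=1..n. [:- ?r k, 1:]) n"
    using degree_lead_coeff_chebyshev_S[of n] by metis
  fix z assume "z \<in> ?r ` {1..n}"
  then obtain k where k: "k \<in> {1..n}" "z = ?r k" by auto
  let ?x = "pi * real k / real (Suc n)"
  have "sin ?x > 0"
  proof (rule sin_gt_zero)
    have "real k < real (Suc n)" using k by simp
    then show "?x < pi" by (simp add: divide_less_eq del: of_nat_Suc)
  qed (use k in simp)
  moreover have "poly (chebyshev_S n) z * sin ?x = 0"
    unfolding k chebyshev_S_cos by (simp add: sin_npi2 del: of_nat_Suc)
  ultimately have "poly (chebyshev_S n) z = 0" by simp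
  moreover have "poly (\<Prod>k=1..n. [:- ?r k, 1:]) z = 0"
    unfolding poly_prod using k by (intro prod_zero) auto
  ultimately show "poly (chebyshev_S n) z = poly (\<Prod>k=1..n. [:- ?r k, 1:]) z" by simp
qed

text \<open>Since \<open>gfun a w\<close> is a (a + 1/a - 2 cos w), the product is a^n times the
  Chebyshev value at a + 1/a, that is, the determinant of the Toeplitz matrix. It later turns the
  factor paid for the unstable direction into a product over the eigenvalues.\<close>

lemma prod_gfun_grid:
  assumes "a > 0"
  shows "(\<Prod>k=1..n. gfun a (pi * real k / real (Suc n))) = (\<Sum>i\<le>n. a ^ (2 * i))"
proof -
  have "(\<Sum>i\<le>n. a ^ (2 * i)) = a ^ n * (\<Prod>k=1..n. (a + 1 / a) - 2 * cos (pi * real k / real (Suc n)))"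
    using chebyshev_S_geometric[of a n] assms by (simp add: chebyshev_S_eq_prod poly_prod)
  also have "\<dots> = (\<Prod>k=1..n. a * ((a + 1 / a) - 2 * cos (pi * real k / real (Suc n))))"
    by (simp add: prod.distrib)
  also have "\<dots> = (\<Prod>k=1..n. gfun a (pi * real k / real (Suc n)))"
    using assms by (intro prod.cong) (auto simp: gfun_def field_simps power2_eq_square)
  finally show ?thesis by simp
qed

text \<open>The discrete sine transform (type I): the orthogonal eigenbasis of the tridiagonal Toeplitz matrix
  with $1 + a^2$ on the diagonal and $-a$ next to it.\<close>

definition dst :: "nat \<Rightarrow> nat \<Rightarrow> nat \<Rightarrow> real" where
  "dst n k j = sqrt (2 / real (Suc n)) * sin (pi * real k * real j / real (Suc n))"

lemma dst_sym: "dst n k j = dst n j k"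
  by (simp add: dst_def mult_ac)

text \<open>These boundary values make the tridiagonal eigenvector relation hold at both ends and
  remove the boundary terms from summation by parts.\<close>

lemma dst_0 [simp]: "dst n k 0 = 0" and dst_Suc_n [simp]: "dst n k (Suc n) = 0"
  by (simp_all add: dst_def sin_npi2 del: of_nat_Suc)

text \<open>Multiplication by 2 sin(x/2), with x = pi m/(n + 1), makes the sum telescope; the
  divisibility assumption says exactly that this factor is nonzero. The term j = 0 is included,
  hence the value 1 for odd m.\<close>

lemma sum_cos_grid:
  assumes N: "\<not> 2 * Suc n dvd m"
  shows "(\<Sum>j\<le>n. cos (pi * real m * real j / real (Suc n))) = (if even m then 0 else 1)"
proof -
  let ?x = "pi * real m / real (Suc n)"
  have s: "sin (?x / 2) \<noteq> 0"
  proof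
    assume "sin (?x / 2) = 0"
    then obtain i :: int where "?x / 2 = of_int i * pi" by (auto simp: sin_zero_iff_int2)
    then have "pi * real m = pi * (real_of_int i * (2 * real (Suc n)))"
      by (simp add: field_simps del: of_nat_Suc)
    then have "real m = real_of_int i * (2 * real (Suc n))" by (simp only: mult_cancel_left) simp
    then have "int m = i * int (2 * Suc n)"
      by (metis (mono_tags) of_int_eq_iff of_int_mult of_int_of_nat_eq of_nat_mult of_nat_numeral)
    then have "int (2 * Suc n) dvd int m" by simp
    with N show False by (simp only: int_dvd_int_iff)
  qed
  have half: "y * (1 + r) - y / 2 = y * r + y / 2" for y r :: real by (simp add: field_simps)
  have tele: "2 * sin (?x / 2) * (\<Sum>j\<le>k. cos (?x * real j)) = sin (?x * real k + ?x / 2) + sin (?x / 2)" for k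
  proof (induction k)
    case (Suc k)
    have "2 * sin (?x / 2) * cos (?x * real (Suc k)) = sin (?x * real (Suc k) + ?x / 2) - sin (?x * real (Suc k) - ?x / 2)"
      unfolding sin_add sin_diff by simp
    also have "?x * real (Suc k) - ?x / 2 = ?x * real k + ?x / 2" unfolding of_nat_Suc by (rule half)
    finally show ?case using Suc by (simp add: algebra_simps)
  qed simp
  have "?x * real n + ?x / 2 = ?x * real (Suc n) - ?x / 2"
    unfolding of_nat_Suc half ..
  moreover have "?x * real (Suc n) = pi * real m" by (simp del: of_nat_Suc)
  ultimately have "?x * real n + ?x / 2 = pi * real m - ?x / 2" by linarith
  then have "sin (?x * real n + ?x / 2) = sin (pi * real m - ?x / 2)" by (simp only:)
  then have "sin (?x * real n + ?x / 2) = - (cos (pi * real m) * sin (?x / 2))"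
    unfolding sin_diff by simp
  then have "2 * sin (?x / 2) * (\<Sum>j\<le>n. cos (?x * real j)) = (1 - cos (pi * real m)) * sin (?x / 2)"
    using tele[of n] by (simp add: algebra_simps)
  then have "2 * (\<Sum>j\<le>n. cos (?x * real j)) = 1 - cos (pi * real m)" using s by auto
  moreover have "cos (pi * real m) = (if even m then 1 else -1)"
    by (simp add: cos_npi2)
  ultimately show ?thesis by (auto simp: mult_ac)
qed

text \<open>Product-to-sum gives cosine sums with frequencies k - l and k + l. These have the same
  parity, so the two values cancel unless k = l.\<close>

lemma dst_orthonormal:
  assumes "k \<in> {1..n}" "l \<in> {1..n}"
  shows "(\<Sum>j=1..n. dst n k j * dst n l j) = (if k = l then 1 else 0)"
proof -
  \<comment> \<open>The order l <= k makes the natural-number difference \<open>k - l\<close> a true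
    one; the other case follows by symmetry.\<close>
  have main: "(\<Sum>j=1..n. dst n k j * dst n l j) = (if k = l then 1 else 0)" if kl: "l \<le> k" "k \<in> {1..n}" "l \<in> {1..n}" for k l
  proof -
    have "(\<Sum>j=1..n. dst n k j * dst n l j) = (\<Sum>j\<le>n. dst n k j * dst n l j)"
      by (intro sum.mono_neutral_left) (auto simp: Suc_le_eq)
    also have "\<dots> = (\<Sum>j\<le>n. (1 / real (Suc n)) * (cos (pi * real (k - l) * real j / real (Suc n)) - cos (pi * real (k + l) * real j / real (Suc n))))"
    proof (intro sum.cong refl)
      fix j
      have "pi * real (k - l) * real j / real (Suc n) = pi * real k * real j / real (Suc n) - pi * real l * real j / real (Suc n)"
        "pi * real (k + l) * real j / real (Suc n) = pi * real k * real j / real (Suc n) + pi * real l * real j / real (Suc n)"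
        using kl(1) by (auto simp: of_nat_diff add_divide_distrib[symmetric] diff_divide_distrib[symmetric] algebra_simps)
      then show "dst n k j * dst n l j = (1 / real (Suc n)) * (cos (pi * real (k - l) * real j / real (Suc n)) - cos (pi * real (k + l) * real j / real (Suc n)))"
        using real_sqrt_mult_self[of "2 / real (Suc n)"]
        unfolding dst_def by (simp add: cos_add cos_diff mult.left_commute mult.assoc[symmetric] del: of_nat_Suc real_sqrt_mult_self)
    qed
    also have "\<dots> = (1 / real (Suc n)) * ((\<Sum>j\<le>n. cos (pi * real (k - l) * real j / real (Suc n))) - (\<Sum>j\<le>n. cos (pi * real (k + l) * real j / real (Suc n))))"
      by (simp add: sum_subtractf sum_divide_distrib[symmetric])
    also have "(\<Sum>j\<le>n. cos (pi * real (k + l) * real j / real (Suc n))) = (if even (k + l) then 0 else 1)"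
      using kl by (intro sum_cos_grid) (auto dest!: dvd_imp_le)
    also have "(\<Sum>j\<le>n. cos (pi * real (k - l) * real j / real (Suc n))) = (if k = l then real (Suc n) else if even (k - l) then 0 else 1)"
    proof (cases "k = l")
      case False
      then have "\<not> 2 * Suc n dvd k - l" using kl by (auto dest!: dvd_imp_le)
      then show ?thesis using False by (subst sum_cos_grid) auto
    qed simp
    finally show ?thesis using kl by auto
  qed
  show ?thesis
  proof (cases "l \<le> k")
    case True
    then show ?thesis using main assms by blast
  next
    case False
    have "(\<Sum>j=1..n. dst n k j * dst n l j) = (\<Sum>j=1..n. dst n l j * dst n k j)" by (simp add: mult.commute)
    then show ?thesis using main[of k l] assms False by auto
  qed
qed

lemma dst_eigenvector:
  "(1 + a\<^sup>2) * dst n k (Suc j) - a * dst n k j - a * dst n k (Suc (Suc j))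
    = gfun a (pi * real k / real (Suc n)) * dst n k (Suc j)"
proof -
  let ?x = "pi * real k / real (Suc n)"
  have e: "dst n k j = sqrt (2 / real (Suc n)) * sin (?x * real (Suc j) - ?x)"
    "dst n k (Suc (Suc j)) = sqrt (2 / real (Suc n)) * sin (?x * real (Suc j) + ?x)"
    "dst n k (Suc j) = sqrt (2 / real (Suc n)) * sin (?x * real (Suc j))"
    by (auto simp: dst_def add_divide_distrib[symmetric] diff_divide_distrib[symmetric] algebra_simps)
  show ?thesis unfolding e sin_add sin_diff gfun_def by (simp add: algebra_simps)
qed

section \<open>Orthogonal decomposition of the source energy\<close>

lemma bessel_finite:
  fixes x :: "'i \<Rightarrow> real"
  assumes "finite C"
    and orth: "\<And>c c'. c \<in> C \<Longrightarrow> c' \<in> C \<Longrightarrow> (\<Sum>i\<in>A. q c i * q c' i) = (if c = c' then \<nu> c else 0)"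
    and pos: "\<And>c. c \<in> C \<Longrightarrow> \<nu> c > 0"
  shows "(\<Sum>c\<in>C. (\<Sum>i\<in>A. x i * q c i)\<^sup>2 / \<nu> c) \<le> (\<Sum>i\<in>A. (x i)\<^sup>2)"
proof -
  define e where "e c = (\<Sum>i\<in>A. x i * q c i) / \<nu> c" for c
  have e: "(\<Sum>i\<in>A. x i * q c i) = \<nu> c * e c" if "c \<in> C" for c
    using pos[OF that] by (simp add: e_def)
  have 1: "(\<Sum>i\<in>A. x i * (\<Sum>c\<in>C. e c * q c i)) = (\<Sum>c\<in>C. \<nu> c * (e c)\<^sup>2)"
  proof -
    have "(\<Sum>i\<in>A. x i * (\<Sum>c\<in>C. e c * q c i)) = (\<Sum>i\<in>A. \<Sum>c\<in>C. e c * (x i * q c i))"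
      by (simp add: sum_distrib_left mult_ac)
    also have "\<dots> = (\<Sum>c\<in>C. e c * (\<Sum>i\<in>A. x i * q c i))"
      by (subst sum.swap) (simp add: sum_distrib_left)
    also have "\<dots> = (\<Sum>c\<in>C. \<nu> c * (e c)\<^sup>2)"
      by (intro sum.cong) (simp_all add: e power2_eq_square)
    finally show ?thesis .
  qed
  have 2: "(\<Sum>i\<in>A. (\<Sum>c\<in>C. e c * q c i)\<^sup>2) = (\<Sum>c\<in>C. \<nu> c * (e c)\<^sup>2)"
  proof -
    have "(\<Sum>i\<in>A. (\<Sum>c\<in>C. e c * q c i)\<^sup>2) = (\<Sum>i\<in>A. \<Sum>c\<in>C. \<Sum>c'\<in>C. e c * e c' * (q c i * q c' i))"
      by (simp add: power2_eq_square sum_product mult_ac)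
    also have "\<dots> = (\<Sum>c\<in>C. \<Sum>c'\<in>C. e c * e c' * (\<Sum>i\<in>A. q c i * q c' i))"
      by (subst sum.swap, rule sum.cong[OF refl], subst sum.swap) (simp add: sum_distrib_left)
    also have "\<dots> = (\<Sum>c\<in>C. \<Sum>c'\<in>C. if c = c' then \<nu> c * (e c)\<^sup>2 else 0)"
      by (intro sum.cong refl) (simp add: orth power2_eq_square)
    also have "\<dots> = (\<Sum>c\<in>C. \<nu> c * (e c)\<^sup>2)" using \<open>finite C\<close> by simp
    finally show ?thesis .
  qed
  have "0 \<le> (\<Sum>i\<in>A. (x i - (\<Sum>c\<in>C. e c * q c i))\<^sup>2)" by (intro sum_nonneg) simp
  also have "\<dots> = (\<Sum>i\<in>A. (x i)\<^sup>2 - 2 * (x i * (\<Sum>c\<in>C. e c * q c i)) + (\<Sum>c\<in>C. e c * q c i)\<^sup>2)"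
    by (intro sum.cong refl) (simp add: power2_eq_square algebra_simps)
  also have "\<dots> = (\<Sum>i\<in>A. (x i)\<^sup>2) - (\<Sum>c\<in>C. \<nu> c * (e c)\<^sup>2)"
    unfolding sum.distrib sum_subtractf 2 sum_distrib_left[symmetric] 1 by simp
  also have "(\<Sum>c\<in>C. \<nu> c * (e c)\<^sup>2) = (\<Sum>c\<in>C. (\<Sum>i\<in>A. x i * q c i)\<^sup>2 / \<nu> c)"
    by (intro sum.cong refl) (simp add: e power2_eq_square)
  finally show ?thesis by simp
qed

lemma gfun_lower: "0 \<le> a \<Longrightarrow> (a - 1)\<^sup>2 \<le> gfun a w"
  using mult_left_mono[of "cos w" 1 a] by (simp add: gfun_def power2_eq_square algebra_simps)

lemma gfun_upper: "0 \<le> a \<Longrightarrow> gfun a w \<le> (a + 1)\<^sup>2"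
  using mult_left_mono[of "-1" "cos w" a] by (simp add: gfun_def power2_eq_square algebra_simps)

lemma gfun_pos: "1 < a \<Longrightarrow> 0 < gfun a w"
  using gfun_lower[of a w] by (smt (verit) zero_less_power2)

text \<open>The extension of the innovation map to an additional coordinate $x_0$ has the Toeplitz matrix as its
  Gram matrix, so the vectors \<open>dst n k i - a * dst n k (i + 1)\<close>, $0 \le i \le n$, are orthogonal; together
  with the kernel vector $a^i$ they form an orthogonal basis. The component along the kernel vector is the
  unstable direction of the source.\<close>

lemma energy_lower_bound:
  fixes x :: "nat \<Rightarrow> real"
  assumes "1 < a" and x0: "x 0 = 0"
  defines "z \<equiv> \<lambda>i. x i - a * x (i - 1)"
  shows "(\<Sum>k=1..n. (\<Sum>j=1..n. dst n k j * z j)\<^sup>2 / gfun a (pi * real k / real (Suc n)))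
      + (\<Sum>i=1..n. a ^ i * x i)\<^sup>2 / (\<Sum>i\<le>n. a ^ (2 * i)) \<le> (\<Sum>i=1..n. (x i)\<^sup>2)"
proof -
  define g where "g k = gfun a (pi * real k / real (Suc n))" for k
  \<comment> \<open>Index 0 is free, since its sine vector vanishes; it carries the kernel vector of
    the extended innovation map.\<close>
  define q where "q k i = (if k = 0 then a ^ i else dst n k i - a * dst n k (Suc i))" for k i
  define \<nu> where "\<nu> k = (if k = 0 then (\<Sum>i\<le>n. a ^ (2 * i)) else g k)" for k
  have shift: "(\<Sum>i\<le>n. f (Suc i)) = (\<Sum>i=1..n. f i)" if "f (Suc n) = (0::real)" for f
  proof -
    have "(\<Sum>i\<le>n. f (Suc i)) = (\<Sum>i=1..Suc n. f i)"
      by (rule sum.reindex_bij_witness[of _ "\<lambda>i. i - 1" Suc]) auto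
    then show ?thesis using that by simp
  qed
  have drop0: "(\<Sum>i\<le>n. f i) = (\<Sum>i=1..n. f i)" if "f 0 = (0::real)" for f
    using that by (intro sum.mono_neutral_right) (auto simp: Suc_le_eq)
  \<comment> \<open>Summation by parts moves the difference from the sine vector to
    \<open>f\<close>. The boundary terms vanish because \<open>dst n k\<close> is zero at 0 and at
    \<open>Suc n\<close>.\<close>
  have parts: "(\<Sum>i\<le>n. f i * (dst n k i - a * dst n k (Suc i))) = (\<Sum>i=1..n. dst n k i * (f i - a * f (i - 1)))" for f k
  proof -
    have "(\<Sum>i\<le>n. f i * (dst n k i - a * dst n k (Suc i)))
        = (\<Sum>i\<le>n. dst n k i * f i) - (\<Sum>i\<le>n. (\<lambda>i. a * dst n k i * f (i - 1)) (Suc i))"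
      by (simp add: sum_subtractf algebra_simps)
    also have "\<dots> = (\<Sum>i=1..n. dst n k i * f i) - (\<Sum>i=1..n. a * dst n k i * f (i - 1))"
      using shift[of "\<lambda>i. a * dst n k i * f (i - 1)"] drop0[of "\<lambda>i. dst n k i * f i"] by simp
    finally show ?thesis by (simp add: sum_subtractf algebra_simps)
  qed
  \<comment> \<open>After \<open>parts\<close>, the second factor has been differenced in both
    directions. This is the Toeplitz operator, with eigenvalue \<open>g l\<close> on the sine
    vector.\<close>
  have qq: "(\<Sum>i\<le>n. q k i * q l i) = (if k = l then g l else 0)" if "k \<in> {1..n}" "l \<in> {1..n}" for k l
  proof -
    have "(\<Sum>i\<le>n. q k i * q l i) = (\<Sum>i\<le>n. q l i * (dst n k i - a * dst n k (Suc i)))"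
      using that by (simp add: q_def mult.commute)
    also have "\<dots> = (\<Sum>i=1..n. dst n k i * (q l i - a * q l (i - 1)))" by (rule parts)
    also have "\<dots> = (\<Sum>i=1..n. dst n k i * (g l * dst n l i))"
    proof (intro sum.cong refl)
      fix i assume "i \<in> {1..n}"
      then obtain j where "i = Suc j" by (cases i) auto
      then show "dst n k i * (q l i - a * q l (i - 1)) = dst n k i * (g l * dst n l i)"
        using dst_eigenvector[of a n l j] that by (simp add: q_def g_def algebra_simps power2_eq_square)
    qed
    also have "\<dots> = g l * (\<Sum>i=1..n. dst n k i * dst n l i)" by (simp add: sum_distrib_left mult_ac)
    also have "\<dots> = (if k = l then g l else 0)" using dst_orthonormal[OF that] by simp
    finally show ?thesis .
  qed
  have q0: "(\<Sum>i\<le>n. q 0 i * q k i) = 0" if "k \<in> {1..n}" for k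
  proof -
    have "(\<Sum>i\<le>n. q 0 i * q k i) = (\<Sum>i=1..n. dst n k i * (a ^ i - a * a ^ (i - 1)))"
      using parts[of "\<lambda>i. a ^ i" k] that by (simp add: q_def)
    also have "\<dots> = 0"
      by (intro sum.neutral) (auto simp: power_Suc[symmetric] simp del: power_Suc)
    finally show ?thesis .
  qed
  have "(\<Sum>k\<in>{..n}. (\<Sum>i\<in>{..n}. x i * q k i)\<^sup>2 / \<nu> k) \<le> (\<Sum>i\<in>{..n}. (x i)\<^sup>2)"
  proof (rule bessel_finite)
    fix k l assume kl: "k \<in> {..n}" "l \<in> {..n}"
    consider "k = 0" "l = 0" | "k = 0" "l \<in> {1..n}" | "k \<in> {1..n}" "l = 0" | "k \<in> {1..n}" "l \<in> {1..n}"
      using kl by (cases k; cases l) auto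
    then show "(\<Sum>i\<in>{..n}. q k i * q l i) = (if k = l then \<nu> k else 0)"
    proof cases
      case 1
      then show ?thesis by (simp add: q_def \<nu>_def power_add[symmetric] mult_2)
    next
      case 2
      then show ?thesis using q0 by auto
    next
      case 3
      then show ?thesis using q0[of k] by (auto simp: mult.commute)
    next
      case 4
      then show ?thesis using qq by (auto simp: \<nu>_def)
    qed
  next
    fix k assume "k \<in> {..n}"
    show "\<nu> k > 0" using \<open>1 < a\<close> by (auto simp: \<nu>_def g_def gfun_pos intro!: sum_pos)
  qed simp
  moreover have "(\<Sum>i\<in>{..n}. (x i)\<^sup>2) = (\<Sum>i=1..n. (x i)\<^sup>2)"
    by (rule drop0) (simp add: x0)
  moreover have "(\<Sum>k\<in>{..n}. (\<Sum>i\<in>{..n}. x i * q k i)\<^sup>2 / \<nu> k)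
      = (\<Sum>i=1..n. a ^ i * x i)\<^sup>2 / (\<Sum>i\<le>n. a ^ (2 * i))
        + (\<Sum>k=1..n. (\<Sum>j=1..n. dst n k j * z j)\<^sup>2 / gfun a (pi * real k / real (Suc n)))"
  proof -
    have split: "sum F {..n} = F 0 + sum F {1..n}" for F :: "nat \<Rightarrow> real"
      by (simp add: sum.atLeast_Suc_atMost atMost_atLeast0)
    have x0': "(\<Sum>i\<in>{..n}. x i * q 0 i) = (\<Sum>i=1..n. a ^ i * x i)"
      using drop0[of "\<lambda>i. x i * q 0 i"] by (simp add: x0 q_def mult.commute)
    have xk: "(\<Sum>i\<in>{..n}. x i * q k i) = (\<Sum>j=1..n. dst n k j * z j)" if "k \<in> {1..n}" for k
      using parts[of x k] that by (simp add: q_def z_def)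
    show ?thesis
      by (subst split, rule arg_cong2[where f = "(+)"], simp only: x0' \<nu>_def, simp,
          intro sum.cong refl, simp only: xk, simp add: \<nu>_def g_def)
  qed
  ultimately show ?thesis by linarith
qed

section \<open>Products of normal distributions\<close>

text \<open>Mean and deviation may vary with the coordinate because exponential tilting gives each
  sine coordinate its own pair.\<close>

definition normal_PiM :: "'i set \<Rightarrow> ('i \<Rightarrow> real) \<Rightarrow> ('i \<Rightarrow> real) \<Rightarrow> ('i \<Rightarrow> real) measure" where
  "normal_PiM I m s = PiM I (\<lambda>i. density lborel (normal_density (m i) (s i)))"

lemma sets_normal_PiM [simp, measurable_cong]: "sets (normal_PiM I m s) = sets (PiM I (\<lambda>_. borel))"
  unfolding normal_PiM_def by (intro sets_PiM_cong) auto

lemma space_normal_PiM [simp]: "space (normal_PiM I m s) = extensional I"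
  by (simp add: normal_PiM_def space_PiM PiE_UNIV_domain PiE_def)

lemma sets_PiM_lborel [measurable_cong]: "sets (PiM I (\<lambda>_. lborel :: real measure)) = sets (PiM I (\<lambda>_. borel))"
  by (intro sets_PiM_cong) auto

lemma product_sigma_finite_lborel: "product_sigma_finite (\<lambda>_. lborel :: real measure)"
  by standard

lemma prob_space_normal_PiM:
  assumes "\<And>i. i \<in> I \<Longrightarrow> s i > 0"
  shows "prob_space (normal_PiM I m s)"
  unfolding normal_PiM_def using assms by (intro prob_space_PiM prob_space_normal_density)

lemma normal_PiM_eq_density:
  assumes fin: "finite I" and pos: "\<And>i. i \<in> I \<Longrightarrow> s i > 0"
  shows "normal_PiM I m s = density (PiM I (\<lambda>_. lborel)) (\<lambda>x. \<Prod>i\<in>I. ennreal (normal_density (m i) (s i) (x i)))"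
proof -
  interpret L: product_sigma_finite "\<lambda>_ :: 'a. lborel :: real measure" by (rule product_sigma_finite_lborel)
  \<comment> \<open>The product locale demands a probability measure at every index, so the
    deviation is set to 1 outside \<open>I\<close>.\<close>
  define s' where "s' i = (if i \<in> I then s i else 1)" for i
  have pos': "s' i > 0" for i using pos by (auto simp: s'_def)
  interpret N: product_prob_space "\<lambda>i. density lborel (normal_density (m i) (s' i))"
    using pos' by (auto intro!: product_prob_spaceI prob_space_normal_density)
  have "density (PiM I (\<lambda>_. lborel)) (\<lambda>x. \<Prod>i\<in>I. ennreal (normal_density (m i) (s i) (x i)))
      = PiM I (\<lambda>i. density lborel (normal_density (m i) (s' i)))"
  proof (rule N.PiM_eqI[OF fin])
    show "sets (density (PiM I (\<lambda>_. lborel)) (\<lambda>x. \<Prod>i\<in>I. ennreal (normal_density (m i) (s i) (x i))))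
        = sets (PiM I (\<lambda>i. density lborel (normal_density (m i) (s' i))))"
      by (auto intro!: sets_PiM_cong)
    fix A assume A: "\<And>i. i \<in> I \<Longrightarrow> A i \<in> sets (density lborel (normal_density (m i) (s' i)))"
    have [measurable]: "Pi\<^sub>E I A \<in> sets (PiM I (\<lambda>_. lborel))"
      using A fin by (intro sets_PiM_I_finite) auto
    have "emeasure (density (PiM I (\<lambda>_. lborel)) (\<lambda>x. \<Prod>i\<in>I. ennreal (normal_density (m i) (s i) (x i)))) (Pi\<^sub>E I A)
        = (\<integral>\<^sup>+x. (\<Prod>i\<in>I. ennreal (normal_density (m i) (s i) (x i))) * indicator (Pi\<^sub>E I A) x \<partial>PiM I (\<lambda>_. lborel))"
      by (subst emeasure_density) auto
    also have "\<dots> = (\<integral>\<^sup>+x. (\<Prod>i\<in>I. ennreal (normal_density (m i) (s i) (x i)) * indicator (A i) (x i)) \<partial>PiM I (\<lambda>_. lborel))"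
    proof (rule nn_integral_cong)
      fix x assume x: "x \<in> space (PiM I (\<lambda>_. lborel :: real measure))"
      have "indicator (Pi\<^sub>E I A) x = (\<Prod>i\<in>I. indicator (A i) (x i) :: ennreal)"
      proof (cases "\<forall>i\<in>I. x i \<in> A i")
        case True
        then show ?thesis using x by (auto simp: space_PiM PiE_def intro!: prod.neutral[symmetric])
      next
        case False
        then obtain i where "i \<in> I" "x i \<notin> A i" by auto
        then have "(\<Prod>i\<in>I. indicator (A i) (x i) :: ennreal) = 0" "x \<notin> Pi\<^sub>E I A"
          using fin by (auto simp: prod_zero_iff intro!: bexI[of _ i])
        then show ?thesis by simp
      qed
      then show "(\<Prod>i\<in>I. ennreal (normal_density (m i) (s i) (x i))) * indicator (Pi\<^sub>E I A) x
        = (\<Prod>i\<in>I. ennreal (normal_density (m i) (s i) (x i)) * indicator (A i) (x i))"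
        by (simp add: prod.distrib)
    qed
    also have "\<dots> = (\<Prod>i\<in>I. \<integral>\<^sup>+x. ennreal (normal_density (m i) (s i) x) * indicator (A i) x \<partial>lborel)"
      using A by (intro L.product_nn_integral_prod fin) auto
    also have "\<dots> = (\<Prod>i\<in>I. emeasure (density lborel (normal_density (m i) (s' i))) (A i))"
      using A by (intro prod.cong refl) (auto simp: emeasure_density s'_def)
    finally show "emeasure (density (PiM I (\<lambda>_. lborel)) (\<lambda>x. \<Prod>i\<in>I. ennreal (normal_density (m i) (s i) (x i)))) (Pi\<^sub>E I A)
        = (\<Prod>i\<in>I. emeasure (density lborel (normal_density (m i) (s' i))) (A i))" .
  qed
  also have "PiM I (\<lambda>i. density lborel (normal_density (m i) (s' i))) = normal_PiM I m s"
    unfolding normal_PiM_def by (intro PiM_cong) (auto simp: s'_def)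
  finally show ?thesis by simp
qed

lemma nn_integral_normal_PiM:
  assumes "finite I" "\<And>i. i \<in> I \<Longrightarrow> s i > 0" "f \<in> borel_measurable (PiM I (\<lambda>_. borel))"
  shows "(\<integral>\<^sup>+x. f x \<partial>normal_PiM I m s)
    = (\<integral>\<^sup>+x. (\<Prod>i\<in>I. ennreal (normal_density (m i) (s i) (x i))) * f x \<partial>PiM I (\<lambda>_. lborel))"
proof -
  note [measurable] = assms(3)
  have "normal_PiM I m s = density (PiM I (\<lambda>_. lborel)) (\<lambda>x. \<Prod>i\<in>I. ennreal (normal_density (m i) (s i) (x i)))"
    by (rule normal_PiM_eq_density) (use assms in auto)
  then show ?thesis by (simp add: nn_integral_density)
qed

lemma nn_integral_PiM_lborel_translate:
  assumes fin: "finite I" and [measurable]: "f \<in> borel_measurable (PiM I (\<lambda>_. borel))"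
  shows "(\<integral>\<^sup>+x. f (\<lambda>i\<in>I. x i + c i) \<partial>PiM I (\<lambda>_. lborel)) = (\<integral>\<^sup>+x. f x \<partial>PiM I (\<lambda>_. lborel :: real measure))"
proof -
  interpret L: product_sigma_finite "\<lambda>_ :: 'a. lborel :: real measure" by (rule product_sigma_finite_lborel)
  let ?T = "\<lambda>x. \<lambda>i\<in>I. x i + c i"
  have T [measurable]: "?T \<in> measurable (PiM I (\<lambda>_. lborel)) (PiM I (\<lambda>_. lborel))" by measurable
  have "distr (PiM I (\<lambda>_. lborel)) (PiM I (\<lambda>_. lborel)) ?T = PiM I (\<lambda>_. lborel)"
  proof (rule L.PiM_eqI[OF fin])
    fix A :: "'a \<Rightarrow> real set" assume A: "\<And>i. i \<in> I \<Longrightarrow> A i \<in> sets lborel"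
    have "emeasure (distr (PiM I (\<lambda>_. lborel)) (PiM I (\<lambda>_. lborel)) ?T) (Pi\<^sub>E I A)
        = emeasure (PiM I (\<lambda>_. lborel)) (?T -` (Pi\<^sub>E I A) \<inter> space (PiM I (\<lambda>_. lborel)))"
      using A fin by (intro emeasure_distr T sets_PiM_I_finite) auto
    also have "?T -` (Pi\<^sub>E I A) \<inter> space (PiM I (\<lambda>_. lborel)) = Pi\<^sub>E I (\<lambda>i. (\<lambda>x. x + c i) -` A i \<inter> space lborel)"
      by (auto simp: space_PiM PiE_def Pi_def)
    also have "emeasure (PiM I (\<lambda>_. lborel)) \<dots> = (\<Prod>i\<in>I. emeasure lborel ((\<lambda>x. x + c i) -` A i \<inter> space lborel))"
      using A by (intro L.emeasure_PiM fin measurable_sets[of _ _ lborel]) auto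
    also have "\<dots> = (\<Prod>i\<in>I. emeasure lborel (A i))"
    proof (intro prod.cong refl)
      fix i assume i: "i \<in> I"
      have "emeasure lborel (A i) = emeasure (distr lborel borel ((+) (c i))) (A i)"
        using lborel_distr_plus[of "c i"] by simp
      also have "\<dots> = emeasure lborel (((+) (c i)) -` A i \<inter> space lborel)"
        using A[OF i] by (intro emeasure_distr) auto
      finally show "emeasure lborel ((\<lambda>x. x + c i) -` A i \<inter> space lborel) = emeasure lborel (A i)"
        by (simp add: add.commute[of _ "c i"])
    qed
    finally show "emeasure (distr (PiM I (\<lambda>_. lborel)) (PiM I (\<lambda>_. lborel)) ?T) (Pi\<^sub>E I A) = (\<Prod>i\<in>I. emeasure lborel (A i))" .
  qed simp
  then have "(\<integral>\<^sup>+x. f x \<partial>PiM I (\<lambda>_. lborel :: real measure)) = (\<integral>\<^sup>+x. f x \<partial>distr (PiM I (\<lambda>_. lborel)) (PiM I (\<lambda>_. lborel)) ?T)"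
    by simp
  also have "\<dots> = (\<integral>\<^sup>+x. f (?T x) \<partial>PiM I (\<lambda>_. lborel))"
    by (rule nn_integral_distr) auto
  finally show ?thesis by simp
qed

section \<open>Orthogonal maps on product measures\<close>

definition mat_app :: "'i set \<Rightarrow> ('i \<Rightarrow> 'i \<Rightarrow> real) \<Rightarrow> ('i \<Rightarrow> real) \<Rightarrow> 'i \<Rightarrow> real" where
  "mat_app I S x = (\<lambda>k\<in>I. \<Sum>j\<in>I. S k j * x j)"

lemma mat_app_apply: "k \<in> I \<Longrightarrow> mat_app I S x k = (\<Sum>j\<in>I. S k j * x j)"
  by (simp add: mat_app_def)

lemma measurable_mat_app [measurable]:
  "mat_app I S \<in> measurable (PiM I (\<lambda>_. borel)) (PiM I (\<lambda>_. borel))"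
  unfolding mat_app_def by measurable

text \<open>Rows and columns are both required to be orthonormal, so that a matrix and its transpose
  are inverse to each other without any appeal to linear algebra. For the symmetric sine matrix the
  two conditions coincide.\<close>

definition orthogonal_on :: "'i set \<Rightarrow> ('i \<Rightarrow> 'i \<Rightarrow> real) \<Rightarrow> bool" where
  "orthogonal_on I S \<longleftrightarrow>
    (\<forall>k\<in>I. \<forall>l\<in>I. (\<Sum>j\<in>I. S k j * S l j) = (if k = l then 1 else 0)) \<and>
    (\<forall>k\<in>I. \<forall>l\<in>I. (\<Sum>j\<in>I. S j k * S j l) = (if k = l then 1 else 0))"

lemma orthogonal_on_transpose: "orthogonal_on I S \<Longrightarrow> orthogonal_on I (\<lambda>i j. S j i)"
  by (simp add: orthogonal_on_def)

lemma mat_app_inverse: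
  assumes "orthogonal_on I S" "finite I" "k \<in> I"
  shows "mat_app I S (mat_app I (\<lambda>i j. S j i) x) k = x k"
proof -
  have "mat_app I S (mat_app I (\<lambda>i j. S j i) x) k = (\<Sum>j\<in>I. \<Sum>l\<in>I. S k j * S l j * x l)"
    using assms by (simp add: mat_app_apply sum_distrib_left mult_ac)
  also have "\<dots> = (\<Sum>l\<in>I. (\<Sum>j\<in>I. S k j * S l j) * x l)"
    by (subst sum.swap) (simp add: sum_distrib_right)
  also have "\<dots> = (\<Sum>l\<in>I. if k = l then x l else 0)"
    using assms by (intro sum.cong) (auto simp: orthogonal_on_def)
  finally show ?thesis using assms by simp
qed

lemma sum_sq_mat_app:
  assumes "orthogonal_on I S" "finite I"
  shows "(\<Sum>k\<in>I. (mat_app I S x k)\<^sup>2) = (\<Sum>k\<in>I. (x k)\<^sup>2)"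
proof -
  have "(\<Sum>k\<in>I. (mat_app I S x k)\<^sup>2) = (\<Sum>k\<in>I. mat_app I S x k * (\<Sum>j\<in>I. S k j * x j))"
    by (simp add: mat_app_apply power2_eq_square)
  also have "\<dots> = (\<Sum>j\<in>I. x j * (\<Sum>k\<in>I. S k j * mat_app I S x k))"
    unfolding sum_distrib_left by (subst sum.swap) (simp add: mult_ac)
  also have "\<dots> = (\<Sum>j\<in>I. x j * mat_app I (\<lambda>i j. S j i) (mat_app I S x) j)"
    by (intro sum.cong) (simp_all add: mat_app_apply)
  also have "\<dots> = (\<Sum>k\<in>I. (x k)\<^sup>2)"
    using mat_app_inverse[OF orthogonal_on_transpose[OF assms(1)]] assms by (simp add: power2_eq_square)
  finally show ?thesis .
qed

lemma mat_app_add: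
  "mat_app I S (\<lambda>i\<in>I. x i + y i) = (\<lambda>i\<in>I. mat_app I S x i + mat_app I S y i)"
  by (auto simp: mat_app_def fun_eq_iff distrib_left sum.distrib)

text \<open>With $f(y) = \exp(-|y|^2/2)$, evaluate $\int\int f(y)\, g(Sx)\, dx\, dy$ by translating $x$ by $S^T y$
  and then $y$ by $-Sx$; orthogonality gives $f(y - Sx) = f(x - S^T y)$, so no determinants are needed.\<close>

lemma nn_integral_PiM_lborel_orthogonal:
  assumes orth: "orthogonal_on I S" and fin: "finite I"
    and g [measurable]: "g \<in> borel_measurable (PiM I (\<lambda>_. borel))"
  shows "(\<integral>\<^sup>+x. g (mat_app I S x) \<partial>PiM I (\<lambda>_. lborel)) = (\<integral>\<^sup>+x. g x \<partial>PiM I (\<lambda>_. lborel))"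
proof -
  interpret L: product_sigma_finite "\<lambda>_ :: 'a. lborel :: real measure" by (rule product_sigma_finite_lborel)
  interpret P: pair_sigma_finite "PiM I (\<lambda>_. lborel :: real measure)" "PiM I (\<lambda>_. lborel :: real measure)"
    by (intro pair_sigma_finite.intro L.sigma_finite fin)
  let ?L = "PiM I (\<lambda>_. lborel :: real measure)"
  let ?T = "\<lambda>i j. S j i"
  define f where "f x = ennreal (exp (- (\<Sum>i\<in>I. (x i)\<^sup>2) / 2))" for x :: "'a \<Rightarrow> real"
  have [measurable]: "f \<in> borel_measurable (PiM I (\<lambda>_. borel))" unfolding f_def by measurable
  have fs [measurable]:
    "(\<lambda>p. fst p i) \<in> borel_measurable (PiM I (\<lambda>_. borel) \<Otimes>\<^sub>M PiM I (\<lambda>_. borel :: real measure))"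
    "(\<lambda>p. snd p i) \<in> borel_measurable (PiM I (\<lambda>_. borel) \<Otimes>\<^sub>M PiM I (\<lambda>_. borel :: real measure))"
    if "i \<in> I" for i
    using measurable_compose[OF measurable_fst measurable_component_singleton[OF that]]
      measurable_compose[OF measurable_snd measurable_component_singleton[OF that]] by auto
  have [measurable]: "(\<lambda>p. \<lambda>i\<in>I. mat_app I S (fst p) i + snd p i)
      \<in> measurable (PiM I (\<lambda>_. borel) \<Otimes>\<^sub>M PiM I (\<lambda>_. borel)) (PiM I (\<lambda>_. borel))"
    by (intro measurable_restrict) (simp add: mat_app_apply)
  have [measurable]: "(\<lambda>p. \<lambda>i\<in>I. snd p i + - mat_app I S (fst p) i)
      \<in> measurable (PiM I (\<lambda>_. borel) \<Otimes>\<^sub>M PiM I (\<lambda>_. borel)) (PiM I (\<lambda>_. borel))"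
    by (intro measurable_restrict) (simp add: mat_app_apply)
  have ext: "mat_app I S (mat_app I ?T y) = y" if "y \<in> extensional I" for y
    using that mat_app_inverse[OF orth fin] by (intro extensionalityI[of _ I]) (auto simp: mat_app_def)
  \<comment> \<open>The Gaussian mass is nonzero and finite, so it can be cancelled from both sides
    at the end.\<close>
  have F: "(\<integral>\<^sup>+x. f x \<partial>?L) = (ennreal (sqrt (2 * pi))) ^ card I"
  proof -
    have "f = (\<lambda>x. \<Prod>i\<in>I. ennreal (sqrt (2 * pi)) * ennreal (std_normal_density (x i)))"
      using fin by (auto simp: f_def fun_eq_iff std_normal_density_def prod_ennreal ennreal_mult[symmetric]
          exp_sum[symmetric] sum_divide_distrib sum_negf)
    then have "(\<integral>\<^sup>+x. f x \<partial>?L) = (\<integral>\<^sup>+x. (\<Prod>i\<in>I. ennreal (sqrt (2 * pi)) * ennreal (std_normal_density (x i))) \<partial>?L)"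
      by simp
    also have "\<dots> = (\<Prod>i\<in>I. \<integral>\<^sup>+x. ennreal (sqrt (2 * pi)) * ennreal (std_normal_density x) \<partial>lborel)"
      by (intro L.product_nn_integral_prod fin) simp
    also have "(\<integral>\<^sup>+x. ennreal (sqrt (2 * pi)) * ennreal (std_normal_density x) \<partial>lborel) = ennreal (sqrt (2 * pi))"
      by (subst nn_integral_cmult) (simp_all add: nn_integral_eq_integral)
    finally show ?thesis by simp
  qed
  have "(\<integral>\<^sup>+x. f x \<partial>?L) * (\<integral>\<^sup>+x. g (mat_app I S x) \<partial>?L) = (\<integral>\<^sup>+y. f y * (\<integral>\<^sup>+x. g (mat_app I S x) \<partial>?L) \<partial>?L)"
    by (simp add: nn_integral_multc)
  also have "\<dots> = (\<integral>\<^sup>+y. (\<integral>\<^sup>+x. f y * g (\<lambda>i\<in>I. mat_app I S x i + y i) \<partial>?L) \<partial>?L)"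
  proof (rule nn_integral_cong)
    fix y assume "y \<in> space ?L"
    then have y: "y \<in> extensional I" by (auto simp: space_PiM PiE_def)
    have "(\<integral>\<^sup>+x. g (mat_app I S x) \<partial>?L) = (\<integral>\<^sup>+x. g (mat_app I S (\<lambda>i\<in>I. x i + mat_app I ?T y i)) \<partial>?L)"
      by (intro nn_integral_PiM_lborel_translate[symmetric] fin) measurable
    also have "\<dots> = (\<integral>\<^sup>+x. g (\<lambda>i\<in>I. mat_app I S x i + y i) \<partial>?L)"
      unfolding mat_app_add ext[OF y] ..
    finally show "f y * (\<integral>\<^sup>+x. g (mat_app I S x) \<partial>?L) = (\<integral>\<^sup>+x. f y * g (\<lambda>i\<in>I. mat_app I S x i + y i) \<partial>?L)"
      by (simp add: nn_integral_cmult)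
  qed
  also have "\<dots> = (\<integral>\<^sup>+x. (\<integral>\<^sup>+y. f y * g (\<lambda>i\<in>I. mat_app I S x i + y i) \<partial>?L) \<partial>?L)"
    by (intro P.Fubini'[symmetric]) measurable
  also have "\<dots> = (\<integral>\<^sup>+x. (\<integral>\<^sup>+y. f (\<lambda>i\<in>I. y i + - mat_app I S x i) * g y \<partial>?L) \<partial>?L)"
  proof (rule nn_integral_cong)
    fix x
    have "(\<integral>\<^sup>+y. f (\<lambda>i\<in>I. y i + - mat_app I S x i) * g y \<partial>?L)
        = (\<integral>\<^sup>+y. f (\<lambda>i\<in>I. (\<lambda>i\<in>I. y i + mat_app I S x i) i + - mat_app I S x i) * g (\<lambda>i\<in>I. y i + mat_app I S x i) \<partial>?L)"
      by (intro nn_integral_PiM_lborel_translate[symmetric] fin) measurable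
    also have "\<dots> = (\<integral>\<^sup>+y. f y * g (\<lambda>i\<in>I. mat_app I S x i + y i) \<partial>?L)"
      by (intro nn_integral_cong) (simp add: f_def add.commute)
    finally show "(\<integral>\<^sup>+y. f y * g (\<lambda>i\<in>I. mat_app I S x i + y i) \<partial>?L)
        = (\<integral>\<^sup>+y. f (\<lambda>i\<in>I. y i + - mat_app I S x i) * g y \<partial>?L)" ..
  qed
  also have "\<dots> = (\<integral>\<^sup>+y. (\<integral>\<^sup>+x. f (\<lambda>i\<in>I. y i + - mat_app I S x i) * g y \<partial>?L) \<partial>?L)"
    by (intro P.Fubini') measurable
  also have "\<dots> = (\<integral>\<^sup>+y. (\<integral>\<^sup>+x. f x \<partial>?L) * g y \<partial>?L)"
  proof (rule nn_integral_cong)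
    fix y assume "y \<in> space ?L"
    then have y: "y \<in> extensional I" by (auto simp: space_PiM PiE_def)
    have "f (\<lambda>i\<in>I. y i + - mat_app I S x i) = f (\<lambda>i\<in>I. x i + - mat_app I ?T y i)" for x
    proof -
      let ?v = "\<lambda>i\<in>I. x i + - mat_app I ?T y i"
      have "mat_app I S ?v i = - (y i - mat_app I S x i)" if "i \<in> I" for i
      proof -
        have "mat_app I S (\<lambda>i. - mat_app I ?T y i) i = - mat_app I S (mat_app I ?T y) i"
          using that by (simp add: mat_app_apply sum_negf)
        then show ?thesis using that
          unfolding mat_app_add by (simp add: mat_app_inverse[OF orth fin])
      qed
      then have "(\<Sum>i\<in>I. (mat_app I S ?v i)\<^sup>2) = (\<Sum>i\<in>I. (y i + - mat_app I S x i)\<^sup>2)"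
        by (intro sum.cong refl) (simp add: power2_commute)
      then have "(\<Sum>i\<in>I. (?v i)\<^sup>2) = (\<Sum>i\<in>I. (y i + - mat_app I S x i)\<^sup>2)"
        unfolding sum_sq_mat_app[OF orth fin] .
      then show ?thesis by (simp add: f_def)
    qed
    then have "(\<integral>\<^sup>+x. f (\<lambda>i\<in>I. y i + - mat_app I S x i) * g y \<partial>?L) = (\<integral>\<^sup>+x. f (\<lambda>i\<in>I. x i + - mat_app I ?T y i) * g y \<partial>?L)"
      by simp
    also have "\<dots> = (\<integral>\<^sup>+x. f (\<lambda>i\<in>I. x i + - mat_app I ?T y i) \<partial>?L) * g y"
      by (rule nn_integral_multc) measurable
    also have "(\<integral>\<^sup>+x. f (\<lambda>i\<in>I. x i + - mat_app I ?T y i) \<partial>?L) = (\<integral>\<^sup>+x. f x \<partial>?L)"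
      by (intro nn_integral_PiM_lborel_translate fin) measurable
    finally show "(\<integral>\<^sup>+x. f (\<lambda>i\<in>I. y i + - mat_app I S x i) * g y \<partial>?L) = (\<integral>\<^sup>+x. f x \<partial>?L) * g y" .
  qed
  also have "\<dots> = (\<integral>\<^sup>+x. f x \<partial>?L) * (\<integral>\<^sup>+y. g y \<partial>?L)"
    by (rule nn_integral_cmult) measurable
  finally have eq: "(\<integral>\<^sup>+x. f x \<partial>?L) * (\<integral>\<^sup>+x. g (mat_app I S x) \<partial>?L) = (\<integral>\<^sup>+x. f x \<partial>?L) * (\<integral>\<^sup>+y. g y \<partial>?L)" .
  have "(\<integral>\<^sup>+x. f x \<partial>?L) \<noteq> 0" "(\<integral>\<^sup>+x. f x \<partial>?L) \<noteq> \<infinity>" unfolding F by (auto simp: ennreal_power)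
  with eq show ?thesis by (simp add: ennreal_mult_cancel_left)
qed

text \<open>The centred isotropic normal density is a function of the Euclidean norm, and an
  orthogonal map preserves both the norm and Lebesgue measure.\<close>

lemma distr_normal_PiM_orthogonal:
  assumes orth: "orthogonal_on I S" and fin: "finite I" and s: "s > 0"
  shows "distr (normal_PiM I (\<lambda>_. 0) (\<lambda>_. s)) (PiM I (\<lambda>_. borel)) (mat_app I S) = normal_PiM I (\<lambda>_. 0) (\<lambda>_. s)"
    (is "distr ?N _ _ = _")
proof (rule measure_eqI)
  fix A assume "A \<in> sets (distr ?N (PiM I (\<lambda>_. borel)) (mat_app I S))"
  then have A [measurable]: "A \<in> sets (PiM I (\<lambda>_. borel))" by simp
  have inv: "(\<Prod>i\<in>I. ennreal (normal_density 0 s (mat_app I S x i))) = (\<Prod>i\<in>I. ennreal (normal_density 0 s (x i)))" for x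
  proof -
    have "(\<Prod>i\<in>I. normal_density 0 s (x i)) = (1 / sqrt (2 * pi * s\<^sup>2)) ^ card I * exp (- (\<Sum>i\<in>I. (x i)\<^sup>2) / (2 * s\<^sup>2))" for x
      using fin by (simp add: normal_density_def prod.distrib exp_sum[symmetric] sum_divide_distrib sum_negf prod_dividef power_divide)
    then show ?thesis by (simp add: prod_ennreal sum_sq_mat_app[OF orth fin])
  qed
  have "emeasure (distr ?N (PiM I (\<lambda>_. borel)) (mat_app I S)) A = (\<integral>\<^sup>+x. indicator A (mat_app I S x) \<partial>?N)"
    by (subst nn_integral_indicator[symmetric], simp, subst nn_integral_distr) auto
  also have "\<dots> = (\<integral>\<^sup>+x. (\<Prod>i\<in>I. ennreal (normal_density 0 s (mat_app I S x i))) * indicator A (mat_app I S x) \<partial>PiM I (\<lambda>_. lborel))"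
    unfolding inv using fin s by (subst nn_integral_normal_PiM) auto
  also have "\<dots> = (\<integral>\<^sup>+x. (\<Prod>i\<in>I. ennreal (normal_density 0 s (x i))) * indicator A x \<partial>PiM I (\<lambda>_. lborel))"
    by (intro nn_integral_PiM_lborel_orthogonal[OF orth fin]) measurable
  also have "\<dots> = (\<integral>\<^sup>+x. indicator A x \<partial>?N)"
    using fin s by (subst nn_integral_normal_PiM) auto
  finally show "emeasure (distr ?N (PiM I (\<lambda>_. borel)) (mat_app I S)) A = emeasure ?N A" by simp
qed simp

lemma distr_scale_normal_PiM:
  assumes fin: "finite I" and s: "0 < s"
  shows "distr (normal_PiM I (\<lambda>_. 0) (\<lambda>_. 1)) (PiM I (\<lambda>_. borel)) (\<lambda>x. \<lambda>i\<in>I. s * x i) = normal_PiM I (\<lambda>_. 0) (\<lambda>_. s)"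
proof -
  interpret G: prob_space std_normal_distribution by (rule prob_space_normal_density) simp
  interpret N1: product_prob_space "\<lambda>_::'a. std_normal_distribution" ..
  interpret NS: product_prob_space "\<lambda>_::'a. density lborel (normal_density 0 s)"
    using s by (auto intro!: product_prob_spaceI prob_space_normal_density)
  let ?T = "\<lambda>x. \<lambda>i\<in>I. s * x i"
  have [measurable]: "?T \<in> measurable (PiM I (\<lambda>_. borel)) (PiM I (\<lambda>_. borel))" by measurable
  have one: "emeasure std_normal_distribution ((\<lambda>x. s * x) -` A) = emeasure (density lborel (normal_density 0 s)) A"
    if [measurable]: "A \<in> sets borel" for A
  proof -
    have "distributed std_normal_distribution lborel (\<lambda>x. x) std_normal_density"
      by (simp add: distributed_def distr_id2)
    from G.normal_density_affine[OF this, of s 0] s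
    have "distr std_normal_distribution lborel (\<lambda>x. s * x) = density lborel (normal_density 0 s)"
      by (simp add: distributed_def)
    then have "emeasure (density lborel (normal_density 0 s)) A = emeasure (distr std_normal_distribution lborel (\<lambda>x. s * x)) A"
      by simp
    also have "\<dots> = emeasure std_normal_distribution ((\<lambda>x. s * x) -` A)"
      by (subst emeasure_distr) auto
    finally show ?thesis ..
  qed
  have "distr (normal_PiM I (\<lambda>_. 0) (\<lambda>_. 1)) (PiM I (\<lambda>_. borel)) ?T = PiM I (\<lambda>_. density lborel (normal_density 0 s))"
  proof (rule NS.PiM_eqI[OF fin])
    show "sets (distr (normal_PiM I (\<lambda>_. 0) (\<lambda>_. 1)) (PiM I (\<lambda>_. borel)) ?T) = sets (PiM I (\<lambda>_. density lborel (normal_density 0 s)))"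
      by (simp, intro sets_PiM_cong) auto
    fix A :: "'a \<Rightarrow> real set" assume A: "\<And>i. i \<in> I \<Longrightarrow> A i \<in> sets (density lborel (normal_density 0 s))"
    have "emeasure (distr (normal_PiM I (\<lambda>_. 0) (\<lambda>_. 1)) (PiM I (\<lambda>_. borel)) ?T) (Pi\<^sub>E I A)
        = emeasure (normal_PiM I (\<lambda>_. 0) (\<lambda>_. 1)) (?T -` (Pi\<^sub>E I A) \<inter> extensional I)"
      using A fin by (subst emeasure_distr) (auto intro!: sets_PiM_I_finite)
    also have "?T -` (Pi\<^sub>E I A) \<inter> extensional I = Pi\<^sub>E I (\<lambda>i. (\<lambda>x. s * x) -` A i)"
      by (auto simp: PiE_def Pi_def)
    also have "emeasure (normal_PiM I (\<lambda>_. 0) (\<lambda>_. 1)) \<dots> = (\<Prod>i\<in>I. emeasure std_normal_distribution ((\<lambda>x. s * x) -` A i))"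
      unfolding normal_PiM_def using A
      by (intro N1.emeasure_PiM fin) (auto intro!: measurable_sets_borel[of _ borel])
    also have "\<dots> = (\<Prod>i\<in>I. emeasure (density lborel (normal_density 0 s)) (A i))"
      using A by (intro prod.cong refl one) auto
    finally show "emeasure (distr (normal_PiM I (\<lambda>_. 0) (\<lambda>_. 1)) (PiM I (\<lambda>_. borel)) ?T) (Pi\<^sub>E I A)
        = (\<Prod>i\<in>I. emeasure (density lborel (normal_density 0 s)) (A i))" .
  qed
  then show ?thesis by (simp add: normal_PiM_def)
qed

section \<open>Normal approximation of weighted chi-square sums\<close>

declare One_nat_def [simp del]

text \<open>In Levy's inversion formula the kernel is bounded by 2/|t|, which cancels the factor |t|
  in the hypothesis. Integrability of \<open>h\<close> then controls the whole frequency axis at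
  once, and the constant is 2/(2 pi).\<close>

lemma cdf_diff_le_char_diff:
  fixes h :: "real \<Rightarrow> real"
  assumes "real_distribution M1" "real_distribution M2"
    and h: "integrable lborel h" and h0: "\<And>t. 0 \<le> h t"
    and char: "\<And>t. cmod (char M1 t - char M2 t) \<le> \<bar>t\<bar> * h t"
    and atoms: "measure M1 {b} = 0" "measure M2 {b} = 0"
  shows "\<bar>cdf M1 b - cdf M2 b\<bar> \<le> (\<integral>t. h t \<partial>lborel) / pi"
proof -
  interpret M1: real_distribution M1 by (rule assms)
  interpret M2: real_distribution M2 by (rule assms)
  have count: "countable {x. measure M1 {x} \<noteq> 0 \<or> measure M2 {x} \<noteq> 0}"
    using countable_Un[OF M1.countable_support M2.countable_support] by (simp add: Un_def)
  have interval: "\<bar>measure M1 {a<..b} - measure M2 {a<..b}\<bar> \<le> (\<integral>t. h t \<partial>lborel) / pi"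
    if ab: "a \<le> b" "measure M1 {a} = 0" "measure M2 {a} = 0" for a
  proof -
    let ?F = "\<lambda>t. (iexp (-(t * a)) - iexp (-(t * b))) / (\<i> * complex_of_real t)"
    \<comment> \<open>The bound b - a serves only for integrability on finite intervals. The
      estimate that is uniform in \<open>a\<close> uses 2/|t| below.\<close>
    have F_bound: "cmod (?F t) \<le> b - a" if "t \<noteq> 0" for t
      using Levy_Inversion_aux2[of "-b" "-a" t] ab(1) that by simp
    have integ: "complex_interval_lebesgue_integrable lborel (ereal (- T)) (ereal T) (\<lambda>t. ?F t * char M t)"
      if "real_distribution M" for T M
    proof -
      interpret M: real_distribution M by (rule that)
      have "cmod (?F t * char M t) \<le> b - a" if "t \<noteq> 0" for t
      proof -
        have "cmod (?F t) * cmod (char M t) \<le> (b - a) * 1"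
          using F_bound[OF that] M.cmod_char_le_1 ab(1) by (intro mult_mono) auto
        then show ?thesis by (simp only: norm_mult mult_1_right)
      qed
      then show ?thesis
        by (auto simp add: interval_lebesgue_integrable_def set_integrable_def simp del: times_divide_eq_left
            intro!: integrableI_bounded_set_indicator[where B="b - a"] AE_I[of _ _ "{0}"])
    qed
    let ?D = "\<lambda>T::nat. (CLBINT t=-real T..real T. ?F t * char M1 t) - (CLBINT t=-real T..real T. ?F t * char M2 t)"
    have lim: "(\<lambda>T. 1 / (2 * pi) * ?D T) \<longlonglongrightarrow> complex_of_real (measure M1 {a<..b} - measure M2 {a<..b})"
      using tendsto_diff[OF M1.Levy_Inversion[OF ab(1,2) atoms(1)] M2.Levy_Inversion[OF ab(1,3) atoms(2)]]
      by (simp add: right_diff_distrib)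
    have bound: "cmod (1 / (2 * pi) * ?D T) \<le> (\<integral>t. h t \<partial>lborel) / pi" for T :: nat
    proof -
      let ?I = "einterval (- real T) (real T)"
      have "?D T = (CLBINT t=-real T..real T. ?F t * char M1 t - ?F t * char M2 t)"
        by (intro interval_lebesgue_integral_diff(2)[symmetric] integ assms)
      also have "\<dots> = (\<integral>t. indicator ?I t *\<^sub>R (?F t * char M1 t - ?F t * char M2 t) \<partial>lborel)"
        by (simp add: interval_lebesgue_integral_def set_lebesgue_integral_def)
      finally have D: "?D T = (\<integral>t. indicator ?I t *\<^sub>R (?F t * char M1 t - ?F t * char M2 t) \<partial>lborel)" .
      have "cmod (?D T) \<le> (\<integral>t. 2 * h t \<partial>lborel)"
        unfolding D
      proof (rule Bochner_Integration.integral_norm_bound_integral)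
        show "integrable lborel (\<lambda>t. indicator ?I t *\<^sub>R (?F t * char M1 t - ?F t * char M2 t))"
          using interval_lebesgue_integral_diff(1)[OF integ[OF assms(1), of T] integ[OF assms(2), of T]]
          by (simp add: interval_lebesgue_integrable_def set_integrable_def)
        show "integrable lborel (\<lambda>t. 2 * h t)" using h by simp
        fix t :: real
        show "cmod (indicator ?I t *\<^sub>R (?F t * char M1 t - ?F t * char M2 t)) \<le> 2 * h t"
        proof (cases "t = 0")
          case True
          then show ?thesis using h0 by simp
        next
          case False
          have "cmod (iexp (-(t * a)) - iexp (-(t * b))) \<le> 2"
            using norm_triangle_ineq4[of "iexp (-(t * a))" "iexp (-(t * b))"] by (simp add: norm_exp_i_times)
          then have "cmod (?F t) \<le> 2 / \<bar>t\<bar>"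
            using False by (simp add: norm_divide norm_mult divide_right_mono)
          then have "cmod (?F t) * cmod (char M1 t - char M2 t) \<le> (2 / \<bar>t\<bar>) * (\<bar>t\<bar> * h t)"
            by (intro mult_mono char) auto
          also have "\<dots> = 2 * h t" using False by simp
          finally have "cmod (?F t * (char M1 t - char M2 t)) \<le> 2 * h t" by (simp only: norm_mult)
          then have "cmod (?F t * char M1 t - ?F t * char M2 t) \<le> 2 * h t" by (simp only: right_diff_distrib)
          then show ?thesis using h0[of t] by (auto simp: indicator_def)
        qed
      qed
      then have "cmod (?D T) / (2 * pi) \<le> (2 * (\<integral>t. h t \<partial>lborel)) / (2 * pi)"
        by (intro divide_right_mono) auto
      then show ?thesis by (simp add: norm_mult norm_divide)
    qed
    have "cmod (complex_of_real (measure M1 {a<..b} - measure M2 {a<..b})) \<le> (\<integral>t. h t \<partial>lborel) / pi"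
      by (rule tendsto_upperbound[OF tendsto_norm[OF lim]]) (use bound in auto)
    then show ?thesis by (simp only: norm_of_real)
  qed
  show ?thesis
  \<comment> \<open>The bound for intervals does not depend on the left endpoint, which is now sent
    to minus infinity through common continuity points; there the two distribution functions differ
    by less than any given amount.\<close>
  proof (rule field_le_epsilon)
    fix \<epsilon> :: real assume "\<epsilon> > 0"
    have "((\<lambda>x. \<bar>cdf M1 x - cdf M2 x\<bar>) \<longlongrightarrow> 0) at_bot"
      using M1.cdf_lim_at_bot M2.cdf_lim_at_bot by (intro tendsto_eq_intros) auto
    then have "eventually (\<lambda>y. \<bar>cdf M1 y - cdf M2 y\<bar> < \<epsilon> \<and> y \<le> b) at_bot"
      using \<open>\<epsilon> > 0\<close> by (simp only: tendsto_iff dist_real_def diff_0_right eventually_conj eventually_le_at_bot abs_idempotent)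
    then obtain m where m: "\<And>y. y \<le> m \<Longrightarrow> \<bar>cdf M1 y - cdf M2 y\<bar> < \<epsilon>" "m \<le> b"
      unfolding eventually_at_bot_linorder by auto
    with open_minus_countable[OF count, of "{..< m}"] obtain a where a:
      "measure M1 {a} = 0" "measure M2 {a} = 0" "a < m" by auto
    have "a < b" using a m by simp
    then show "\<bar>cdf M1 b - cdf M2 b\<bar> \<le> (\<integral>t. h t \<partial>lborel) / pi + \<epsilon>"
      using interval[of a] a m(1)[of a] M1.cdf_diff_eq[of a b] M2.cdf_diff_eq[of a b] by simp
  qed
qed

text \<open>The characteristic function of (X^2 - 1)/2 for a standard normal X. Its closed form is
  exp(-i s/2) (1 - i s)^(-1/2), but only the modulus and the expansion at 0 are used, which avoids
  branches of the complex root.\<close>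

definition chisq_char :: "real \<Rightarrow> complex" where
  "chisq_char s = (\<integral>x. iexp (s * ((x\<^sup>2 - 1) / 2)) \<partial>std_normal_distribution)"

lemma integrable_std_normal_chisq_power:
  "integrable std_normal_distribution (\<lambda>x. ((x\<^sup>2 - 1) / 2) ^ k)"
proof -
  interpret real_distribution std_normal_distribution by (rule real_dist_normal_dist)
  show ?thesis
  proof (rule Bochner_Integration.integrable_bound)
    show "integrable std_normal_distribution (\<lambda>x. 1 + x ^ (2 * k))"
      by (intro Bochner_Integration.integrable_add std_normal_distribution_even_moments(2)) simp
    show "AE x in std_normal_distribution. norm (((x\<^sup>2 - 1) / 2) ^ k) \<le> norm (1 + x ^ (2 * k))"
    proof (intro AE_I2)
      fix x :: real
      have "\<bar>(x\<^sup>2 - 1) / 2\<bar> ^ k \<le> (max 1 (x\<^sup>2)) ^ k"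
        by (intro power_mono) (auto simp: max_def abs_if)
      also have "\<dots> \<le> 1 + (x\<^sup>2) ^ k" by (auto simp: max_def)
      finally show "norm (((x\<^sup>2 - 1) / 2) ^ k) \<le> norm (1 + x ^ (2 * k))"
        by (simp add: power_abs power_mult)
    qed
  qed simp
qed

text \<open>The variable (X^2 - 1)/2 has mean 0 and variance 1/2, which gives the term s^2/4; the
  remainder is bounded by a sixth of the third absolute moment.\<close>

lemma chisq_char_taylor:
  obtains \<kappa> :: real where "\<kappa> \<ge> 0" "\<And>s. cmod (chisq_char s - (1 - of_real (s\<^sup>2 / 4))) \<le> \<kappa> * \<bar>s\<bar> ^ 3"
proof -
  interpret G: real_distribution std_normal_distribution by (rule real_dist_normal_dist)
  let ?X = "\<lambda>x::real. (x\<^sup>2 - 1) / 2"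
  define M where "M = distr std_normal_distribution borel ?X"
  interpret M: real_distribution M unfolding M_def by (intro G.real_distribution_distr) simp
  have chisq_char: "chisq_char s = char M s" for s
    unfolding chisq_char_def char_def M_def by (subst integral_distr) auto
  have int: "integrable M (\<lambda>x. x ^ k)" for k
    unfolding M_def using integrable_std_normal_chisq_power[of k] by (subst integrable_distr_eq) auto
  have mom: "(\<integral>x. x ^ k \<partial>M) = (\<integral>x. ?X x ^ k \<partial>std_normal_distribution)" for k
    unfolding M_def by (subst integral_distr) auto
  have m2: "(\<integral>x. x\<^sup>2 \<partial>std_normal_distribution) = 1" "integrable std_normal_distribution (\<lambda>x. x\<^sup>2)"
    using std_normal_distribution_even_moments[of 1] by auto
  have m4: "(\<integral>x. x ^ 4 \<partial>std_normal_distribution) = 3" "integrable std_normal_distribution (\<lambda>x. x ^ 4)"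
    using std_normal_distribution_even_moments[of 2] by (auto simp: fact_numeral)
  have e1: "(\<integral>x. x ^ 1 \<partial>M) = 0"
    unfolding mom using m2 G.prob_space by simp
  have e2: "(\<integral>x. x ^ 2 \<partial>M) = 1 / 2"
  proof -
    have "(\<integral>x. x ^ 2 \<partial>M) = (\<integral>x. (x ^ 4 - 2 * x\<^sup>2 + 1) / 4 \<partial>std_normal_distribution)"
      unfolding mom by (intro Bochner_Integration.integral_cong) (auto simp: power2_eq_square power4_eq_xxxx field_simps)
    also have "\<dots> = 1 / 2" using m2 m4 G.prob_space by simp
    finally show ?thesis .
  qed
  define \<kappa> where "\<kappa> = (\<integral>x. \<bar>x\<bar> ^ 3 \<partial>M) / 6"
  have int3: "integrable M (\<lambda>x. \<bar>x\<bar> ^ 3)" using integrable_norm[OF int[of 3]] by (simp add: power_abs)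
  show thesis
  proof
    show "\<kappa> \<ge> 0" unfolding \<kappa>_def by (simp add: integral_nonneg_AE)
    fix s
    have "cmod (char M s - (\<Sum>k\<le>2. (\<i> * s) ^ k / fact k * (\<integral>x. x ^ k \<partial>M)))
        \<le> (\<bar>s\<bar> ^ 2 / fact (Suc 2)) * (\<integral>x. min (2 * \<bar>x\<bar>\<^sup>2 * Suc 2) (\<bar>s\<bar> * \<bar>x\<bar> ^ Suc 2) \<partial>M)"
      by (rule M.char_approx2) (rule int)
    also have "(\<Sum>k\<le>2. (\<i> * s) ^ k / fact k * (\<integral>x. x ^ k \<partial>M)) = 1 - of_real (s\<^sup>2 / 4)"
    proof -
      have three: "(\<Sum>k\<le>2. c k) = c 0 + c 1 + c 2" for c :: "nat \<Rightarrow> complex"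
        by (simp add: numeral_2_eq_2 One_nat_def)
      show ?thesis unfolding three e1 e2 using M.prob_space by (simp add: power_mult_distrib)
    qed
    also have "(\<bar>s\<bar> ^ 2 / fact (Suc 2)) * (\<integral>x. min (2 * \<bar>x\<bar>\<^sup>2 * Suc 2) (\<bar>s\<bar> * \<bar>x\<bar> ^ Suc 2) \<partial>M)
        \<le> (\<bar>s\<bar> ^ 2 / fact (Suc 2)) * (\<integral>x. \<bar>s\<bar> * \<bar>x\<bar> ^ 3 \<partial>M)"
    proof (rule mult_left_mono[OF integral_mono])
      show "integrable M (\<lambda>x. min (2 * \<bar>x\<bar>\<^sup>2 * Suc 2) (\<bar>s\<bar> * \<bar>x\<bar> ^ Suc 2))"
        using int[of 2] int3 by (intro integrable_min) simp_all
      show "integrable M (\<lambda>x. \<bar>s\<bar> * \<bar>x\<bar> ^ 3)" using int3 by simp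
    qed simp_all
    also have "\<dots> = \<kappa> * \<bar>s\<bar> ^ 3"
      by (simp add: \<kappa>_def fact_numeral numeral_eq_Suc)
    finally show "cmod (chisq_char s - (1 - of_real (s\<^sup>2 / 4))) \<le> \<kappa> * \<bar>s\<bar> ^ 3" unfolding chisq_char .
  qed
qed

text \<open>The squared modulus is $E \exp(\mathrm{i} s (X^2 - Y^2)/2)$ for independent standard normal $X$, $Y$, and a
  rotation by 45 degrees turns $(X^2 - Y^2)/2$ into $XY$.\<close>

lemma cmod_chisq_char: "(cmod (chisq_char s))\<^sup>2 = 1 / sqrt (1 + s\<^sup>2)"
proof -
  interpret G: real_distribution std_normal_distribution by (rule real_dist_normal_dist)
  interpret P: product_prob_space "\<lambda>_::nat. std_normal_distribution" ..
  let ?P = "PiM {0, 1::nat} (\<lambda>_. std_normal_distribution)"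
  have P: "?P = normal_PiM {0, 1} (\<lambda>_. 0) (\<lambda>_. 1)" by (simp add: normal_PiM_def)
  interpret PP: prob_space ?P by (intro prob_space_PiM G.prob_space_axioms)
  have [measurable_cong]: "sets ?P = sets (PiM {0, 1} (\<lambda>_. borel))" by (intro sets_PiM_cong) auto
  define S :: "nat \<Rightarrow> nat \<Rightarrow> real" where "S i j = (if i = 1 \<and> j = 1 then - 1 else 1) / sqrt 2" for i j
  have orth: "orthogonal_on {0, 1} S"
    by (auto simp: orthogonal_on_def S_def)
  have int: "integrable std_normal_distribution (\<lambda>x. iexp (c * ((x\<^sup>2 - 1) / 2)))" for c
    by (intro G.integrable_const_bound[where B = 1]) (auto simp: norm_exp_i_times)
  have cnj: "cnj (chisq_char s) = chisq_char (- s)"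
  proof -
    have "cnj (chisq_char s) = (\<integral>x. cnj (iexp (s * ((x\<^sup>2 - 1) / 2))) \<partial>std_normal_distribution)"
      unfolding chisq_char_def by (rule Bochner_Integration.integral_cnj[symmetric])
    then show ?thesis unfolding chisq_char_def by (simp add: exp_cnj)
  qed
  define f where "f x = iexp (s * (((x 0)\<^sup>2 - (x 1)\<^sup>2) / 2))" for x :: "nat \<Rightarrow> real"
  have f [measurable]: "f \<in> borel_measurable (PiM {0, 1} (\<lambda>_. borel))" unfolding f_def by measurable
  have "chisq_char s * chisq_char (- s) = (\<Prod>i\<in>{0, 1::nat}. \<integral>x. iexp ((if i = 0 then s else - s) * ((x\<^sup>2 - 1) / 2)) \<partial>std_normal_distribution)"
    by (simp add: chisq_char_def)
  also have "\<dots> = (\<integral>x. (\<Prod>i\<in>{0, 1}. iexp ((if i = 0 then s else - s) * (((x i)\<^sup>2 - 1) / 2))) \<partial>?P)"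
    by (intro P.product_integral_prod[symmetric] int) simp
  also have "\<dots> = (\<integral>x. f x \<partial>?P)"
  proof (intro Bochner_Integration.integral_cong refl)
    fix x :: "nat \<Rightarrow> real"
    have "iexp u * iexp v = iexp (u + v)" for u v :: real by (simp add: exp_add[symmetric] distrib_left)
    from this[of "s * (((x 0)\<^sup>2 - 1) / 2)" "- s * (((x 1)\<^sup>2 - 1) / 2)"]
    have "iexp (s * (((x 0)\<^sup>2 - 1) / 2)) * iexp (- s * (((x 1)\<^sup>2 - 1) / 2))
        = iexp (s * (((x 0)\<^sup>2 - 1) / 2) + - s * (((x 1)\<^sup>2 - 1) / 2))" .
    also have "s * (((x 0)\<^sup>2 - 1) / 2) + - s * (((x 1)\<^sup>2 - 1) / 2) = s * (((x 0)\<^sup>2 - (x 1)\<^sup>2) / 2)"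
      by (simp add: field_simps)
    finally show "(\<Prod>i\<in>{0, 1}. iexp ((if i = 0 then s else - s) * (((x i)\<^sup>2 - 1) / 2))) = f x"
      by (simp add: f_def)
  qed
  also have "\<dots> = (\<integral>x. f x \<partial>distr ?P (PiM {0, 1} (\<lambda>_. borel)) (mat_app {0, 1} S))"
    unfolding P by (subst distr_normal_PiM_orthogonal[OF orth]) auto
  also have "\<dots> = (\<integral>x. f (mat_app {0, 1} S x) \<partial>?P)"
    by (intro integral_distr) auto
  also have "\<dots> = (\<integral>x. iexp (s * (x 0 * x 1)) \<partial>?P)"
  proof (intro Bochner_Integration.integral_cong refl)
    fix x :: "nat \<Rightarrow> real"
    have "(mat_app {0, 1} S x 0)\<^sup>2 - (mat_app {0, 1} S x 1)\<^sup>2 = 2 * (x 0 * x 1)"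
      by (simp add: mat_app_def S_def power_divide add_divide_distrib[symmetric] diff_divide_distrib[symmetric])
        (simp add: power2_eq_square algebra_simps)
    then show "f (mat_app {0, 1} S x) = iexp (s * (x 0 * x 1))" by (simp add: f_def)
  qed
  \<comment> \<open>With coordinate 1 fixed, the inner integral is the normal characteristic
    function. What remains is the Gaussian integral of exp(-s^2 x^2/2).\<close>
  also have "\<dots> = (\<integral>x. (\<integral>y. iexp (s * ((x(0 := y)) 0 * (x(0 := y)) 1)) \<partial>std_normal_distribution) \<partial>PiM {1::nat} (\<lambda>_. std_normal_distribution))"
  proof -
    have int2: "integrable (PiM (insert 0 {1}) (\<lambda>_. std_normal_distribution)) (\<lambda>x. iexp (s * (x (0::nat) * x 1)))"
      by (intro PP.integrable_const_bound[where B = 1]) (auto simp: norm_exp_i_times)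
    show ?thesis
      by (rule P.product_integral_insert[OF _ _ int2]) auto
  qed
  also have "\<dots> = (\<integral>x. char std_normal_distribution (s * x 1) \<partial>PiM {1::nat} (\<lambda>_. std_normal_distribution))"
    by (simp add: char_def mult_ac)
  also have "\<dots> = (\<integral>x. char std_normal_distribution (s * x) \<partial>std_normal_distribution)"
    by (rule P.product_integral_singleton) (simp add: char_std_normal_distribution)
  also have "\<dots> = of_real (\<integral>x. exp (- (s * x)\<^sup>2 / 2) \<partial>std_normal_distribution)"
    by (simp add: char_std_normal_distribution)
  also have "(\<integral>x. exp (- (s * x)\<^sup>2 / 2) \<partial>std_normal_distribution) = (\<integral>x. std_normal_density x * exp (- (s * x)\<^sup>2 / 2) \<partial>lborel)"
    by (subst integral_density) auto
  also have "\<dots> = (\<integral>x. 1 / sqrt (1 + s\<^sup>2) * normal_density 0 (1 / sqrt (1 + s\<^sup>2)) x \<partial>lborel)"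
  proof (intro Bochner_Integration.integral_cong refl)
    fix x :: real
    have pos: "1 + s\<^sup>2 > 0" by (simp add: add_pos_nonneg)
    have "std_normal_density x * exp (- (s * x)\<^sup>2 / 2) = 1 / sqrt (2 * pi) * exp (- ((1 + s\<^sup>2) * x\<^sup>2 / 2))"
      by (simp add: std_normal_density_def exp_add[symmetric] power_mult_distrib algebra_simps add_divide_distrib)
    also have "\<dots> = 1 / sqrt (1 + s\<^sup>2) * normal_density 0 (1 / sqrt (1 + s\<^sup>2)) x"
      using pos by (simp add: normal_density_def power_divide real_sqrt_mult real_sqrt_divide mult.commute)
    finally show "std_normal_density x * exp (- (s * x)\<^sup>2 / 2) = 1 / sqrt (1 + s\<^sup>2) * normal_density 0 (1 / sqrt (1 + s\<^sup>2)) x" .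
  qed
  also have "\<dots> = 1 / sqrt (1 + s\<^sup>2)"
    by (simp add: integral_normal_density add_pos_nonneg)
  finally have "chisq_char s * cnj (chisq_char s) = of_real (1 / sqrt (1 + s\<^sup>2))" unfolding cnj .
  then have "of_real ((cmod (chisq_char s))\<^sup>2) = (of_real (1 / sqrt (1 + s\<^sup>2)) :: complex)"
    by (simp only: complex_norm_square)
  then show ?thesis by (simp only: of_real_eq_iff)
qed

text \<open>For |s| <= 1 both functions are compared with 1 - s^2/4. For larger |s| both have
  modulus at most 1, so their distance is at most 2 <= 2 |s|^3; hence \<open>\<kappa> + 2\<close>
  serves on the whole line.\<close>

lemma chisq_char_gauss_approx:
  obtains \<kappa> :: real where "\<kappa> > 0" "\<And>s. cmod (chisq_char s - of_real (exp (- s\<^sup>2 / 4))) \<le> \<kappa> * \<bar>s\<bar> ^ 3"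
proof -
  obtain \<kappa> where \<kappa>: "\<kappa> \<ge> 0" "\<And>s. cmod (chisq_char s - (1 - of_real (s\<^sup>2 / 4))) \<le> \<kappa> * \<bar>s\<bar> ^ 3"
    using chisq_char_taylor by blast
  have chi1: "cmod (chisq_char s) \<le> 1" for s
  proof -
    have "(cmod (chisq_char s))\<^sup>2 \<le> 1" unfolding cmod_chisq_char by (simp add: add_pos_nonneg)
    then show ?thesis by (simp add: power2_le_iff_abs_le abs_square_le_1)
  qed
  show thesis
  proof
    show "\<kappa> + 2 > 0" using \<kappa> by simp
    fix s :: real
    show "cmod (chisq_char s - of_real (exp (- s\<^sup>2 / 4))) \<le> (\<kappa> + 2) * \<bar>s\<bar> ^ 3"
    proof (cases "\<bar>s\<bar> \<le> 1")
      case True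
      have "\<bar>1 - s\<^sup>2 / 4 - exp (- s\<^sup>2 / 4)\<bar> \<le> 2 * \<bar>s\<bar> ^ 3"
      proof -
        define u where "u = s\<^sup>2 / 4"
        have s2: "s\<^sup>2 \<le> 1" using True by (simp add: abs_square_le_1)
        have u: "0 \<le> u" "u \<le> 1" using s2 by (auto simp: u_def)
        have 1: "1 - u \<le> exp (- u)" using exp_ge_add_one_self[of "-u"] by simp
        have "exp (- u) * (1 + u) \<le> 1"
          using exp_ge_add_one_self[of u] by (simp add: exp_minus field_simps)
        also have "1 \<le> (1 - u + u\<^sup>2) * (1 + u)" using u by (simp add: algebra_simps power2_eq_square)
        finally have "exp (- u) \<le> 1 - u + u\<^sup>2" using u by (simp add: mult_le_cancel_right)
        then have "exp (- u) \<le> 1 - u + u\<^sup>2" .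
        with 1 have "\<bar>1 - u - exp (- u)\<bar> \<le> u\<^sup>2" by auto
        also have "u\<^sup>2 = \<bar>s\<bar> ^ 3 * \<bar>s\<bar> / 16" by (simp add: u_def power2_eq_square power3_eq_cube)
        also have "\<dots> \<le> \<bar>s\<bar> ^ 3 * 1 / 16" using True by (intro divide_right_mono mult_left_mono) auto
        also have "\<dots> \<le> 2 * \<bar>s\<bar> ^ 3" by simp
        finally show ?thesis by (simp add: u_def)
      qed
      then have 2: "cmod ((1 - of_real (s\<^sup>2 / 4)) - of_real (exp (- s\<^sup>2 / 4))) \<le> 2 * \<bar>s\<bar> ^ 3"
      proof -
        have "(1 - of_real (s\<^sup>2 / 4)) - of_real (exp (- s\<^sup>2 / 4)) = (of_real (1 - s\<^sup>2 / 4 - exp (- s\<^sup>2 / 4)) :: complex)"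
          by simp
        with \<open>\<bar>1 - s\<^sup>2 / 4 - exp (- s\<^sup>2 / 4)\<bar> \<le> 2 * \<bar>s\<bar> ^ 3\<close> show ?thesis by (simp only: norm_of_real)
      qed
      have "cmod (chisq_char s - of_real (exp (- s\<^sup>2 / 4))) \<le> cmod (chisq_char s - (1 - of_real (s\<^sup>2 / 4))) + cmod ((1 - of_real (s\<^sup>2 / 4)) - of_real (exp (- s\<^sup>2 / 4)))"
      proof -
        have "cmod (A - C) \<le> cmod (A - B) + cmod (B - C)" for A B C
          using norm_triangle_ineq[of "A - B" "B - C"] by simp
        then show ?thesis .
      qed
      then show ?thesis using 2 \<kappa>(2)[of s] by (simp add: distrib_right)
    next
      case False
      have "cmod (chisq_char s - of_real (exp (- s\<^sup>2 / 4))) \<le> cmod (chisq_char s) + cmod (of_real (exp (- s\<^sup>2 / 4)))"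
        by (rule norm_triangle_ineq4)
      also have "\<dots> \<le> 1 + 1" using chi1 by (intro add_mono) (auto simp: norm_of_real)
      also have "\<dots> \<le> (\<kappa> + 2) * 1" using \<kappa> by simp
      also have "\<dots> \<le> (\<kappa> + 2) * \<bar>s\<bar> ^ 3" using False \<kappa> by (intro mult_left_mono one_le_power) auto
      finally show ?thesis .
    qed
  qed
qed

section \<open>Gaussian approximation of products of characteristic functions\<close>

lemma integral_inverse_1_plus_square:
  assumes "0 < (c::real)"
  shows "integrable lborel (\<lambda>t. 1 / (1 + c * t\<^sup>2))"
    and "(\<integral>t. 1 / (1 + c * t\<^sup>2) \<partial>lborel) = pi / sqrt c"
proof -
  have U: "einterval (-\<infinity>) \<infinity> = UNIV" by (auto simp: einterval_def)
  have i: "integrable lborel (\<lambda>t::real. inverse (1 + t\<^sup>2))"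
    using integrable_inverse_1_plus_square by (simp add: set_integrable_def U)
  have v: "(\<integral>t. inverse (1 + t\<^sup>2) \<partial>lborel) = pi"
    using LBINT_inverse_1_plus_square by (simp add: interval_lebesgue_integral_def set_lebesgue_integral_def U)
  have e: "(\<lambda>t. 1 / (1 + c * t\<^sup>2)) = (\<lambda>t. inverse (1 + (0 + sqrt c * t)\<^sup>2))"
    using assms by (simp add: fun_eq_iff inverse_eq_divide power_mult_distrib)
  show "integrable lborel (\<lambda>t. 1 / (1 + c * t\<^sup>2))"
    unfolding e using assms by (intro lborel_integrable_real_affine i) simp
  show "(\<integral>t. 1 / (1 + c * t\<^sup>2) \<partial>lborel) = pi / sqrt c"
    unfolding e using lborel_integral_real_affine[of "sqrt c" "\<lambda>t. inverse (1 + t\<^sup>2)" 0] v assms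
    by (simp add: field_simps)
qed

text \<open>Division by \<open>q\<close> reduces to factors of modulus at most 1. The retained power
  of \<open>q\<close> is the purpose: exchanging one factor keeps the decay of all the
  others.\<close>

lemma norm_prod_diff_le:
  fixes z w :: "'i \<Rightarrow> complex"
  assumes "finite I" "q > 0" "\<And>i. i \<in> I \<Longrightarrow> norm (z i) \<le> q" "\<And>i. i \<in> I \<Longrightarrow> norm (w i) \<le> q"
  shows "norm ((\<Prod>i\<in>I. z i) - (\<Prod>i\<in>I. w i)) \<le> q ^ (card I - 1) * (\<Sum>i\<in>I. norm (z i - w i))"
proof (cases "I = {}")
  case False
  define z' where "z' i = z i / of_real q" for i
  define w' where "w' i = w i / of_real q" for i
  have "norm ((\<Prod>i\<in>I. z' i) - (\<Prod>i\<in>I. w' i)) \<le> (\<Sum>i\<in>I. norm (z' i - w' i))"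
    using assms by (intro norm_prod_diff) (auto simp: z'_def w'_def norm_divide)
  also have "\<dots> = (\<Sum>i\<in>I. norm (z i - w i)) / q"
    using assms(2) by (simp add: z'_def w'_def diff_divide_distrib[symmetric] norm_divide sum_divide_distrib)
  finally have *: "norm ((\<Prod>i\<in>I. z' i) - (\<Prod>i\<in>I. w' i)) \<le> (\<Sum>i\<in>I. norm (z i - w i)) / q" .
  have "(\<Prod>i\<in>I. z i) - (\<Prod>i\<in>I. w i) = of_real (q ^ card I) * ((\<Prod>i\<in>I. z' i) - (\<Prod>i\<in>I. w' i))"
    using assms(2) by (simp add: z'_def w'_def prod_dividef right_diff_distrib)
  then have "norm ((\<Prod>i\<in>I. z i) - (\<Prod>i\<in>I. w i)) = q ^ card I * norm ((\<Prod>i\<in>I. z' i) - (\<Prod>i\<in>I. w' i))"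
    using assms(2) by (simp only: norm_mult norm_of_real) simp
  also have "\<dots> \<le> q ^ card I * ((\<Sum>i\<in>I. norm (z i - w i)) / q)"
    using * assms(2) by (intro mult_left_mono) auto
  also have "\<dots> = q ^ (card I - 1) * (\<Sum>i\<in>I. norm (z i - w i))"
    using False assms(1,2) by (cases "card I") auto
  finally show ?thesis .
qed simp

definition chisq_sum :: "'i set \<Rightarrow> ('i \<Rightarrow> real) \<Rightarrow> ('i \<Rightarrow> real) \<Rightarrow> real" where
  "chisq_sum I b x = (\<Sum>i\<in>I. b i * (((x i)\<^sup>2 - 1) / 2))"

lemma measurable_chisq_sum [measurable]: "chisq_sum I b \<in> borel_measurable (PiM I (\<lambda>_. borel))"
  unfolding chisq_sum_def by measurable

lemma char_chisq_sum:
  assumes "finite I"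
  shows "char (distr (normal_PiM I (\<lambda>_. 0) (\<lambda>_. 1)) borel (chisq_sum I b)) t = (\<Prod>i\<in>I. chisq_char (b i * t))"
proof -
  interpret G: real_distribution std_normal_distribution by (rule real_dist_normal_dist)
  interpret P: product_prob_space "\<lambda>_::'a. std_normal_distribution" ..
  have P: "PiM I (\<lambda>_. std_normal_distribution) = normal_PiM I (\<lambda>_. 0) (\<lambda>_. 1)" by (simp add: normal_PiM_def)
  have "char (distr (normal_PiM I (\<lambda>_. 0) (\<lambda>_. 1)) borel (chisq_sum I b)) t
      = (\<integral>x. iexp (t * chisq_sum I b x) \<partial>normal_PiM I (\<lambda>_. 0) (\<lambda>_. 1))"
    unfolding char_def by (subst integral_distr) auto
  also have "\<dots> = (\<integral>x. (\<Prod>i\<in>I. iexp ((b i * t) * (((x i)\<^sup>2 - 1) / 2))) \<partial>PiM I (\<lambda>_. std_normal_distribution))"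
    unfolding P
  proof (intro Bochner_Integration.integral_cong refl)
    fix x :: "'a \<Rightarrow> real"
    have "iexp (t * chisq_sum I b x) = exp (\<Sum>i\<in>I. \<i> * of_real ((b i * t) * (((x i)\<^sup>2 - 1) / 2)))"
      by (simp add: chisq_sum_def sum_distrib_left mult_ac)
    then show "iexp (t * chisq_sum I b x) = (\<Prod>i\<in>I. iexp ((b i * t) * (((x i)\<^sup>2 - 1) / 2)))"
      using assms by (simp only: exp_sum)
  qed
  also have "\<dots> = (\<Prod>i\<in>I. chisq_char (b i * t))"
    unfolding chisq_char_def using assms
    by (intro P.product_integral_prod) (auto intro!: G.integrable_const_bound[where B = 1] simp: norm_exp_i_times)
  finally show ?thesis .
qed

text \<open>Exchanging the n factors one by one costs at most n \<open>\<kappa>\<close> |t|^3, while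
  the n - 1 untouched factors decay like (1 + c n t^2)^(-2). One power of this decay absorbs n t^2.
  The other remains integrable in t, with integral of order n^(-1/2).\<close>

lemma char_chisq_sum_gauss_approx:
  fixes b :: "'i \<Rightarrow> real" and \<kappa> :: real
  assumes \<kappa>: "0 < \<kappa>" "\<And>s. cmod (chisq_char s - of_real (exp (- s\<^sup>2 / 4))) \<le> \<kappa> * \<bar>s\<bar> ^ 3"
    and I: "finite I" "16 \<le> card I" and b0: "0 < b0"
    and b: "\<And>i. i \<in> I \<Longrightarrow> b0 \<le> b i" "\<And>i. i \<in> I \<Longrightarrow> b i \<le> 1"
  shows "cmod ((\<Prod>i\<in>I. chisq_char (b i * t)) - of_real (exp (- ((\<Sum>i\<in>I. (b i)\<^sup>2) / 2) * t\<^sup>2 / 2)))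
    \<le> \<bar>t\<bar> * ((16 * \<kappa> / b0\<^sup>2) * (1 / (1 + (real (card I) * b0\<^sup>2 / 16) * t\<^sup>2)))"
proof -
  define n where "n = card I"
  define u where "u = b0\<^sup>2 * t\<^sup>2"
  have u: "u \<ge> 0" by (simp add: u_def)
  \<comment> \<open>q = (1 + u)^(-1/4) dominates the chi-square factors, by the exact formula for
    their modulus, and the Gaussian factors, by 1 + x <= exp x.\<close>
  define q where "q = 1 / sqrt (sqrt (1 + u))"
  have q: "q > 0" "q \<le> 1" using u by (auto simp: q_def)
  have q2: "q\<^sup>2 = 1 / sqrt (1 + u)" using u by (simp add: q_def power_divide)
  have us: "u \<le> (b i * t)\<^sup>2" if "i \<in> I" for i
    unfolding u_def power_mult_distrib using b(1)[OF that] b0 by (intro mult_right_mono power_mono) auto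
  have "16 \<le> n" using I by (simp add: n_def)
  have chi_q: "cmod (chisq_char (b i * t)) \<le> q" if "i \<in> I" for i
  proof (rule power2_le_imp_le)
    show "(cmod (chisq_char (b i * t)))\<^sup>2 \<le> q\<^sup>2"
      unfolding q2 cmod_chisq_char using us[OF that] u by (intro divide_left_mono) (auto intro!: mult_pos_pos)
  qed (use q in simp)
  have gauss_q: "cmod (of_real (exp (- (b i * t)\<^sup>2 / 4))) \<le> q" if "i \<in> I" for i
  proof -
    let ?s = "b i * t"
    have "sqrt (1 + ?s\<^sup>2) \<le> exp (?s\<^sup>2 / 2)"
      using exp_ge_add_one_self[of "?s\<^sup>2"] by (intro real_le_lsqrt) (auto simp: exp_double[symmetric])
    then have "exp (- ?s\<^sup>2 / 2) \<le> 1 / sqrt (1 + ?s\<^sup>2)"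
      by (simp add: exp_minus field_simps add_pos_nonneg)
    also have "\<dots> \<le> q\<^sup>2" unfolding q2 using us[OF that] u by (intro divide_left_mono) (auto intro!: mult_pos_pos)
    also have "exp (- ?s\<^sup>2 / 2) = (exp (- ?s\<^sup>2 / 4))\<^sup>2" by (simp add: exp_double[symmetric])
    finally have "exp (- ?s\<^sup>2 / 4) \<le> q" by (rule power2_le_imp_le) (use q in simp)
    then show ?thesis by (simp only: norm_of_real abs_exp_cancel)
  qed
  have "of_real (exp (- ((\<Sum>i\<in>I. (b i)\<^sup>2) / 2) * t\<^sup>2 / 2)) = (\<Prod>i\<in>I. of_real (exp (- (b i * t)\<^sup>2 / 4)) :: complex)"
  proof -
    have "- ((\<Sum>i\<in>I. (b i)\<^sup>2) / 2) * t\<^sup>2 / 2 = (\<Sum>i\<in>I. - (b i * t)\<^sup>2 / 4)"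
      by (simp add: sum_negf sum_divide_distrib sum_distrib_right power_mult_distrib)
    then show ?thesis using I by (simp only: exp_sum of_real_prod)
  qed
  then have "cmod ((\<Prod>i\<in>I. chisq_char (b i * t)) - of_real (exp (- ((\<Sum>i\<in>I. (b i)\<^sup>2) / 2) * t\<^sup>2 / 2)))
      \<le> q ^ (n - 1) * (\<Sum>i\<in>I. cmod (chisq_char (b i * t) - of_real (exp (- (b i * t)\<^sup>2 / 4))))"
    unfolding n_def using norm_prod_diff_le[OF I(1) q(1) chi_q gauss_q] by simp
  also have "\<dots> \<le> q ^ (n - 1) * (\<Sum>i\<in>I. \<kappa> * \<bar>t\<bar> ^ 3)"
  proof (intro mult_left_mono sum_mono)
    fix i assume i: "i \<in> I"
    have "\<bar>b i * t\<bar> \<le> 1 * \<bar>t\<bar>" unfolding abs_mult using b[OF i] b0 by (intro mult_right_mono) auto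
    then have "\<bar>b i * t\<bar> ^ 3 \<le> \<bar>t\<bar> ^ 3" by (intro power_mono) auto
    then show "cmod (chisq_char (b i * t) - of_real (exp (- (b i * t)\<^sup>2 / 4))) \<le> \<kappa> * \<bar>t\<bar> ^ 3"
      using \<kappa>(2)[of "b i * t"] \<kappa>(1) by (smt (verit) mult_left_mono)
  qed (use q in simp)
  also have "\<dots> = q ^ (n - 1) * (real n * \<kappa> * \<bar>t\<bar> ^ 3)" by (simp add: n_def)
  also have "\<dots> \<le> (1 / (1 + real n * u / 16)\<^sup>2) * (real n * \<kappa> * \<bar>t\<bar> ^ 3)"
  proof (intro mult_right_mono)
    \<comment> \<open>Eight factors q give (1 + u)^(-2), so \<open>j\<close> counts full blocks of
      eight among n - 1 factors. For n >= 16 this loses at most a factor 2, that is n <= 16 j, and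
      Bernoulli's inequality makes the bound linear in n u.\<close>
    define j where "j = (n - 1) div 8"
    have "8 * j \<le> n - 1" by (simp add: j_def)
    have j16: "n \<le> 16 * j" using \<open>16 \<le> n\<close> unfolding j_def by presburger
    have "q ^ (n - 1) \<le> q ^ (8 * j)" using q \<open>8 * j \<le> n - 1\<close> by (intro power_decreasing) auto
    also have "q ^ (8 * j) = (1 / ((1 + u) ^ j)\<^sup>2)"
    proof -
      have "q ^ (8 * j) = (((q\<^sup>2)\<^sup>2)\<^sup>2) ^ j" by (simp add: power_mult[symmetric])
      also have "(q\<^sup>2)\<^sup>2 = 1 / (1 + u)" unfolding q2 using u by (simp add: power_divide)
      finally show ?thesis by (simp add: power_divide power_mult[symmetric] mult.commute)
    qed
    also have "\<dots> \<le> 1 / (1 + real n * u / 16)\<^sup>2"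
    proof (intro divide_left_mono power_mono)
      have pos: "0 < 1 + real n * u / 16" using u by (intro add_pos_nonneg) auto
      then show "0 \<le> 1 + real n * u / 16" by simp
      show "0 < ((1 + u) ^ j)\<^sup>2 * (1 + real n * u / 16)\<^sup>2"
        using pos u by (auto intro!: mult_pos_pos zero_less_power)
      have "1 + real n * u / 16 \<le> 1 + real j * u"
        using j16 u mult_right_mono[of "real n" "16 * real j" u] by simp
      also have "\<dots> \<le> (1 + u) ^ j" using Bernoulli_inequality[of u j] u by (simp add: mult.commute)
      finally show "1 + real n * u / 16 \<le> (1 + u) ^ j" .
    qed simp
    finally show "q ^ (n - 1) \<le> 1 / (1 + real n * u / 16)\<^sup>2" .
  qed (use \<kappa> in simp)
  also have "\<dots> \<le> \<bar>t\<bar> * ((16 * \<kappa> / b0\<^sup>2) * (1 / (1 + (real n * b0\<^sup>2 / 16) * t\<^sup>2)))"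
  proof -
    \<comment> \<open>In terms of \<open>y\<close> the numerator n |t|^3 is a multiple of |t| y, and
      y/(1 + y)^2 <= 1/(1 + y).\<close>
    define y where "y = real n * u / 16"
    have y: "y \<ge> 0" using u by (simp add: y_def)
    have nt: "real n * t\<^sup>2 = 16 / b0\<^sup>2 * y" using b0 by (simp add: y_def u_def)
    have "real n * \<kappa> * \<bar>t\<bar> ^ 3 = \<bar>t\<bar> * \<kappa> * (real n * t\<^sup>2)"
      by (simp add: power3_eq_cube power2_eq_square mult_ac)
    then have "real n * \<kappa> * \<bar>t\<bar> ^ 3 = \<bar>t\<bar> * (16 * \<kappa> / b0\<^sup>2) * y"
      unfolding nt by simp
    then have "(1 / (1 + y)\<^sup>2) * (real n * \<kappa> * \<bar>t\<bar> ^ 3) = \<bar>t\<bar> * (16 * \<kappa> / b0\<^sup>2) * (y / (1 + y)\<^sup>2)" by simp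
    also have "\<dots> \<le> \<bar>t\<bar> * (16 * \<kappa> / b0\<^sup>2) * (1 / (1 + y))"
      using y \<kappa> by (intro mult_left_mono) (auto simp: power2_eq_square divide_simps)
    finally show ?thesis by (simp add: y_def u_def mult_ac)
  qed
  finally show ?thesis by (simp add: n_def)
qed

text \<open>The shift by $1$ makes room for a common continuity point of the two distributions.\<close>

lemma chisq_sum_tail_lower:
  assumes b0: "0 < b0"
  shows "\<exists>K>0. \<forall>(I::nat set) b x. finite I \<longrightarrow> 16 \<le> card I \<longrightarrow> (\<forall>i\<in>I. b0 \<le> b i \<and> b i \<le> 1) \<longrightarrow>
      measure std_normal_distribution {(x + 1) / sqrt ((\<Sum>i\<in>I. (b i)\<^sup>2) / 2)<..} - K / sqrt (card I)
      \<le> measure (normal_PiM I (\<lambda>_. 0) (\<lambda>_. 1)) {z \<in> space (normal_PiM I (\<lambda>_. 0) (\<lambda>_. 1)). x \<le> chisq_sum I b z}"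
proof -
  interpret G: real_distribution std_normal_distribution by (rule real_dist_normal_dist)
  obtain \<kappa> where \<kappa>: "0 < \<kappa>" "\<And>s. cmod (chisq_char s - of_real (exp (- s\<^sup>2 / 4))) \<le> \<kappa> * \<bar>s\<bar> ^ 3"
    using chisq_char_gauss_approx by blast
  \<comment> \<open>The majorant (16 \<open>\<kappa>\<close>/b0^2)/(1 + (n b0^2/16) t^2) integrates
    to (16 \<open>\<kappa>\<close>/b0^2) pi 4/(b0 sqrt n); dividing by pi gives K/sqrt n.\<close>
  define K where "K = 64 * \<kappa> / b0 ^ 3"
  show ?thesis
  proof (intro exI[of _ K] conjI allI impI)
    show "0 < K" using \<kappa> b0 by (simp add: K_def)
    fix I :: "nat set" and b :: "nat \<Rightarrow> real" and x :: real
    assume I: "finite I" "16 \<le> card I" and b: "\<forall>i\<in>I. b0 \<le> b i \<and> b i \<le> 1"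
    let ?N = "normal_PiM I (\<lambda>_. 0) (\<lambda>_. 1)"
    interpret N: prob_space ?N by (rule prob_space_normal_PiM) simp
    define v where "v = (\<Sum>i\<in>I. (b i)\<^sup>2) / 2"
    have "(\<Sum>i\<in>I. (b i)\<^sup>2) > 0"
      using I b b0 by (intro sum_pos) (force simp: card_gt_0_iff zero_less_power2)+
    then have v: "v > 0" by (simp add: v_def)
    define M1 where "M1 = distr ?N borel (chisq_sum I b)"
    define M2 where "M2 = distr std_normal_distribution borel (\<lambda>u. sqrt v * u)"
    interpret M1: real_distribution M1 unfolding M1_def by (intro N.real_distribution_distr) simp
    interpret M2: real_distribution M2 unfolding M2_def by (intro G.real_distribution_distr) simp
    have char2: "char M2 t = of_real (exp (- v * t\<^sup>2 / 2))" for t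
    proof -
      have "char M2 t = char std_normal_distribution (sqrt v * t)"
        unfolding M2_def char_def by (subst integral_distr) (auto simp: mult_ac)
      then show ?thesis using v by (simp add: char_std_normal_distribution power_mult_distrib)
    qed
    define h where "h t = (16 * \<kappa> / b0\<^sup>2) * (1 / (1 + (real (card I) * b0\<^sup>2 / 16) * t\<^sup>2))" for t
    have c: "real (card I) * b0\<^sup>2 / 16 > 0" using I b0 by simp
    have h_int: "integrable lborel h"
      unfolding h_def using integral_inverse_1_plus_square(1)[OF c] by (intro integrable_mult_right)
    have "(\<integral>t. h t \<partial>lborel) = (16 * \<kappa> / b0\<^sup>2) * (pi / sqrt (real (card I) * b0\<^sup>2 / 16))"
        unfolding h_def integral_mult_right_zero integral_inverse_1_plus_square(2)[OF c] ..
    also have "\<dots> = pi * (K / sqrt (card I))"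
      using b0 by (simp add: K_def real_sqrt_divide real_sqrt_mult power2_eq_square power3_eq_cube mult_ac)
    finally have h_val: "(\<integral>t. h t \<partial>lborel) / pi = K / sqrt (card I)" by simp
    have count: "countable {x. measure M1 {x} \<noteq> 0 \<or> measure M2 {x} \<noteq> 0}"
      using countable_Un[OF M1.countable_support M2.countable_support] by (simp add: Un_def)
    obtain y where y: "x < y" "y < x + 1" "measure M1 {y} = 0" "measure M2 {y} = 0"
      using open_minus_countable[OF count, of "{x<..<x + 1}"] by auto
    have "\<bar>cdf M1 y - cdf M2 y\<bar> \<le> (\<integral>t. h t \<partial>lborel) / pi"
    proof (rule cdf_diff_le_char_diff[OF M1.real_distribution_axioms M2.real_distribution_axioms h_int _ _ y(3,4)])
      show "0 \<le> h t" for t using \<kappa> by (simp add: h_def)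
      show "cmod (char M1 t - char M2 t) \<le> \<bar>t\<bar> * h t" for t
        unfolding char2 h_def M1_def char_chisq_sum[OF I(1)] v_def
        using b by (intro char_chisq_sum_gauss_approx[OF \<kappa> I b0]) auto
    qed
    then have diff: "cdf M1 y - cdf M2 y \<le> K / sqrt (card I)" unfolding h_val by linarith
    have tail: "measure M {y<..} = 1 - cdf M y" if "real_distribution M" for M
    proof -
      interpret M: real_distribution M by (rule that)
      have "{y<..} = space M - {..y}" by auto
      then show ?thesis using M.prob_compl[of "{..y}"] by (simp add: cdf_def)
    qed
    have "measure std_normal_distribution {(x + 1) / sqrt v<..} = measure M2 {x + 1<..}"
      unfolding M2_def using v by (subst measure_distr) (auto intro!: arg_cong[where f = "measure _"] simp: divide_less_eq mult.commute)
    also have "\<dots> \<le> measure M2 {y<..}" using y by (intro M2.finite_measure_mono) auto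
    also have "\<dots> \<le> measure M1 {y<..} + K / sqrt (card I)"
      using diff unfolding tail[OF M1.real_distribution_axioms] tail[OF M2.real_distribution_axioms] by linarith
    also have "measure M1 {y<..} = measure ?N {z \<in> space ?N. y < chisq_sum I b z}"
      unfolding M1_def by (subst measure_distr) (auto intro!: arg_cong[where f = "measure _"])
    also have "\<dots> \<le> measure ?N {z \<in> space ?N. x \<le> chisq_sum I b z}"
    proof (intro N.finite_measure_mono)
      show "{z \<in> space ?N. x \<le> chisq_sum I b z} \<in> sets ?N" by measurable
    qed (use y in auto)
    finally show "measure std_normal_distribution {(x + 1) / sqrt ((\<Sum>i\<in>I. (b i)\<^sup>2) / 2)<..} - K / sqrt (card I)
      \<le> measure ?N {z \<in> space ?N. x \<le> chisq_sum I b z}"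
      by (simp add: v_def)
  qed
qed

section \<open>The one-shot converse\<close>

lemma inner_mat_app:
  assumes "orthogonal_on I S" "finite I"
  shows "(\<Sum>k\<in>I. mat_app I S x k * mat_app I S y k) = (\<Sum>k\<in>I. x k * y k)"
proof -
  have "(\<Sum>k\<in>I. mat_app I S x k * mat_app I S y k) = (\<Sum>k\<in>I. \<Sum>j\<in>I. mat_app I S x k * (S k j * y j))"
    by (simp add: mat_app_apply sum_distrib_left)
  also have "\<dots> = (\<Sum>j\<in>I. (\<Sum>k\<in>I. S k j * mat_app I S x k) * y j)"
    by (subst sum.swap) (simp add: sum_distrib_left sum_distrib_right mult_ac)
  also have "\<dots> = (\<Sum>j\<in>I. mat_app I (\<lambda>i j. S j i) (mat_app I S x) j * y j)"
    by (intro sum.cong) (simp_all add: mat_app_apply)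
  also have "\<dots> = (\<Sum>k\<in>I. x k * y k)"
    using mat_app_inverse[OF orthogonal_on_transpose[OF assms(1)]] assms by simp
  finally show ?thesis .
qed

lemma orthogonal_dst: "orthogonal_on {1..n} (dst n)"
  unfolding orthogonal_on_def using dst_orthonormal[of _ n] by (auto simp: dst_sym[of n _ "_ :: nat"])

text \<open>Completing the square in \<open>w\<close> leaves the exponent -(1 - b) e v^2/(2 s2
  \<open>\<omega>\<close>). It is nonpositive since b <= 1 and is dropped, so the prefactor no
  longer depends on \<open>v\<close>, which will encode the codeword.\<close>

lemma dst_tilted_density_bound:
  fixes b v e s2 w :: real
  assumes "s2 > 0" "e > 0" "b \<le> 1"
  defines "\<omega> \<equiv> (1 - b) / s2 + e"
  shows "normal_density 0 (sqrt s2) w * exp (b * w\<^sup>2 / (2 * s2) - e * (w - v)\<^sup>2 / 2)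
    \<le> (1 / sqrt (s2 * \<omega>)) * normal_density (e * v / \<omega>) (1 / sqrt \<omega>) w"
proof -
  have \<omega>: "\<omega> > 0" unfolding \<omega>_def using assms by (intro add_nonneg_pos) auto
  have "\<omega> * (\<omega> * w\<^sup>2 - 2 * (e * v) * w + e * v\<^sup>2) - (\<omega> * w - e * v)\<^sup>2 = ((1 - b) / s2) * e * v\<^sup>2"
  proof -
    have "x * (x * w\<^sup>2 - 2 * (e * v) * w + e * v\<^sup>2) - (x * w - e * v)\<^sup>2 = (x - e) * e * v\<^sup>2" for x
      by (simp add: power2_eq_square algebra_simps)
    from this[of \<omega>] show ?thesis by (simp add: \<omega>_def)
  qed
  moreover have "((1 - b) / s2) * e * v\<^sup>2 \<ge> 0" using assms by simp
  ultimately have "(\<omega> * w - e * v)\<^sup>2 / \<omega> \<le> \<omega> * w\<^sup>2 - 2 * (e * v) * w + e * v\<^sup>2"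
    using \<omega> by (simp add: pos_divide_le_eq mult.commute)
  moreover have "(\<omega> * w - e * v)\<^sup>2 / \<omega> = \<omega> * (w - e * v / \<omega>)\<^sup>2"
    using \<omega> by (simp add: power2_eq_square field_simps)
  moreover have "\<omega> * w\<^sup>2 - 2 * (e * v) * w + e * v\<^sup>2 = w\<^sup>2 / s2 - b * w\<^sup>2 / s2 + e * (w - v)\<^sup>2"
    using assms(1) by (simp add: \<omega>_def power2_eq_square field_simps)
  ultimately have "- w\<^sup>2 / (2 * s2) + (b * w\<^sup>2 / (2 * s2) - e * (w - v)\<^sup>2 / 2) \<le> - (\<omega> * (w - e * v / \<omega>)\<^sup>2) / 2"
    by (simp add: field_simps)
  then have le: "exp (- w\<^sup>2 / (2 * s2)) * exp (b * w\<^sup>2 / (2 * s2) - e * (w - v)\<^sup>2 / 2) \<le> exp (- (\<omega> * (w - e * v / \<omega>)\<^sup>2) / 2)"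
    by (simp add: exp_add[symmetric])
  have "normal_density 0 (sqrt s2) w * exp (b * w\<^sup>2 / (2 * s2) - e * (w - v)\<^sup>2 / 2)
      = (1 / sqrt (2 * pi * s2)) * (exp (- w\<^sup>2 / (2 * s2)) * exp (b * w\<^sup>2 / (2 * s2) - e * (w - v)\<^sup>2 / 2))"
    using assms(1) by (simp add: normal_density_def)
  also have "\<dots> \<le> (1 / sqrt (2 * pi * s2)) * exp (- (\<omega> * (w - e * v / \<omega>)\<^sup>2) / 2)"
    using assms(1) by (intro mult_left_mono le) simp
  also have "\<dots> = (1 / sqrt (s2 * \<omega>)) * normal_density (e * v / \<omega>) (1 / sqrt \<omega>) w"
    using assms(1) \<omega> by (simp add: normal_density_def real_sqrt_mult real_sqrt_divide power_divide field_simps)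
  finally show ?thesis .
qed

lemma distributed_linear_normal_PiM:
  assumes fin: "finite I" and s: "\<And>i. i \<in> I \<Longrightarrow> s i > 0" and nz: "\<exists>i\<in>I. c i \<noteq> 0"
  shows "distributed (normal_PiM I m s) lborel (\<lambda>x. \<Sum>i\<in>I. c i * x i)
    (normal_density (\<Sum>i\<in>I. c i * m i) (sqrt (\<Sum>i\<in>I. (c i * s i)\<^sup>2)))"
proof -
  interpret prob_space "normal_PiM I m s" by (rule prob_space_normal_PiM) (rule s)
  \<comment> \<open>A zero coefficient would contribute a degenerate normal variable, so such
    indices are removed before summing and restored at the end.\<close>
  define J where "J = {i \<in> I. c i \<noteq> 0}"
  have J: "finite J" "J \<noteq> {}" "J \<subseteq> I" using fin nz by (auto simp: J_def)
  have comp: "distributed (normal_PiM I m s) lborel (\<lambda>x. x i) (normal_density (m i) (s i))" if i: "i \<in> I" for i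
  proof -
    have "distr (normal_PiM I m s) (density lborel (normal_density (m i) (s i))) (\<lambda>x. x i) = density lborel (normal_density (m i) (s i))"
      unfolding normal_PiM_def using fin s i by (intro distr_PiM_component prob_space_normal_density) auto
    moreover have "distr (normal_PiM I m s) (density lborel (normal_density (m i) (s i))) (\<lambda>x. x i) = distr (normal_PiM I m s) lborel (\<lambda>x. x i)"
      by (intro distr_cong) auto
    ultimately show ?thesis using i by (auto simp: distributed_def)
  qed
  have "indep_vars (\<lambda>i. borel) (\<lambda>i x. x i) I"
  proof (subst indep_vars_iff_distr_eq_PiM')
    show "I \<noteq> {}" using J by auto
    show "random_variable borel (\<lambda>x. x i)" if "i \<in> I" for i using that by simp
    have "distr (normal_PiM I m s) (PiM I (\<lambda>_. borel)) (\<lambda>x. \<lambda>i\<in>I. x i) = distr (normal_PiM I m s) (normal_PiM I m s) (\<lambda>x. x)"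
      by (intro distr_cong) (auto simp: restrict_def extensional_def fun_eq_iff)
    also have "\<dots> = PiM I (\<lambda>i. distr (normal_PiM I m s) borel (\<lambda>x. x i))"
      unfolding distr_id
    proof (subst normal_PiM_def, intro PiM_cong refl)
      fix i assume "i \<in> I"
      have "distr (normal_PiM I m s) borel (\<lambda>x. x i) = distr (normal_PiM I m s) lborel (\<lambda>x. x i)"
        by (intro distr_cong) auto
      then show "density lborel (normal_density (m i) (s i)) = distr (normal_PiM I m s) borel (\<lambda>x. x i)"
        using comp[OF \<open>i \<in> I\<close>] by (simp add: distributed_def)
    qed
    finally show "distr (normal_PiM I m s) (PiM I (\<lambda>_. borel)) (\<lambda>x. \<lambda>i\<in>I. x i) = PiM I (\<lambda>i. distr (normal_PiM I m s) borel (\<lambda>x. x i))" .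
  qed
  then have "indep_vars (\<lambda>i. borel) (\<lambda>i. (\<lambda>y. c i * y) \<circ> (\<lambda>x. x i)) I"
    by (rule indep_vars_compose) simp
  then have ind: "indep_vars (\<lambda>i. borel) (\<lambda>i x. c i * x i) J"
    using J by (auto simp: o_def intro: indep_vars_subset)
  have dist: "distributed (normal_PiM I m s) lborel (\<lambda>x. c i * x i) (normal_density (c i * m i) (\<bar>c i\<bar> * s i))" if "i \<in> J" for i
    using normal_density_affine[OF comp, of i "c i" 0] that s by (simp add: J_def)
  have "distributed (normal_PiM I m s) lborel (\<lambda>x. \<Sum>i\<in>J. c i * x i)
    (normal_density (\<Sum>i\<in>J. c i * m i) (sqrt (\<Sum>i\<in>J. (\<bar>c i\<bar> * s i)\<^sup>2)))"
    using J s by (intro sum_indep_normal[OF _ _ ind _ dist]) (auto simp: J_def)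
  moreover have "(\<Sum>i\<in>J. f i) = (\<Sum>i\<in>I. f i)" if "\<And>i. i \<in> I \<Longrightarrow> c i = 0 \<Longrightarrow> f i = 0" for f :: "'a \<Rightarrow> real"
    using that fin by (intro sum.mono_neutral_left) (auto simp: J_def)
  ultimately show ?thesis by (simp add: power_mult_distrib)
qed

text \<open>The functional is normal with deviation \<open>\<tau>\<close> whatever the means are, so
  its density is at most 1/(sqrt(2 pi) \<open>\<tau>\<close>), and the bump around \<open>t\<close>
  has mass sqrt(2 pi/\<open>\<beta>\<close>). The bound is thus free of both \<open>m\<close> and
  \<open>t\<close>.\<close>

lemma nn_integral_normal_PiM_linear_exp:
  assumes fin: "finite I" and s: "\<And>i. i \<in> I \<Longrightarrow> s i > 0" and nz: "\<exists>i\<in>I. c i \<noteq> 0" and "\<beta> > 0"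
  defines "\<tau> \<equiv> sqrt (\<Sum>i\<in>I. (c i * s i)\<^sup>2)"
  shows "(\<integral>\<^sup>+x. exp (- \<beta> / 2 * ((\<Sum>i\<in>I. c i * x i) - t)\<^sup>2) \<partial>normal_PiM I m s) \<le> 1 / (\<tau> * sqrt \<beta>)"
proof -
  have "(\<Sum>i\<in>I. (c i * s i)\<^sup>2) > 0"
    using nz s fin by (metis (no_types, lifting) mult_eq_0_iff less_irrefl sum_pos2 zero_le_power2 zero_less_power2)
  then have \<tau>: "\<tau> > 0" by (simp add: \<tau>_def)
  let ?\<mu> = "\<Sum>i\<in>I. c i * m i"
  have sig: "1 / sqrt \<beta> > 0" using \<open>\<beta> > 0\<close> by simp
  have "(\<integral>\<^sup>+x. exp (- \<beta> / 2 * ((\<Sum>i\<in>I. c i * x i) - t)\<^sup>2) \<partial>normal_PiM I m s)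
      = (\<integral>\<^sup>+u. ennreal (normal_density ?\<mu> \<tau> u) * ennreal (exp (- \<beta> / 2 * (u - t)\<^sup>2)) \<partial>lborel)"
    unfolding \<tau>_def
    by (rule distributed_nn_integral[OF distributed_linear_normal_PiM[OF fin s nz], symmetric]) auto
  also have "\<dots> \<le> (\<integral>\<^sup>+u. ennreal (1 / (\<tau> * sqrt \<beta>)) * ennreal (normal_density t (1 / sqrt \<beta>) u) \<partial>lborel)"
  proof (intro nn_integral_mono)
    fix u
    have "normal_density ?\<mu> \<tau> u \<le> 1 / (sqrt (2 * pi) * \<tau>)"
      using \<tau> by (simp add: normal_density_def real_sqrt_mult mult_ac divide_le_eq)
    then have "normal_density ?\<mu> \<tau> u * exp (- \<beta> / 2 * (u - t)\<^sup>2) \<le> 1 / (sqrt (2 * pi) * \<tau>) * exp (- \<beta> / 2 * (u - t)\<^sup>2)"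
      by (intro mult_right_mono) auto
    also have "\<dots> = (1 / (\<tau> * sqrt \<beta>)) * normal_density t (1 / sqrt \<beta>) u"
      using \<tau> \<open>\<beta> > 0\<close> by (simp add: normal_density_def real_sqrt_mult real_sqrt_divide power_divide field_simps)
    finally show "ennreal (normal_density ?\<mu> \<tau> u) * ennreal (exp (- \<beta> / 2 * (u - t)\<^sup>2))
      \<le> ennreal (1 / (\<tau> * sqrt \<beta>)) * ennreal (normal_density t (1 / sqrt \<beta>) u)"
      using \<tau> \<open>\<beta> > 0\<close> by (simp add: ennreal_mult[symmetric] ennreal_leI)
  qed
  also have "\<dots> = ennreal (1 / (\<tau> * sqrt \<beta>))"
    using sig by (subst nn_integral_cmult) (simp_all add: nn_integral_eq_integral)
  finally show ?thesis .
qed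

text \<open>Unrolling the recursion expresses the unstable coordinate through the innovations. The
  exponent \<open>2 * i - j\<close> is a true difference because j <= i in the inner sum.\<close>

lemma gm_source_weighted_sum:
  fixes a :: real
  shows "(\<Sum>i=1..n. a ^ i * gm_source a z i) = (\<Sum>j=1..n. (\<Sum>i=j..n. a ^ (2 * i - j)) * z j)"
proof -
  have gm: "gm_source a z i = (\<Sum>j=1..i. a ^ (i - j) * z j)" for i
  proof (induction i)
    case (Suc i)
    have "a * (\<Sum>j=1..i. a ^ (i - j) * z j) = (\<Sum>j=1..i. a ^ (Suc i - j) * z j)"
      unfolding sum_distrib_left by (intro sum.cong refl) (auto simp: Suc_diff_le)
    then show ?case using Suc by simp
  qed simp
  have "(\<Sum>i=1..n. a ^ i * gm_source a z i) = (\<Sum>i=1..n. \<Sum>j=1..i. a ^ (2 * i - j) * z j)"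
    unfolding gm sum_distrib_left
    by (intro sum.cong refl) (auto simp: power_add[symmetric] mult.assoc[symmetric] mult_2)
  also have "\<dots> = (\<Sum>j=1..n. \<Sum>i=j..n. a ^ (2 * i - j) * z j)"
    by (simp add: sum.Sigma) (rule sum.reindex_bij_witness[of _ prod.swap prod.swap]; auto)
  finally show ?thesis by (simp add: sum_distrib_right)
qed

lemma measurable_gm_source [measurable]:
  assumes "i \<le> n"
  shows "(\<lambda>z. gm_source a z i) \<in> borel_measurable (PiM {1..n} (\<lambda>_. borel))"
  using assms
proof (induction i)
  case (Suc i)
  then have [measurable]: "(\<lambda>z. gm_source a z i) \<in> borel_measurable (PiM {1..n} (\<lambda>_. borel))" by simp
  have [measurable]: "(\<lambda>z. z (Suc i)) \<in> borel_measurable (PiM {1..n} (\<lambda>_. borel :: real measure))"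
    using Suc by (intro measurable_component_singleton) auto
  show ?case unfolding gm_source.simps by measurable
qed simp

section \<open>The exponential moment of the tilted sum\<close>

definition eigval :: "real \<Rightarrow> nat \<Rightarrow> nat \<Rightarrow> real" where
  "eigval a n k = gfun a (pi * real k / real (Suc n))"

text \<open>This is min(theta, sigma^2/g_k)/theta, the reverse water-filling distortion of component
  k relative to the water level.\<close>

definition weight :: "real \<Rightarrow> real \<Rightarrow> real \<Rightarrow> nat \<Rightarrow> nat \<Rightarrow> real" where
  "weight a s2 \<theta> n k = min 1 (s2 / (\<theta> * eigval a n k))"

definition tilted_sum :: "real \<Rightarrow> real \<Rightarrow> real \<Rightarrow> nat \<Rightarrow> (nat \<Rightarrow> real) \<Rightarrow> real" where
  "tilted_sum a s2 \<theta> n w = (\<Sum>k=1..n. weight a s2 \<theta> n k * (w k)\<^sup>2 / (2 * s2))"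

definition log_det_sum :: "real \<Rightarrow> real \<Rightarrow> real \<Rightarrow> nat \<Rightarrow> real" where
  "log_det_sum a s2 \<theta> n = (\<Sum>k=1..n. ln (max (eigval a n k) (s2 / \<theta>)) / 2)"

lemma eigval_pos: "1 < a \<Longrightarrow> 0 < eigval a n k"
  by (simp add: eigval_def gfun_pos)

lemma measurable_tilted_sum [measurable]:
  "tilted_sum a s2 \<theta> n \<in> borel_measurable (PiM {1..n} (\<lambda>_. borel))"
  unfolding tilted_sum_def by measurable

text \<open>In the transformed coordinates the integrand is dominated by a product of one-dimensional Gaussians
  times a Gaussian in the unstable coordinate. The latter contributes the factor $K^{-1/2}$ with
  $K = \sum_{i \le n} a^{2i}$, which is exactly the product of the factors \<open>eigval a n k\<close> to the power
  $-1/2$.\<close>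

lemma tilted_distortion_bound:
  fixes a s2 \<theta> :: real
  assumes a: "1 < a" and s2: "0 < s2" and \<theta>: "0 < \<theta>" and n: "1 \<le> n"
  defines "C \<equiv> 2 * a * sqrt \<theta> / sqrt (min s2 (\<theta> * (a - 1)\<^sup>2))"
  shows "(\<integral>\<^sup>+z. exp (tilted_sum a s2 \<theta> n (mat_app {1..n} (dst n) z)
            - (\<Sum>i=1..n. (gm_source a z i - y i)\<^sup>2) / (2 * \<theta>)) \<partial>normal_PiM {1..n} (\<lambda>_. 0) (\<lambda>_. sqrt s2))
        \<le> C * exp (- log_det_sum a s2 \<theta> n)"
proof -
  let ?I = "{1..n}" and ?W = "mat_app {1..n} (dst n)"
  let ?N = "normal_PiM {1..n} (\<lambda>_. 0) (\<lambda>_. sqrt s2)"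
  define g where "g = eigval a n"
  have g: "g k > 0" for k using a by (simp add: g_def eigval_pos)
  define b where "b = weight a s2 \<theta> n"
  have b: "b k \<le> 1" for k by (simp add: b_def weight_def)
  define K where "K = (\<Sum>i\<le>n. a ^ (2 * i))"
  define e where "e k = 1 / (\<theta> * g k)" for k
  have e: "e k > 0" for k using g \<theta> by (simp add: e_def)
  \<comment> \<open>The precision of coordinate k after tilting: the prior 1/s2, reduced by the
    weight and increased by the distortion term.\<close>
  define \<omega> where "\<omega> k = (1 - b k) / s2 + e k" for k
  have \<omega>_pos: "\<omega> k > 0" for k unfolding \<omega>_def using b e s2 by (intro add_nonneg_pos) auto
  have s2\<omega>: "s2 * \<omega> k = max 1 (s2 / (\<theta> * g k))" for k
    using s2 by (simp add: \<omega>_def e_def b_def weight_def g_def[symmetric] distrib_left min_def max_def)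
  \<comment> \<open>\<open>l\<close> holds the coefficients of the unstable functional in the
    innovations, \<open>c\<close> the same functional in sine coordinates.\<close>
  define l where "l j = (\<Sum>i=j..n. a ^ (2 * i - j))" for j
  define c where "c = ?W l"
  \<comment> \<open>The energy bound needs a sequence vanishing at 0, whereas a reproduction word is
    arbitrary there. \<open>zy\<close> are the innovations that would generate the corrected
    word.\<close>
  define y' where "y' i = (if i = 0 then 0 else y i)" for i
  define zy where "zy i = y' i - a * y' (i - 1)" for i
  define v where "v = ?W zy"
  define t where "t = (\<Sum>i=1..n. a ^ i * y' i)"
  define \<beta> where "\<beta> = 1 / (\<theta> * K)"
  have K_ge: "K \<ge> 2"
  proof -
    have "(\<Sum>i\<in>{0, 1}. a ^ (2 * i)) \<le> K" unfolding K_def using n a by (intro sum_mono2) auto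
    moreover have "a\<^sup>2 \<ge> 1" using a by simp
    ultimately show ?thesis by (simp add: power2_eq_square)
  qed
  have \<beta>: "\<beta> > 0" using K_ge \<theta> by (simp add: \<beta>_def)
  have orth: "orthogonal_on ?I (dst n)" by (rule orthogonal_dst)
  define G where "G w = tilted_sum a s2 \<theta> n w - (\<Sum>k=1..n. e k * (w k - v k)\<^sup>2 / 2) - \<beta> / 2 * ((\<Sum>k=1..n. c k * w k) - t)\<^sup>2" for w
  have Gm [measurable]: "G \<in> borel_measurable (PiM ?I (\<lambda>_. borel))" unfolding G_def by measurable
  have exponent: "tilted_sum a s2 \<theta> n (?W z) - (\<Sum>i=1..n. (gm_source a z i - y i)\<^sup>2) / (2 * \<theta>) \<le> G (?W z)" for z
  proof -
    define \<delta> where "\<delta> i = gm_source a z i - y' i" for i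
    have \<delta>0: "\<delta> 0 = 0" by (simp add: \<delta>_def y'_def)
    have inc: "\<delta> i - a * \<delta> (i - 1) = z i - zy i" if "i \<in> ?I" for i
      using that by (cases i) (auto simp: \<delta>_def zy_def algebra_simps)
    have "(\<Sum>j=1..n. dst n k j * (\<delta> j - a * \<delta> (j - 1))) = ?W z k - v k" if "k \<in> ?I" for k
    proof -
      have "(\<Sum>j=1..n. dst n k j * (\<delta> j - a * \<delta> (j - 1))) = (\<Sum>j=1..n. dst n k j * (z j - zy j))"
        by (intro sum.cong refl) (simp only: inc)
      also have "\<dots> = ?W z k - v k"
        unfolding v_def mat_app_apply[OF that] by (simp add: right_diff_distrib sum_subtractf)
      finally show ?thesis .
    qed
    then have 1: "(\<Sum>k=1..n. (\<Sum>j=1..n. dst n k j * (\<delta> j - a * \<delta> (j - 1)))\<^sup>2 / gfun a (pi * real k / real (Suc n)))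
        = (\<Sum>k=1..n. (?W z k - v k)\<^sup>2 / g k)"
      by (intro sum.cong refl) (simp only: g_def eigval_def)
    have "(\<Sum>i=1..n. a ^ i * \<delta> i) = (\<Sum>i=1..n. a ^ i * gm_source a z i) - t"
      by (simp add: \<delta>_def t_def right_diff_distrib sum_subtractf)
    also have "(\<Sum>i=1..n. a ^ i * gm_source a z i) = (\<Sum>k=1..n. l k * z k)"
      unfolding gm_source_weighted_sum l_def ..
    also have "\<dots> = (\<Sum>k=1..n. c k * ?W z k)"
      unfolding c_def by (rule inner_mat_app[OF orth, symmetric]) simp
    finally have 2: "(\<Sum>i=1..n. a ^ i * \<delta> i) = (\<Sum>k=1..n. c k * ?W z k) - t" .
    have "(\<Sum>k=1..n. (?W z k - v k)\<^sup>2 / g k) + ((\<Sum>k=1..n. c k * ?W z k) - t)\<^sup>2 / K \<le> (\<Sum>i=1..n. (\<delta> i)\<^sup>2)"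
      using energy_lower_bound[of a \<delta>, OF a \<delta>0, of n] unfolding 1 2 K_def .
    moreover have "(\<Sum>i=1..n. (\<delta> i)\<^sup>2) = (\<Sum>i=1..n. (gm_source a z i - y i)\<^sup>2)"
      by (intro sum.cong) (auto simp: \<delta>_def y'_def)
    ultimately have "((\<Sum>k=1..n. (?W z k - v k)\<^sup>2 / g k) + ((\<Sum>k=1..n. c k * ?W z k) - t)\<^sup>2 / K) / (2 * \<theta>)
        \<le> (\<Sum>i=1..n. (gm_source a z i - y i)\<^sup>2) / (2 * \<theta>)"
      using \<theta> by (simp add: divide_right_mono)
    moreover have "(\<Sum>k=1..n. e k * (?W z k - v k)\<^sup>2 / 2) = (\<Sum>k=1..n. (?W z k - v k)\<^sup>2 / g k) / (2 * \<theta>)"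
      unfolding sum_divide_distrib by (intro sum.cong) (auto simp: e_def)
    ultimately show ?thesis
      by (simp add: G_def \<beta>_def add_divide_distrib mult_ac)
  qed
  define m where "m = min s2 (\<theta> * (a - 1)\<^sup>2)"
  have m: "m > 0" using s2 \<theta> a by (simp add: m_def)
  \<comment> \<open>The coefficient of the first innovation equals (K - 1)/a, and alone it already
    gives \<open>c\<close> a norm of order K.\<close>
  have l1: "l 1 \<ge> K / (2 * a)"
  proof -
    have "a * l 1 = (\<Sum>i=1..n. a ^ (2 * i))"
      unfolding l_def sum_distrib_left by (intro sum.cong) (auto simp: power_Suc[symmetric] simp del: power_Suc)
    also have "\<dots> = K - 1"
      unfolding K_def by (simp add: sum.atLeast_Suc_atMost atMost_atLeast0 One_nat_def)
    finally have "a * l 1 \<ge> K / 2" using K_ge by simp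
    then show ?thesis using a by (simp add: field_simps)
  qed
  have l1_pos: "l 1 > 0" using l1 K_ge a by (smt (verit) divide_pos_pos)
  have c_sq: "(\<Sum>k=1..n. (c k)\<^sup>2) > 0" and c_sq_ge: "(\<Sum>k=1..n. (c k)\<^sup>2) \<ge> (l 1)\<^sup>2"
  proof -
    have "(l 1)\<^sup>2 = (\<Sum>j\<in>{1}. (l j)\<^sup>2)" by simp
    also have "\<dots> \<le> (\<Sum>j=1..n. (l j)\<^sup>2)" using n by (intro sum_mono2) auto
    also have "\<dots> = (\<Sum>k=1..n. (c k)\<^sup>2)" unfolding c_def by (rule sum_sq_mat_app[OF orth, symmetric]) simp
    finally show ge: "(\<Sum>k=1..n. (c k)\<^sup>2) \<ge> (l 1)\<^sup>2" .
    show "(\<Sum>k=1..n. (c k)\<^sup>2) > 0" using ge l1_pos by (smt (verit) zero_less_power2)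
  qed
  define \<tau> where "\<tau> = sqrt (\<Sum>k=1..n. (c k * (1 / sqrt (\<omega> k)))\<^sup>2)"
  \<comment> \<open>All tilted variances 1/\<open>\<omega> k\<close> are at least \<open>m\<close>,
    because \<open>s2 * \<omega> k\<close> is max(1, s2/(theta g_k)) and g_k >= (a - 1)^2. So
    \<open>\<tau>\<close> inherits the order K of the norm of \<open>c\<close>.\<close>
  have \<tau>_ge: "\<tau> \<ge> sqrt m * (K / (2 * a))"
  proof -
    have "m * \<omega> k \<le> 1" for k
    proof -
      have "m * (s2 / (\<theta> * g k)) \<le> (\<theta> * g k) * (s2 / (\<theta> * g k))"
      proof (intro mult_right_mono)
        have "m \<le> \<theta> * (a - 1)\<^sup>2" by (simp add: m_def)
        also have "\<dots> \<le> \<theta> * g k" using gfun_lower[of a] a \<theta> by (simp add: g_def eigval_def)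
        finally show "m \<le> \<theta> * g k" .
      qed (use s2 \<theta> g[of k] in simp)
      also have "\<dots> = s2" using \<theta> g[of k] by simp
      finally have "m * (s2 * \<omega> k) \<le> s2" unfolding s2\<omega> by (simp add: max_def m_def)
      then show ?thesis using s2 by (simp add: mult.left_commute)
    qed
    then have le: "m \<le> 1 / \<omega> k" for k using \<omega>_pos by (simp add: pos_le_divide_eq)
    have "m * (l 1)\<^sup>2 \<le> m * (\<Sum>k=1..n. (c k)\<^sup>2)" using m c_sq_ge by simp
    also have "\<dots> \<le> (\<Sum>k=1..n. (c k * (1 / sqrt (\<omega> k)))\<^sup>2)"
      unfolding sum_distrib_left
    proof (intro sum_mono)
      fix k
      have "m * (c k)\<^sup>2 \<le> 1 / \<omega> k * (c k)\<^sup>2" using le by (intro mult_right_mono) auto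
      also have "\<dots> = (c k * (1 / sqrt (\<omega> k)))\<^sup>2"
        using \<omega>_pos[of k] by (simp add: power_mult_distrib power_divide)
      finally show "m * (c k)\<^sup>2 \<le> (c k * (1 / sqrt (\<omega> k)))\<^sup>2" .
    qed
    finally have "sqrt (m * (l 1)\<^sup>2) \<le> \<tau>" unfolding \<tau>_def by simp
    then have "sqrt m * l 1 \<le> \<tau>" using l1_pos by (simp add: real_sqrt_mult)
    moreover have "sqrt m * (K / (2 * a)) \<le> sqrt m * l 1" using l1 m by (intro mult_left_mono) auto
    ultimately show ?thesis by linarith
  qed
  have \<tau>_pos: "\<tau> > 0"
  proof -
    have "sqrt m * (K / (2 * a)) > 0" using m K_ge a by (intro mult_pos_pos divide_pos_pos) auto
    then show ?thesis using \<tau>_ge by linarith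
  qed
  have sigma: "sqrt s2 > 0" using s2 by simp
  have sqinv: "1 / sqrt (\<omega> k) > 0" for k using \<omega>_pos by simp
  have "(\<integral>\<^sup>+z. exp (tilted_sum a s2 \<theta> n (?W z) - (\<Sum>i=1..n. (gm_source a z i - y i)\<^sup>2) / (2 * \<theta>)) \<partial>?N)
      \<le> (\<integral>\<^sup>+z. exp (G (?W z)) \<partial>?N)"
    by (intro nn_integral_mono ennreal_leI) (subst exp_le_cancel_iff, rule exponent)
  also have "\<dots> = (\<integral>\<^sup>+w. exp (G w) \<partial>distr ?N (PiM ?I (\<lambda>_. borel)) ?W)"
    by (subst nn_integral_distr) auto
  also have "\<dots> = (\<integral>\<^sup>+w. exp (G w) \<partial>?N)"
    by (subst distr_normal_PiM_orthogonal[OF orth _ sigma]) auto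
  also have "\<dots> = (\<integral>\<^sup>+w. (\<Prod>k=1..n. ennreal (normal_density 0 (sqrt s2) (w k))) * exp (G w) \<partial>PiM ?I (\<lambda>_. lborel))"
    using sigma by (subst nn_integral_normal_PiM) auto
  also have "\<dots> \<le> (\<integral>\<^sup>+w. ennreal (\<Prod>k=1..n. 1 / sqrt (s2 * \<omega> k)) *
      ((\<Prod>k=1..n. ennreal (normal_density (e k * v k / \<omega> k) (1 / sqrt (\<omega> k)) (w k))) * exp (- \<beta> / 2 * ((\<Sum>k=1..n. c k * w k) - t)\<^sup>2)) \<partial>PiM ?I (\<lambda>_. lborel))"
  proof (intro nn_integral_mono)
    fix w
    have "exp (G w) = (\<Prod>k=1..n. exp (b k * (w k)\<^sup>2 / (2 * s2) - e k * (w k - v k)\<^sup>2 / 2)) * exp (- \<beta> / 2 * ((\<Sum>k=1..n. c k * w k) - t)\<^sup>2)"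
      by (simp add: G_def exp_sum[symmetric] exp_add[symmetric] tilted_sum_def b_def sum_subtractf)
    then have "(\<Prod>k=1..n. normal_density 0 (sqrt s2) (w k)) * exp (G w)
        = (\<Prod>k=1..n. normal_density 0 (sqrt s2) (w k) * exp (b k * (w k)\<^sup>2 / (2 * s2) - e k * (w k - v k)\<^sup>2 / 2)) * exp (- \<beta> / 2 * ((\<Sum>k=1..n. c k * w k) - t)\<^sup>2)"
      by (simp add: prod.distrib)
    also have "\<dots> \<le> (\<Prod>k=1..n. (1 / sqrt (s2 * \<omega> k)) * normal_density (e k * v k / \<omega> k) (1 / sqrt (\<omega> k)) (w k)) * exp (- \<beta> / 2 * ((\<Sum>k=1..n. c k * w k) - t)\<^sup>2)"
      unfolding \<omega>_def by (intro mult_right_mono prod_mono conjI dst_tilted_density_bound s2 e b) auto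
    also have "\<dots> = (\<Prod>k=1..n. 1 / sqrt (s2 * \<omega> k)) *
      ((\<Prod>k=1..n. normal_density (e k * v k / \<omega> k) (1 / sqrt (\<omega> k)) (w k)) * exp (- \<beta> / 2 * ((\<Sum>k=1..n. c k * w k) - t)\<^sup>2))"
      by (simp only: prod.distrib mult.assoc)
    finally have le: "(\<Prod>k=1..n. normal_density 0 (sqrt s2) (w k)) * exp (G w) \<le> (\<Prod>k=1..n. 1 / sqrt (s2 * \<omega> k)) *
      ((\<Prod>k=1..n. normal_density (e k * v k / \<omega> k) (1 / sqrt (\<omega> k)) (w k)) * exp (- \<beta> / 2 * ((\<Sum>k=1..n. c k * w k) - t)\<^sup>2))" .
    have "(\<Prod>k=1..n. 1 / sqrt (s2 * \<omega> k)) \<ge> 0" using s2 \<omega>_pos by (intro prod_nonneg) (simp add: less_imp_le)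
    with ennreal_leI[OF le]
    show "(\<Prod>k=1..n. ennreal (normal_density 0 (sqrt s2) (w k))) * ennreal (exp (G w)) \<le> ennreal (\<Prod>k=1..n. 1 / sqrt (s2 * \<omega> k)) *
      ((\<Prod>k=1..n. ennreal (normal_density (e k * v k / \<omega> k) (1 / sqrt (\<omega> k)) (w k))) * ennreal (exp (- \<beta> / 2 * ((\<Sum>k=1..n. c k * w k) - t)\<^sup>2)))"
      by (simp add: prod_ennreal ennreal_mult prod_nonneg)
  qed
  also have "\<dots> = ennreal (\<Prod>k=1..n. 1 / sqrt (s2 * \<omega> k)) *
      (\<integral>\<^sup>+w. exp (- \<beta> / 2 * ((\<Sum>k=1..n. c k * w k) - t)\<^sup>2) \<partial>normal_PiM ?I (\<lambda>k. e k * v k / \<omega> k) (\<lambda>k. 1 / sqrt (\<omega> k)))"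
    by (subst nn_integral_cmult, measurable, subst nn_integral_normal_PiM[OF _ sqinv]) auto
  also have "\<dots> \<le> ennreal (\<Prod>k=1..n. 1 / sqrt (s2 * \<omega> k)) * ennreal (1 / (\<tau> * sqrt \<beta>))"
    unfolding \<tau>_def
  proof (intro mult_left_mono nn_integral_normal_PiM_linear_exp sqinv \<beta>)
    show "\<exists>k\<in>?I. c k \<noteq> 0"
      using c_sq by (rule contrapos_pp) simp
  qed auto
  also have "\<dots> = ennreal ((\<Prod>k=1..n. 1 / sqrt (s2 * \<omega> k)) * (1 / (\<tau> * sqrt \<beta>)))"
    using \<tau>_pos \<beta> s2 \<omega>_pos by (intro ennreal_mult[symmetric] prod_nonneg) (auto simp: less_imp_le)
  also have "\<dots> \<le> C * exp (- log_det_sum a s2 \<theta> n)"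
  proof (intro ennreal_leI)
    \<comment> \<open>A deviation of order K against a bump of width sqrt(theta K) leaves C/sqrt K.
      The value of \<open>C\<close> is read off here.\<close>
    have "1 / (\<tau> * sqrt \<beta>) \<le> 1 / ((sqrt m * (K / (2 * a))) * sqrt \<beta>)"
      using \<tau>_ge m K_ge a \<beta> by (intro divide_left_mono mult_right_mono mult_pos_pos) (auto simp: \<tau>_pos)
    also have "\<dots> = C * (1 / sqrt K)"
    proof -
      have "sqrt K * sqrt K = K" using K_ge by simp
      then show ?thesis
        using K_ge m a \<theta> unfolding C_def m_def[symmetric] \<beta>_def
        by (simp add: real_sqrt_divide real_sqrt_mult field_simps)
    qed
    finally have "(\<Prod>k=1..n. 1 / sqrt (s2 * \<omega> k)) * (1 / (\<tau> * sqrt \<beta>)) \<le> (\<Prod>k=1..n. 1 / sqrt (s2 * \<omega> k)) * (C * (1 / sqrt K))"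
      using s2 \<omega>_pos by (intro mult_left_mono prod_nonneg) (auto simp: less_imp_le)
    also have "\<dots> = C * ((\<Prod>k=1..n. 1 / sqrt (s2 * \<omega> k)) * (\<Prod>k=1..n. 1 / sqrt (g k)))"
    proof -
      have "K = (\<Prod>k=1..n. g k)"
        unfolding K_def g_def eigval_def using prod_gfun_grid[of a n] a by simp
      moreover have "sqrt (\<Prod>k=1..n. g k) = (\<Prod>k=1..n. sqrt (g k))"
        by (induction n) (simp_all add: real_sqrt_mult)
      ultimately have "1 / sqrt K = (\<Prod>k=1..n. 1 / sqrt (g k))"
        by (simp add: prod_dividef)
      then show ?thesis by simp
    qed
    also have "\<dots> = C * (\<Prod>k=1..n. exp (- (ln (max (g k) (s2 / \<theta>)) / 2)))"
      unfolding prod.distrib[symmetric]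
    proof (intro arg_cong2[where f = "(*)"] refl prod.cong)
      fix k
      have pos: "max (g k) (s2 / \<theta>) > 0" using g by (simp add: less_max_iff_disj)
      have "s2 * \<omega> k * g k = max (g k) (s2 / \<theta>)"
        unfolding s2\<omega> using g[of k] \<theta> by (simp add: max_def field_simps)
      then have "1 / sqrt (s2 * \<omega> k) * (1 / sqrt (g k)) = 1 / sqrt (max (g k) (s2 / \<theta>))"
        by (simp add: real_sqrt_mult[symmetric])
      also have "\<dots> = exp (- (ln (max (g k) (s2 / \<theta>)) / 2))"
        using pos by (simp add: exp_minus ln_sqrt[symmetric] inverse_eq_divide)
      finally show "1 / sqrt (s2 * \<omega> k) * (1 / sqrt (g k)) = exp (- (ln (max (g k) (s2 / \<theta>)) / 2))" .
    qed
    also have "\<dots> = C * exp (- log_det_sum a s2 \<theta> n)"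
      by (simp add: log_det_sum_def g_def exp_sum[symmetric] sum_negf)
    finally show "(\<Prod>k=1..n. 1 / sqrt (s2 * \<omega> k)) * (1 / (\<tau> * sqrt \<beta>)) \<le> C * exp (- log_det_sum a s2 \<theta> n)" .
  qed
  finally show ?thesis .
qed

section \<open>Measurability and the union bound over codewords\<close>

lemma innov_measure_eq: "innov_measure s2 n = normal_PiM {1..n} (\<lambda>_. 0) (\<lambda>_. sqrt s2)"
  by (simp add: innov_measure_def normal_PiM_def)

lemma measurable_source_block [measurable]:
  "source_block a n \<in> measurable (PiM {1..n} (\<lambda>_. borel)) (PiM {1..n} (\<lambda>_. lborel))"
  unfolding source_block_def by (intro measurable_restrict) simp

lemma measurable_mse_source [measurable]:
  "(\<lambda>z. mse_dist n (source_block a n z) y) \<in> borel_measurable (PiM {1..n} (\<lambda>_. borel))"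
proof -
  have "mse_dist n (source_block a n z) y = (1 / real n) * (\<Sum>i=1..n. (gm_source a z i - y i)\<^sup>2)" for z
    by (simp add: mse_dist_def source_block_def)
  then show ?thesis by simp
qed

text \<open>The encoder output lies in a countable set, so it suffices to treat one fixed codeword
  at a time.\<close>

lemma measurable_mse_code:
  fixes f :: "(nat \<Rightarrow> real) \<Rightarrow> nat"
  assumes f: "f \<in> measurable (PiM {1..n} (\<lambda>_. lborel)) (count_space UNIV)"
  shows "(\<lambda>z. mse_dist n (source_block a n z) (g (f (source_block a n z)))) \<in> borel_measurable (PiM {1..n} (\<lambda>_. borel))"
proof (rule measurable_compose_countable[where g = "\<lambda>z. f (source_block a n z)"])
  show "(\<lambda>z. f (source_block a n z)) \<in> measurable (PiM {1..n} (\<lambda>_. borel)) (count_space UNIV)"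
    using measurable_compose[OF measurable_source_block f] .
qed measurable

lemma one_shot_converse:
  fixes a s2 \<theta> :: real
  assumes a: "1 < a" and s2: "0 < s2" and \<theta>: "0 < \<theta>" and n: "1 \<le> n"
    and code: "is_code a s2 n M d eps f g"
  defines "C \<equiv> 2 * a * sqrt \<theta> / sqrt (min s2 (\<theta> * (a - 1)\<^sup>2))"
  defines "N \<equiv> innov_measure s2 n"
  shows "measure N {z \<in> space N. t \<le> tilted_sum a s2 \<theta> n (mat_app {1..n} (dst n) z)}
    \<le> eps + real M * (C * exp (real n * d / (2 * \<theta>) - log_det_sum a s2 \<theta> n - t))"
proof -
  let ?W = "mat_app {1..n} (dst n)"
  have s: "sqrt s2 > 0" using s2 by simp
  interpret prob_space N unfolding N_def innov_measure_eq using s by (intro prob_space_normal_PiM)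
  have sets_N [measurable_cong]: "sets N = sets (PiM {1..n} (\<lambda>_. borel))" by (simp add: N_def innov_measure_eq)
  have [measurable]: "(\<lambda>z. gm_source a z i) \<in> borel_measurable N" if "i \<in> {1..n}" for i
    using that measurable_gm_source[of i n a] by (simp add: measurable_cong_sets[OF sets_N refl])
  have C: "C \<ge> 0" using a s2 \<theta> by (simp add: C_def)
  from code have f: "f \<in> measurable (PiM {1..n} (\<lambda>_. lborel)) (count_space UNIV)"
    and range: "\<And>x. f x \<in> {1..M}"
    and fail: "measure N {z \<in> space N. mse_dist n (source_block a n z) (g (f (source_block a n z))) > d} \<le> eps"
    by (auto simp: is_code_def N_def)
  define B where "B = {z \<in> space N. mse_dist n (source_block a n z) (g (f (source_block a n z))) > d}"
  define A where "A m = {z \<in> space N. t \<le> tilted_sum a s2 \<theta> n (?W z) \<and> mse_dist n (source_block a n z) (g m) \<le> d}" for m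
  have Bm [measurable]: "B \<in> sets N"
    unfolding B_def using measurable_mse_code[OF f, of a g] by measurable
  have Am [measurable]: "A m \<in> sets N" for m unfolding A_def by measurable
  have A_le: "measure N (A m) \<le> C * exp (real n * d / (2 * \<theta>) - log_det_sum a s2 \<theta> n - t)" for m
  proof -
    \<comment> \<open>On \<open>A m\<close> the exponent of \<open>?h\<close> is at least t - n d/(2
      theta), so \<open>r * ?h z\<close> dominates the indicator; this is Markov's inequality in
      pointwise form.\<close>
    define r where "r = exp (real n * d / (2 * \<theta>) - t)"
    let ?h = "\<lambda>z. exp (tilted_sum a s2 \<theta> n (?W z) - (\<Sum>i=1..n. (gm_source a z i - g m i)\<^sup>2) / (2 * \<theta>))"
    have "emeasure N (A m) = (\<integral>\<^sup>+z. indicator (A m) z \<partial>N)" by simp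
    also have "\<dots> \<le> (\<integral>\<^sup>+z. ennreal r * ennreal (?h z) \<partial>N)"
    proof (intro nn_integral_mono)
      fix z
      show "indicator (A m) z \<le> ennreal r * ennreal (?h z)"
      proof (cases "z \<in> A m")
        case True
        then have "t \<le> tilted_sum a s2 \<theta> n (?W z)" "mse_dist n (source_block a n z) (g m) \<le> d" by (auto simp: A_def)
        then have "(\<Sum>i=1..n. (gm_source a z i - g m i)\<^sup>2) \<le> real n * d"
          using n by (simp add: mse_dist_def source_block_def field_simps)
        then have "(\<Sum>i=1..n. (gm_source a z i - g m i)\<^sup>2) / (2 * \<theta>) \<le> real n * d / (2 * \<theta>)"
          using \<theta> by (intro divide_right_mono) auto
        then have "1 \<le> r * ?h z"
          using \<open>t \<le> tilted_sum a s2 \<theta> n (?W z)\<close> by (simp add: r_def exp_add[symmetric])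
        then have "ennreal 1 \<le> ennreal (r * ?h z)" by (rule ennreal_leI)
        then show ?thesis using True by (simp add: ennreal_mult r_def)
      qed simp
    qed
    also have "\<dots> = ennreal r * (\<integral>\<^sup>+z. ?h z \<partial>N)"
      by (rule nn_integral_cmult) measurable
    also have "\<dots> \<le> ennreal r * ennreal (C * exp (- log_det_sum a s2 \<theta> n))"
      unfolding N_def innov_measure_eq C_def
      by (intro mult_left_mono tilted_distortion_bound a s2 \<theta> n) simp
    also have "\<dots> = ennreal (C * exp (real n * d / (2 * \<theta>) - log_det_sum a s2 \<theta> n - t))"
      using C by (simp add: r_def ennreal_mult[symmetric] exp_diff exp_minus exp_add field_simps)
    finally show ?thesis using C by (simp add: emeasure_eq_measure)
  qed
  have "measure N {z \<in> space N. t \<le> tilted_sum a s2 \<theta> n (?W z)} \<le> measure N (B \<union> (\<Union>m\<in>{1..M}. A m))"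
  proof (intro finite_measure_mono subsetI)
    fix z assume z: "z \<in> {z \<in> space N. t \<le> tilted_sum a s2 \<theta> n (?W z)}"
    show "z \<in> B \<union> (\<Union>m\<in>{1..M}. A m)"
    proof (cases "z \<in> B")
      case False
      \<comment> \<open>Outside the failure event, the index chosen by the encoder is itself the one
        whose event \<open>A\<close> contains \<open>z\<close>.\<close>
      then have "z \<in> A (f (source_block a n z))" using z by (auto simp: A_def B_def)
      then show ?thesis using range by blast
    qed simp
  qed measurable
  also have "\<dots> \<le> measure N B + measure N (\<Union>m\<in>{1..M}. A m)"
    by (intro measure_Un_le) auto
  also have "measure N (\<Union>m\<in>{1..M}. A m) \<le> (\<Sum>m\<in>{1..M}. measure N (A m))"
    by (intro measure_UNION_le) auto
  also have "\<dots> \<le> (\<Sum>m\<in>{1..M}. C * exp (real n * d / (2 * \<theta>) - log_det_sum a s2 \<theta> n - t))"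
    by (intro sum_mono A_le)
  finally show ?thesis using fail by (simp add: B_def)
qed

section \<open>Riemann sums\<close>

lemma mono_riemann_sum:
  fixes h :: "real \<Rightarrow> real"
  assumes mono: "\<And>x y. 0 \<le> x \<Longrightarrow> x \<le> y \<Longrightarrow> y \<le> pi \<Longrightarrow> h x \<le> h y"
    and cont: "continuous_on {0..pi} h" and N: "0 < N"
  shows "real N / pi * integral {0..pi} h \<le> (\<Sum>k=1..N. h (pi * real k / real N))"
    and "(\<Sum>k<N. h (pi * real k / real N)) \<le> real N / pi * integral {0..pi} h"
proof -
  define p where "p k = pi * real k / real N" for k
  have p: "0 \<le> p k" "p k \<le> p (Suc k)" for k using N by (auto simp: p_def divide_right_mono)
  have p_le: "p k \<le> pi" if "k \<le> N" for k using that N by (simp add: p_def divide_le_eq)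
  have int: "h integrable_on {u..w}" if "0 \<le> u" "w \<le> pi" for u w
    using that by (intro integrable_continuous_real continuous_on_subset[OF cont]) auto
  have split: "integral {0..p m} h = (\<Sum>k<m. integral {p k..p (Suc k)} h)" if "m \<le> N" for m
    using that
  proof (induction m)
    case 0
    then show ?case by (simp add: p_def)
  next
    case (Suc m)
    have "integral {0..p m} h + integral {p m..p (Suc m)} h = integral {0..p (Suc m)} h"
      using p p_le[OF Suc.prems] by (intro Henstock_Kurzweil_Integration.integral_combine int) auto
    with Suc show ?case by simp
  qed
  have pN: "p N = pi" using N by (simp add: p_def)
  have len: "p (Suc k) - p k = pi / real N" for k by (simp add: p_def distrib_left add_divide_distrib)
  have up: "integral {p k..p (Suc k)} h \<le> pi / real N * h (p (Suc k))"
    and lo: "pi / real N * h (p k) \<le> integral {p k..p (Suc k)} h" if "k < N" for k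
  proof -
    have le: "p (Suc k) \<le> pi" using that by (intro p_le) simp
    have i: "h integrable_on {p k..p (Suc k)}" using p le by (intro int) auto
    have "integral {p k..p (Suc k)} h \<le> integral {p k..p (Suc k)} (\<lambda>_. h (p (Suc k)))"
      using p[of k] le by (intro integral_le i) (auto intro!: mono intro: order_trans)
    then show "integral {p k..p (Suc k)} h \<le> pi / real N * h (p (Suc k))"
      using p[of k] len[of k] by simp
    have "integral {p k..p (Suc k)} (\<lambda>_. h (p k)) \<le> integral {p k..p (Suc k)} h"
      using p[of k] le by (intro integral_le i) (auto intro!: mono intro: order_trans)
    then show "pi / real N * h (p k) \<le> integral {p k..p (Suc k)} h"
      using p[of k] len[of k] by simp
  qed
  have total: "integral {0..pi} h = (\<Sum>k<N. integral {p k..p (Suc k)} h)"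
    using split[of N] pN by simp
  have "integral {0..pi} h \<le> (\<Sum>k<N. pi / real N * h (p (Suc k)))"
    unfolding total by (intro sum_mono up) simp
  also have "\<dots> = pi / real N * (\<Sum>k=1..N. h (p k))"
    unfolding sum_distrib_left
    by (rule sum.reindex_bij_witness[of _ "\<lambda>i. i - 1" Suc]) auto
  finally show "real N / pi * integral {0..pi} h \<le> (\<Sum>k=1..N. h (pi * real k / real N))"
    using N by (simp add: p_def field_simps)
  have "pi / real N * (\<Sum>k<N. h (p k)) \<le> integral {0..pi} h"
    unfolding total sum_distrib_left by (intro sum_mono lo) simp
  then show "(\<Sum>k<N. h (pi * real k / real N)) \<le> real N / pi * integral {0..pi} h"
    using N by (simp add: p_def field_simps)
qed

text \<open>The n interior nodes belong to a grid with n + 1 cells. Adding h(pi) gives an upper sum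
  and adding h(0) a lower sum; the surplus cell contributes the mean of \<open>h\<close>, which lies
  between these values, so the error stays below one total variation.\<close>

lemma mono_riemann_sum_interior:
  fixes h :: "real \<Rightarrow> real"
  assumes mono: "\<And>x y. 0 \<le> x \<Longrightarrow> x \<le> y \<Longrightarrow> y \<le> pi \<Longrightarrow> h x \<le> h y"
    and cont: "continuous_on {0..pi} h"
  shows "\<bar>(\<Sum>k=1..n. h (pi * real k / real (Suc n))) - real n / pi * integral {0..pi} h\<bar> \<le> h pi - h 0"
proof -
  let ?S = "\<Sum>k=1..n. h (pi * real k / real (Suc n))" and ?J = "integral {0..pi} h / pi"
  have int: "h integrable_on {0..pi}" by (intro integrable_continuous_real cont)
  have "integral {0..pi} h \<le> integral {0..pi} (\<lambda>_. h pi)" "integral {0..pi} (\<lambda>_. h 0) \<le> integral {0..pi} h"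
    by (intro integral_le int; auto intro!: mono)+
  then have J: "?J \<le> h pi" "h 0 \<le> ?J" by (auto simp: field_simps)
  have "(\<Sum>k=1..Suc n. h (pi * real k / real (Suc n))) = ?S + h pi" by simp
  then have 1: "real (Suc n) * ?J \<le> ?S + h pi"
    using mono_riemann_sum(1)[OF mono cont, of "Suc n"] by simp
  have "(\<Sum>k<Suc n. h (pi * real k / real (Suc n))) = h 0 + ?S"
    unfolding sum.lessThan_Suc_shift by (simp add: sum.atLeast1_atMost_eq One_nat_def)
  then have 2: "h 0 + ?S \<le> real (Suc n) * ?J"
    using mono_riemann_sum(2)[OF mono cont, of "Suc n"] by simp
  have "real (Suc n) * ?J = real n * ?J + ?J" by (simp add: distrib_right add_divide_distrib)
  with 1 2 J have "\<bar>?S - real n * ?J\<bar> \<le> h pi - h 0" by (intro abs_leI) linarith+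
  then show ?thesis by simp
qed

lemma interval_integral_even_pi:
  fixes h :: "real \<Rightarrow> real"
  assumes even: "\<And>w. h (- w) = h w" and cont: "continuous_on UNIV h"
  shows "(LBINT w=-pi..pi. h w) = 2 * integral {0..pi} h"
proof -
  have int: "h integrable_on {u..w}" for u w
    by (intro integrable_continuous_real continuous_on_subset[OF cont]) simp
  have "(LBINT w=-pi..pi. h w) = integral {- pi..pi} h"
    using interval_integral_eq_integral[of "- pi" pi h] borel_integrable_atLeastAtMost'[OF continuous_on_subset[OF cont]]
    by simp
  also have "\<dots> = integral {- pi..0} h + integral {0..pi} h"
    by (intro Henstock_Kurzweil_Integration.integral_combine[symmetric] int) auto
  also have "integral {- pi..0} h = integral {0..pi} h"
    using Henstock_Kurzweil_Integration.integral_reflect_real[of pi 0 h] even by simp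
  finally show ?thesis by simp
qed

lemma gfun_mono: "0 < a \<Longrightarrow> 0 \<le> x \<Longrightarrow> x \<le> y \<Longrightarrow> y \<le> pi \<Longrightarrow> gfun a x \<le> gfun a y"
  unfolding gfun_def using cos_monotone_0_pi_le[of x y] by simp

lemma gfun_even: "gfun a (- w) = gfun a w"
  by (simp add: gfun_def)

lemma continuous_on_gfun [continuous_intros]: "continuous_on A (gfun a)"
  unfolding gfun_def by (intro continuous_intros)

section \<open>Spectral averages of the source\<close>

lemma log_det_sum_lower:
  assumes a: "1 < a" and "0 < s2" "0 < \<theta>"
  shows "\<exists>C. \<forall>n. real n * RU a s2 \<theta> - C \<le> log_det_sum a s2 \<theta> n"
proof -
  define h where "h w = ln (max (gfun a w) (s2 / \<theta>)) / 2" for w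
  have pos: "max (gfun a w) (s2 / \<theta>) > 0" for w using gfun_pos[OF a, of w] by (simp add: less_max_iff_disj)
  have cont: "continuous_on A h" for A
    unfolding h_def using pos by (intro continuous_intros) (auto simp: less_le)
  have mono: "h x \<le> h y" if "0 \<le> x" "x \<le> y" "y \<le> pi" for x y
    unfolding h_def using gfun_mono[of a x y] that a pos by (intro divide_right_mono) (auto simp: max.coboundedI1)
  have RU: "RU a s2 \<theta> = integral {0..pi} h / pi"
  proof -
    have "(LBINT w=-pi..pi. (1/2) * ln (max (gfun a w) (s2 / \<theta>))) = (LBINT w=-pi..pi. h w)"
      by (simp add: h_def)
    also have "\<dots> = 2 * integral {0..pi} h"
      by (intro interval_integral_even_pi cont) (simp add: h_def gfun_even)
    finally show ?thesis by (simp add: RU_def)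
  qed
  have "real n * RU a s2 \<theta> - (h pi - h 0) \<le> log_det_sum a s2 \<theta> n" for n
  proof -
    have "log_det_sum a s2 \<theta> n = (\<Sum>k=1..n. h (pi * real k / real (Suc n)))"
      by (simp add: log_det_sum_def h_def eigval_def)
    then show ?thesis
      using mono_riemann_sum_interior[OF mono cont, of n] unfolding RU by simp
  qed
  then show ?thesis by blast
qed

text \<open>This is where the water-filling equation enters: divided by theta, it says that the
  spectral mean of the weights is d/theta.\<close>

lemma weight_sum_lower:
  assumes a: "1 < a" and s2: "0 < s2" and \<theta>: "0 < \<theta>"
    and d: "d = (1 / (2 * pi)) * (LBINT w=-pi..pi. min \<theta> (s2 / gfun a w))"
  shows "\<exists>C. \<forall>n. real n * d / \<theta> - C \<le> (\<Sum>k=1..n. weight a s2 \<theta> n k)"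
proof -
  \<comment> \<open>The weights decrease on [0, pi]; the sign makes \<open>h\<close> increasing, as
    the Riemann sum estimate requires.\<close>
  define h where "h w = - min 1 (s2 / (\<theta> * gfun a w))" for w
  have pos: "gfun a w > 0" for w by (rule gfun_pos[OF a])
  have cont: "continuous_on A h" for A
    unfolding h_def using pos \<theta> by (intro continuous_intros) (auto simp: less_le)
  have mono: "h x \<le> h y" if "0 \<le> x" "x \<le> y" "y \<le> pi" for x y
  proof -
    have "s2 / (\<theta> * gfun a y) \<le> s2 / (\<theta> * gfun a x)"
      using gfun_mono[of a x y] that a pos \<theta> s2 by (intro divide_left_mono mult_left_mono mult_pos_pos) auto
    then show ?thesis unfolding h_def by (simp add: min.coboundedI2)
  qed
  have d': "d / \<theta> = - integral {0..pi} h / pi"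
  proof -
    have "(LBINT w=-pi..pi. min \<theta> (s2 / gfun a w)) = (LBINT w=-pi..pi. - \<theta> * h w)"
    proof (intro interval_integral_cong)
      fix w
      show "min \<theta> (s2 / gfun a w) = - \<theta> * h w"
        using \<theta> by (simp add: h_def min_mult_distrib_left)
    qed
    also have "\<dots> = 2 * integral {0..pi} (\<lambda>w. - \<theta> * h w)"
      by (intro interval_integral_even_pi continuous_intros cont) (simp add: h_def gfun_even)
    also have "\<dots> = - 2 * \<theta> * integral {0..pi} h" by simp
    finally show ?thesis unfolding d using \<theta> by simp
  qed
  have "real n * d / \<theta> - (h pi - h 0) \<le> (\<Sum>k=1..n. weight a s2 \<theta> n k)" for n
  proof -
    have "(\<Sum>k=1..n. weight a s2 \<theta> n k) = - (\<Sum>k=1..n. h (pi * real k / real (Suc n)))"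
      by (simp add: weight_def h_def eigval_def sum_negf)
    moreover have "real n * d / \<theta> = - (real n / pi * integral {0..pi} h)"
      unfolding times_divide_eq_right[symmetric] d' by simp
    ultimately show ?thesis
      using mono_riemann_sum_interior[OF mono cont, of n] by simp
  qed
  then show ?thesis by blast
qed

text \<open>Half the sum of the squared weights is the variance of the weighted chi-square sum, as
  (X^2 - 1)/2 has variance 1/2.\<close>

lemma weight_sq_sum_approx:
  assumes a: "1 < a" and s2: "0 < s2" and \<theta>: "0 < \<theta>"
  shows "\<exists>C. \<forall>n. \<bar>(\<Sum>k=1..n. (weight a s2 \<theta> n k)\<^sup>2) / 2 - real n * VU a s2 \<theta>\<bar> \<le> C"
proof -
  define h where "h w = - min 1 ((s2 / (\<theta> * gfun a w))\<^sup>2)" for w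
  have pos: "gfun a w > 0" for w by (rule gfun_pos[OF a])
  have cont: "continuous_on A h" for A
    unfolding h_def using pos \<theta> by (intro continuous_intros) (auto simp: less_le)
  have mono: "h x \<le> h y" if "0 \<le> x" "x \<le> y" "y \<le> pi" for x y
  proof -
    have "s2 / (\<theta> * gfun a y) \<le> s2 / (\<theta> * gfun a x)"
      using gfun_mono[of a x y] that a pos \<theta> s2 by (intro divide_left_mono mult_left_mono mult_pos_pos) auto
    then have "(s2 / (\<theta> * gfun a y))\<^sup>2 \<le> (s2 / (\<theta> * gfun a x))\<^sup>2"
      using pos[of y] \<theta> s2 by (intro power_mono) (auto simp: less_imp_le)
    then show ?thesis unfolding h_def by (simp add: min.coboundedI2)
  qed
  have V: "VU a s2 \<theta> = - integral {0..pi} h / (2 * pi)"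
  proof -
    have "(LBINT w=-pi..pi. min 1 ((s2 / (\<theta> * gfun a w))\<^sup>2)) = 2 * integral {0..pi} (\<lambda>w. - h w)"
      unfolding h_def minus_minus
      using pos \<theta> by (intro interval_integral_even_pi continuous_intros) (auto simp: gfun_even less_le)
    then show ?thesis unfolding VU_def by simp
  qed
  have "\<bar>(\<Sum>k=1..n. (weight a s2 \<theta> n k)\<^sup>2) / 2 - real n * VU a s2 \<theta>\<bar> \<le> h pi - h 0" for n
  proof -
    have "(\<Sum>k=1..n. (weight a s2 \<theta> n k)\<^sup>2) = - (\<Sum>k=1..n. h (pi * real k / real (Suc n)))"
      unfolding sum_negf[symmetric]
    proof (intro sum.cong refl)
      fix k
      let ?r = "s2 / (\<theta> * gfun a (pi * real k / real (Suc n)))"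
      have "?r \<ge> 0" using pos \<theta> s2 by (simp add: less_imp_le)
      then have "(min 1 ?r)\<^sup>2 = min 1 (?r\<^sup>2)"
      proof (cases "?r \<le> 1")
        case True
        then have "?r\<^sup>2 \<le> 1" using \<open>?r \<ge> 0\<close> by (intro power_le_one)
        then show ?thesis using True by (simp only: min_absorb2)
      next
        case False
        then have "1 \<le> ?r\<^sup>2" by (intro one_le_power) simp
        then show ?thesis using False by (simp only: min_absorb1 linear not_le less_imp_le power_one)
      qed
      then show "(weight a s2 \<theta> n k)\<^sup>2 = - h (pi * real k / real (Suc n))"
        by (simp add: weight_def eigval_def h_def)
  qed
  moreover have "real n * VU a s2 \<theta> = - (real n / pi * integral {0..pi} h) / 2"
    unfolding V by (simp add: field_simps)
  ultimately have eq: "(\<Sum>k=1..n. (weight a s2 \<theta> n k)\<^sup>2) / 2 - real n * VU a s2 \<theta>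
      = - ((\<Sum>k=1..n. h (pi * real k / real (Suc n))) - real n / pi * integral {0..pi} h) / 2"
    by (simp add: field_simps)
  have half: "\<bar>- Y / 2\<bar> \<le> B" if "\<bar>Y\<bar> \<le> B" for Y B :: real using that by linarith
  show ?thesis
    unfolding eq by (rule half[OF mono_riemann_sum_interior[OF mono cont]])
  qed
  then show ?thesis by blast
qed

section \<open>The Gaussian tail function\<close>

lemma Qfun_eq: "Qfun x = measure std_normal_distribution {x<..}"
proof -
  interpret G: real_distribution std_normal_distribution by (rule real_dist_normal_dist)
  have e: "einterval (ereal x) \<infinity> = {x<..}" by (auto simp: einterval_def)
  have "measure std_normal_distribution {x<..} = (\<integral>t. indicator {x<..} t \<partial>std_normal_distribution)" by simp
  also have "\<dots> = (\<integral>t. std_normal_density t * indicator {x<..} t \<partial>lborel)"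
    by (subst integral_density) auto
  finally show ?thesis
    by (simp add: Qfun_def interval_lebesgue_integral_def set_lebesgue_integral_def e mult.commute)
qed

lemma Qfun_diff:
  assumes "x \<le> y"
  shows "Qfun x - Qfun y = (\<integral>t. std_normal_density t * indicator {x<..y} t \<partial>lborel)"
proof -
  interpret G: real_distribution std_normal_distribution by (rule real_dist_normal_dist)
  have split: "{x<..} = {x<..y} \<union> {y<..}" using assms by auto
  have "measure std_normal_distribution {x<..} = measure std_normal_distribution {x<..y} + measure std_normal_distribution {y<..}"
    unfolding split by (rule G.finite_measure_Union) auto
  moreover have "measure std_normal_distribution {x<..y} = (\<integral>t. indicator {x<..y} t \<partial>std_normal_distribution)" by simp
  moreover have "\<dots> = (\<integral>t. std_normal_density t * indicator {x<..y} t \<partial>lborel)"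
    by (subst integral_density) auto
  ultimately show ?thesis unfolding Qfun_eq by linarith
qed

lemma Qfun_diff_lower:
  assumes "x \<le> y" "\<And>t. x < t \<Longrightarrow> t \<le> y \<Longrightarrow> c \<le> std_normal_density t"
  shows "(y - x) * c \<le> Qfun x - Qfun y"
proof -
  have "(y - x) * c = (\<integral>t. c * indicator {x<..y} t \<partial>lborel)" using assms(1) by simp
  also have "\<dots> \<le> (\<integral>t. std_normal_density t * indicator {x<..y} t \<partial>lborel)"
  proof (rule integral_mono)
    show "integrable lborel (\<lambda>t. c * indicator {x<..y} t)" using assms(1) by simp
    show "integrable lborel (\<lambda>t. std_normal_density t * indicator {x<..y} t)"
      by (intro integrable_real_mult_indicator) auto
  qed (use assms in \<open>auto simp: indicator_def\<close>)
  finally show ?thesis using Qfun_diff[OF assms(1)] by simp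
qed

lemma Qfun_diff_upper:
  assumes "x \<le> y"
  shows "Qfun x - Qfun y \<le> y - x"
proof -
  have "Qfun x - Qfun y = (\<integral>t. std_normal_density t * indicator {x<..y} t \<partial>lborel)" by (rule Qfun_diff[OF assms])
  also have "\<dots> \<le> (\<integral>t. indicator {x<..y} t \<partial>lborel)"
  proof (rule integral_mono)
    show "integrable lborel (\<lambda>t. std_normal_density t * indicator {x<..y} t)"
      by (intro integrable_real_mult_indicator) auto
    fix t :: real
    have "std_normal_density t \<le> 1 * 1"
      unfolding std_normal_density_def
      using pi_gt3 by (intro mult_mono) auto
    then show "std_normal_density t * indicator {x<..y} t \<le> indicator {x<..y} t" by (simp add: indicator_def)
  qed (use assms in simp)
  finally show ?thesis using assms by simp
qed

lemma std_normal_density_antimono_abs: "\<bar>t\<bar> \<le> r \<Longrightarrow> std_normal_density r \<le> std_normal_density t"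
  unfolding std_normal_density_def
  by (intro mult_left_mono) (auto simp: abs_le_square_iff[symmetric])

lemma Qfun_strict_antimono: "x < y \<Longrightarrow> Qfun y < Qfun x"
proof -
  assume "x < y"
  let ?r = "max \<bar>x\<bar> \<bar>y\<bar>"
  have "(y - x) * std_normal_density ?r \<le> Qfun x - Qfun y"
    using \<open>x < y\<close> by (intro Qfun_diff_lower std_normal_density_antimono_abs) auto
  moreover have "(y - x) * std_normal_density ?r > 0" using \<open>x < y\<close> by (simp add: normal_density_pos)
  ultimately show "Qfun y < Qfun x" by linarith
qed

text \<open>\<open>Qinv\<close> is a definite description: existence comes from the intermediate
  value theorem, since the tail function is 1-Lipschitz with limits 0 and 1, and uniqueness from
  strict monotonicity.\<close>

lemma Qfun_Qinv:
  assumes "0 < eps" "eps < 1"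
  shows "Qfun (Qinv eps) = eps"
proof -
  interpret G: real_distribution std_normal_distribution by (rule real_dist_normal_dist)
  have Q: "Qfun x = 1 - cdf std_normal_distribution x" for x
  proof -
    have "{x<..} = space std_normal_distribution - {..x}" by auto
    then show ?thesis using G.prob_compl[of "{..x}"] by (simp add: cdf_def Qfun_eq)
  qed
  have "eventually (\<lambda>x. cdf std_normal_distribution x < 1 - eps) at_bot"
    using G.cdf_lim_at_bot assms by (intro order_tendstoD) auto
  then obtain x where "cdf std_normal_distribution x < 1 - eps" by (auto simp: eventually_at_bot_linorder)
  then have x: "eps < Qfun x" by (simp add: Q)
  have "eventually (\<lambda>x. 1 - eps < cdf std_normal_distribution x) at_top"
    using G.cdf_lim_at_top_prob assms by (intro order_tendstoD) auto
  then obtain y where "1 - eps < cdf std_normal_distribution y" by (auto simp: eventually_at_top_linorder)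
  then have y: "Qfun y < eps" by (simp add: Q)
  have "x < y" using x y Qfun_strict_antimono[of y x] by (cases x y rule: linorder_cases) auto
  have "1-lipschitz_on UNIV Qfun"
  proof (rule lipschitz_onI)
    fix u v
    show "dist (Qfun u) (Qfun v) \<le> 1 * dist u v"
      using Qfun_diff_upper[of u v] Qfun_diff_upper[of v u] Qfun_strict_antimono[of u v] Qfun_strict_antimono[of v u]
      by (cases u v rule: linorder_cases) (auto simp: dist_real_def)
  qed simp
  then have "continuous_on {x..y} Qfun"
    using lipschitz_on_continuous_on continuous_on_subset by blast
  then obtain z where z: "Qfun z = eps"
    using IVT2'[of Qfun y eps x] x y \<open>x < y\<close> by auto
  have "Qinv eps = z"
    unfolding Qinv_def
  proof (rule the_equality[where P = "\<lambda>x. Qfun x = eps", OF z])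
    fix w assume "Qfun w = eps"
    with z show "w = z"
      using Qfun_strict_antimono[of w z] Qfun_strict_antimono[of z w] by (cases w z rule: linorder_cases) auto
  qed
  with z show ?thesis by simp
qed

text \<open>A Lipschitz bound for the inverse near \<open>eps\<close>. Within distance 1 of
  \<open>Qinv eps\<close> the density is at least its value at
  \<open>\<bar>Qinv eps\<bar> + 1\<close>, so a step of 2 \<open>\<delta>\<close> to the left raises
  the tail by more than the permitted excess.\<close>

lemma Qinv_le_of_Qfun_le:
  assumes eps: "0 < eps" "eps < 1" and Q: "Qfun x \<le> eps + \<delta> * std_normal_density (\<bar>Qinv eps\<bar> + 1)"
    and \<delta>: "0 < \<delta>" "2 * \<delta> \<le> 1"
  shows "Qinv eps - 2 * \<delta> \<le> x"
proof (rule ccontr)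
  assume "\<not> Qinv eps - 2 * \<delta> \<le> x"
  define c where "c = std_normal_density (\<bar>Qinv eps\<bar> + 1)"
  have c: "c > 0" by (simp add: c_def normal_density_pos)
  let ?y = "Qinv eps - 2 * \<delta>"
  have "2 * \<delta> * c \<le> Qfun ?y - Qfun (Qinv eps)"
  proof -
    have "c \<le> std_normal_density t" if "?y < t" "t \<le> Qinv eps" for t
      unfolding c_def using that \<delta> by (intro std_normal_density_antimono_abs) linarith
    then show ?thesis using Qfun_diff_lower[of ?y "Qinv eps" c] \<delta> by simp
  qed
  moreover have "Qfun ?y < Qfun x" using \<open>\<not> ?y \<le> x\<close> by (intro Qfun_strict_antimono) simp
  moreover have "0 < \<delta> * c" using \<delta> c by simp
  ultimately show False using Q Qfun_Qinv[OF eps] by (simp add: c_def)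
qed

section \<open>Existence of codes\<close>

text \<open>The minimal code size is a \<open>LEAST\<close>, which is attained only if some code
  exists. Rational words are countable and dense, so the probability that the first M of them all
  miss the source tends to 0.\<close>

lemma exists_code:
  assumes s2: "0 < s2" and n: "1 \<le> n" and d: "0 < d" and eps: "0 < eps"
  shows "\<exists>M f g. is_code a s2 n M d eps f g"
proof -
  let ?N = "innov_measure s2 n"
  interpret prob_space ?N unfolding innov_measure_eq using s2 by (intro prob_space_normal_PiM) simp
  have sets_N [measurable_cong]: "sets ?N = sets (PiM {1..n} (\<lambda>_. borel))" by (simp add: innov_measure_eq)
  define R where "R = PiE {1..n} (\<lambda>_. \<rat> :: real set)"
  have R: "countable R" unfolding R_def by (intro countable_PiE) (auto simp: countable_rat)
  have "R \<noteq> {}" by (auto simp: R_def PiE_eq_empty_iff intro: Rats_0)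
  then have "range (from_nat_into R) = R" using R by (rule range_from_nat_into)
  then obtain e :: "nat \<Rightarrow> nat \<Rightarrow> real" where e: "range e = R" by blast
  have ex: "\<exists>m::nat. mse_dist n x (e m) \<le> d" for x
  proof -
    have "\<exists>r\<in>\<rat>. x i < r \<and> r < x i + sqrt d" for i using d by (intro Rats_dense_in_real) simp
    then obtain r where r: "\<And>i. r i \<in> \<rat> \<and> x i < r i \<and> r i < x i + sqrt d" by metis
    have "restrict r {1..n} \<in> R" using r by (auto simp: R_def)
    then obtain m where m: "e m = restrict r {1..n}" using e by (metis imageE)
    have "(\<Sum>i=1..n. (x i - e m i)\<^sup>2) \<le> (\<Sum>i=1..n. d)"
    proof (intro sum_mono)
      fix i assume "i \<in> {1..n}"
      have "\<bar>x i - r i\<bar> \<le> sqrt d" using r[of i] by linarith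
      then have "\<bar>x i - r i\<bar>\<^sup>2 \<le> (sqrt d)\<^sup>2" by (intro power_mono) auto
      then show "(x i - e m i)\<^sup>2 \<le> d" using d m \<open>i \<in> {1..n}\<close> by simp
    qed
    then have "mse_dist n x (e m) \<le> d" using n by (simp add: mse_dist_def field_simps)
    then show ?thesis ..
  qed
  define B where "B M = {z \<in> space ?N. \<forall>m<M. d < mse_dist n (source_block a n z) (e m)}" for M
  have Bm: "range B \<subseteq> events" unfolding B_def by auto
  have "decseq B" by (auto simp: decseq_def B_def)
  have "(\<Inter>M. B M) = {}"
  proof (rule ccontr)
    assume "(\<Inter>M. B M) \<noteq> {}"
    then obtain z where z: "\<And>M. z \<in> B M" by auto
    obtain m where "mse_dist n (source_block a n z) (e m) \<le> d" using ex by blast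
    with z[of "Suc m"] show False by (auto simp: B_def)
  qed
  then have "(\<lambda>M. prob (B M)) \<longlonglongrightarrow> 0"
    using finite_Lim_measure_decseq[OF Bm \<open>decseq B\<close>] by simp
  then have "eventually (\<lambda>M. prob (B M) < eps) sequentially"
    using eps by (intro order_tendstoD) auto
  then obtain M where M: "prob (B (Suc M)) < eps"
    unfolding eventually_sequentially by (metis le_SucI order_refl)
  \<comment> \<open>The first rational word within distortion \<open>d\<close> is used. Word
    \<open>e m\<close> gets the index m + 1 because code indices start at 1; a source block missed
    by all words defaults to 1.\<close>
  define f where "f x = (if \<exists>m<Suc M. mse_dist n x (e m) \<le> d then Suc (LEAST m. mse_dist n x (e m) \<le> d) else 1)" for x
  have [measurable]: "(\<lambda>x. mse_dist n x y) \<in> borel_measurable (PiM {1..n} (\<lambda>_. lborel))" for y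
    unfolding mse_dist_def by measurable
  have f_meas: "f \<in> measurable (PiM {1..n} (\<lambda>_. lborel)) (count_space UNIV)"
    unfolding f_def by measurable
  have f_range: "f x \<in> {1..Suc M}" for x
    unfolding f_def by (auto intro: Least_le order_trans)
  have "is_code a s2 n (Suc M) d eps f (\<lambda>m. e (m - 1))"
    unfolding is_code_def
  proof (intro conjI allI f_meas f_range)
    have "prob {z \<in> space ?N. d < mse_dist n (source_block a n z) (e (f (source_block a n z) - 1))} \<le> prob (B (Suc M))"
    proof (intro finite_measure_mono subsetI)
      fix z assume z: "z \<in> {z \<in> space ?N. d < mse_dist n (source_block a n z) (e (f (source_block a n z) - 1))}"
      let ?x = "source_block a n z"
      have "\<not> (\<exists>m<Suc M. mse_dist n ?x (e m) \<le> d)"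
      proof
        assume *: "\<exists>m<Suc M. mse_dist n ?x (e m) \<le> d"
        then have "mse_dist n ?x (e (LEAST m. mse_dist n ?x (e m) \<le> d)) \<le> d" by (metis (mono_tags, lifting) LeastI)
        with z * show False by (simp add: f_def)
      qed
      then show "z \<in> B (Suc M)" using z by (auto simp: B_def not_le)
    qed (use Bm in auto)
    with M show "prob {z \<in> space ?N. d < mse_dist n (source_block a n z) (e (f (source_block a n z) - 1))} \<le> eps"
      by linarith
  qed
  then show ?thesis by blast
qed

section \<open>The second-order converse bound\<close>

lemma weight_bounds:
  assumes a: "1 < a" and s2: "0 < s2" and \<theta>: "0 < \<theta>"
  shows "min 1 (s2 / (\<theta> * (a + 1)\<^sup>2)) \<le> weight a s2 \<theta> n k" "weight a s2 \<theta> n k \<le> 1"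
proof -
  have "s2 / (\<theta> * (a + 1)\<^sup>2) \<le> s2 / (\<theta> * eigval a n k)"
    using gfun_upper[of a] eigval_pos[OF a, of n k] a s2 \<theta>
    by (intro divide_left_mono mult_left_mono mult_pos_pos) (auto simp: eigval_def)
  then show "min 1 (s2 / (\<theta> * (a + 1)\<^sup>2)) \<le> weight a s2 \<theta> n k" by (simp add: weight_def min.coboundedI2)
qed (simp add: weight_def)

text \<open>Rotation invariance removes the sine transform and scaling normalizes the variance;
  centring each X^2/2 then shifts the threshold by half the sum of the weights.\<close>

lemma prob_tilted_sum:
  assumes s2: "0 < s2"
  shows "measure (innov_measure s2 n) {z \<in> space (innov_measure s2 n). t \<le> tilted_sum a s2 \<theta> n (mat_app {1..n} (dst n) z)}
    = measure (normal_PiM {1..n} (\<lambda>_. 0) (\<lambda>_. 1))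
        {z \<in> space (normal_PiM {1..n} (\<lambda>_. 0) (\<lambda>_. 1)).
          t - (\<Sum>k=1..n. weight a s2 \<theta> n k) / 2 \<le> chisq_sum {1..n} (weight a s2 \<theta> n) z}"
proof -
  let ?I = "{1..n}" and ?P = "PiM {1..n} (\<lambda>_. borel :: real measure)"
  let ?N = "normal_PiM ?I (\<lambda>_. 0) (\<lambda>_. sqrt s2)" and ?N1 = "normal_PiM ?I (\<lambda>_. 0) (\<lambda>_. 1)"
  let ?T = "\<lambda>x. \<lambda>i\<in>?I. sqrt s2 * x i"
  define E where "E = {w \<in> space ?P. t \<le> tilted_sum a s2 \<theta> n w}"
  have E [measurable]: "E \<in> sets ?P" unfolding E_def by measurable
  have [measurable]: "?T \<in> measurable ?P ?P" by measurable
  have sp: "space ?P = extensional ?I" by (simp add: space_PiM PiE_UNIV_domain PiE_def)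
  have "{z \<in> space ?N. t \<le> tilted_sum a s2 \<theta> n (mat_app ?I (dst n) z)} = mat_app ?I (dst n) -` E \<inter> space ?N"
    by (auto simp: E_def sp mat_app_def)
  also have "measure ?N \<dots> = measure (distr ?N ?P (mat_app ?I (dst n))) E"
    by (rule measure_distr[symmetric]) auto
  also have "\<dots> = measure ?N E"
    using s2 by (subst distr_normal_PiM_orthogonal[OF orthogonal_dst]) auto
  also have "\<dots> = measure (distr ?N1 ?P ?T) E"
    using s2 by (subst distr_scale_normal_PiM) auto
  also have "\<dots> = measure ?N1 (?T -` E \<inter> space ?N1)"
    by (rule measure_distr) auto
  also have "?T -` E \<inter> space ?N1 = {z \<in> space ?N1. t - (\<Sum>k=1..n. weight a s2 \<theta> n k) / 2 \<le> chisq_sum ?I (weight a s2 \<theta> n) z}"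
  proof -
    have "tilted_sum a s2 \<theta> n (?T z) = chisq_sum ?I (weight a s2 \<theta> n) z + (\<Sum>k=1..n. weight a s2 \<theta> n k) / 2" for z
    proof -
      have "tilted_sum a s2 \<theta> n (?T z) = (\<Sum>k=1..n. weight a s2 \<theta> n k * ((z k)\<^sup>2 - 1) / 2 + weight a s2 \<theta> n k / 2)"
        unfolding tilted_sum_def using s2 by (intro sum.cong) (auto simp: power_mult_distrib field_simps)
      then show ?thesis by (simp add: chisq_sum_def sum.distrib sum_divide_distrib)
    qed
    then show ?thesis by (auto simp: E_def sp)
  qed
  finally show ?thesis unfolding innov_measure_eq .
qed

theorem theorem6:
  fixes a s2 d eps \<theta> :: real
  assumes "a > 1" and "s2 > 0"
    and "0 < eps" and "eps < 1"
    and "0 < d" and "d < s2 / (a\<^sup>2 - 1)"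
    and "\<theta> > 0"
    and "d = (1 / (2 * pi)) * (LBINT w=-pi..pi. min \<theta> (s2 / gfun a w))"
  shows "\<exists>C. \<forall>\<^sub>F n in sequentially.
           Rate a s2 n d eps \<ge> RU a s2 \<theta> + sqrt (VU a s2 \<theta> / real n) * Qinv eps
                                - ln (real n) / (2 * real n) - C / real n"
proof -
  note a = \<open>a > 1\<close> and s2 = \<open>s2 > 0\<close> and \<theta> = \<open>\<theta> > 0\<close> and eps = \<open>0 < eps\<close> \<open>eps < 1\<close>
  define q where "q = Qinv eps"
  define b0 where "b0 = min 1 (s2 / (\<theta> * (a + 1)\<^sup>2))"
  have b0: "b0 > 0" using a s2 \<theta> by (simp add: b0_def)
  have w: "b0 \<le> weight a s2 \<theta> n k" "weight a s2 \<theta> n k \<le> 1" for n k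
    using weight_bounds[OF a s2 \<theta>] by (auto simp: b0_def)
  define C0 where "C0 = 2 * a * sqrt \<theta> / sqrt (min s2 (\<theta> * (a - 1)\<^sup>2))"
  have C0: "C0 \<ge> 0" using a s2 \<theta> by (simp add: C0_def)
  obtain K where K: "0 < K" and tail:
    "\<forall>(I::nat set) b x. finite I \<longrightarrow> 16 \<le> card I \<longrightarrow> (\<forall>i\<in>I. b0 \<le> b i \<and> b i \<le> 1) \<longrightarrow>
      measure std_normal_distribution {(x + 1) / sqrt ((\<Sum>i\<in>I. (b i)\<^sup>2) / 2)<..} - K / sqrt (card I)
      \<le> measure (normal_PiM I (\<lambda>_. 0) (\<lambda>_. 1)) {z \<in> space (normal_PiM I (\<lambda>_. 0) (\<lambda>_. 1)). x \<le> chisq_sum I b z}"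
    using chisq_sum_tail_lower[OF b0] by auto
  obtain C1 where C1: "\<And>n. real n * RU a s2 \<theta> - C1 \<le> log_det_sum a s2 \<theta> n"
    using log_det_sum_lower[OF a s2 \<theta>] by blast
  obtain C2 where C2: "\<And>n. real n * d / \<theta> - C2 \<le> (\<Sum>k=1..n. weight a s2 \<theta> n k)"
    using weight_sum_lower[OF a s2 \<theta> assms(8)] by blast
  obtain C3 where C3: "\<And>n. \<bar>(\<Sum>k=1..n. (weight a s2 \<theta> n k)\<^sup>2) / 2 - real n * VU a s2 \<theta>\<bar> \<le> C3"
    using weight_sq_sum_approx[OF a s2 \<theta>] by blast
  define c where "c = std_normal_density (\<bar>q\<bar> + 1)"
  have c: "c > 0" by (simp add: c_def normal_density_pos)
  \<comment> \<open>The union bound and the normal approximation together perturb \<open>eps\<close>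
    by (C0 + K)/sqrt n; division by the density bound \<open>c\<close> converts this into a
    perturbation of the quantile.\<close>
  define D where "D = (C0 + K) / c"
  have D: "D > 0" using C0 K c by (simp add: D_def)
  define V where "V = VU a s2 \<theta>"
  \<comment> \<open>For every n, n V is within \<open>C3\<close> of half a sum of squares, which
    rules out a negative V for large n.\<close>
  have "V \<ge> 0"
  proof (rule ccontr)
    assume "\<not> V \<ge> 0"
    obtain m :: nat where m: "C3 < real m * - V" using reals_Archimedean3[of "- V"] \<open>\<not> V \<ge> 0\<close> by force
    have "(\<Sum>k=1..m. (weight a s2 \<theta> m k)\<^sup>2) \<ge> 0" by (intro sum_nonneg) simp
    with m C3[of m] show False by (simp add: V_def)
  qed
  \<comment> \<open>2 D is the quantile loss, the \<open>\<bar>q\<bar>\<close> term replaces the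
    exact variance by n V, 1 is the threshold shift of the normal approximation, and C1 and C2/2 are
    Riemann sum errors.\<close>
  define C where "C = 2 * D + \<bar>q\<bar> * (2 * C3 / b0) + 1 + C1 + C2 / 2"
  have bound: "RU a s2 \<theta> + sqrt (V / real n) * q - ln (real n) / (2 * real n) - C / real n \<le> Rate a s2 n d eps"
    if n16: "16 \<le> n" and nD: "2 * D \<le> sqrt (real n)" for n :: nat
  proof -
    have n: "1 \<le> n" "0 < real n" using n16 by auto
    define v where "v = (\<Sum>k=1..n. (weight a s2 \<theta> n k)\<^sup>2) / 2"
    define B where "B = (\<Sum>k=1..n. weight a s2 \<theta> n k)"
    define L where "L = log_det_sum a s2 \<theta> n"
    define M where "M = min_code_size a s2 n d eps"
    have "\<exists>f g. is_code a s2 n M d eps f g"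
      unfolding M_def min_code_size_def using exists_code[OF s2 n(1) assms(5) eps(1)] by (rule LeastI_ex)
    then obtain f g where code: "is_code a s2 n M d eps f g" by blast
    \<comment> \<open>The encoder takes some value in \<open>{1..M}\<close>, so M is positive and
      its logarithm behaves as expected.\<close>
    then have M: "0 < real M" by (force simp: is_code_def)
    have v_ge: "real n * b0\<^sup>2 / 2 \<le> v"
    proof -
      have "(\<Sum>k=1..n. b0\<^sup>2) \<le> (\<Sum>k=1..n. (weight a s2 \<theta> n k)\<^sup>2)"
        using w b0 by (intro sum_mono power_mono) auto
      then show ?thesis by (simp add: v_def)
    qed
    have v_le: "v \<le> real n"
    proof -
      have "(\<Sum>k=1..n. (weight a s2 \<theta> n k)\<^sup>2) \<le> (\<Sum>k=1..n. 1)"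
        using w b0 by (intro sum_mono power_le_one) (auto intro: order_trans[OF less_imp_le[OF b0]])
      then show ?thesis by (simp add: v_def)
    qed
    have v_pos: "0 < v" using v_ge b0 n by (smt (verit) divide_pos_pos mult_pos_pos zero_less_power)
    \<comment> \<open>With this threshold the union bound term is exactly C0/sqrt n. The summand ln
      n/2 achieves this and becomes the logarithmic correction of the rate.\<close>
    define t where "t = ln (real M) + ln (real n) / 2 - L + real n * d / (2 * \<theta>)"
    define x where "x = t - B / 2"
    have "Qfun ((x + 1) / sqrt v) - K / sqrt (real n) \<le> eps + real M * (C0 * exp (real n * d / (2 * \<theta>) - L - t))"
    proof -
      have "Qfun ((x + 1) / sqrt v) - K / sqrt (real n)
        \<le> measure (normal_PiM {1..n} (\<lambda>_. 0) (\<lambda>_. 1)) {z \<in> space (normal_PiM {1..n} (\<lambda>_. 0) (\<lambda>_. 1)). x \<le> chisq_sum {1..n} (weight a s2 \<theta> n) z}"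
        using tail[rule_format, of "{1..n}" "weight a s2 \<theta> n" x] w n16 unfolding Qfun_eq v_def by simp
      also have "\<dots> \<le> eps + real M * (C0 * exp (real n * d / (2 * \<theta>) - L - t))"
        using one_shot_converse[OF a s2 \<theta> n(1) code, of t]
        unfolding prob_tilted_sum[OF s2] x_def B_def L_def C0_def .
      finally show ?thesis .
    qed
    also have "real M * (C0 * exp (real n * d / (2 * \<theta>) - L - t)) = C0 / sqrt (real n)"
    proof -
      have "exp (real n * d / (2 * \<theta>) - L - t) = exp (- ln (real M) - ln (sqrt (real n)))"
        using n by (simp add: t_def ln_sqrt)
      also have "\<dots> = 1 / (real M * sqrt (real n))"
        using M n by (simp add: exp_diff exp_minus field_simps)
      finally show ?thesis using M by simp
    qed
    finally have "Qfun ((x + 1) / sqrt v) \<le> eps + (C0 + K) / sqrt (real n)" by (simp add: add_divide_distrib)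
    also have "(C0 + K) / sqrt (real n) = D / sqrt (real n) * c" using c by (simp add: D_def)
    finally have "q - 2 * (D / sqrt (real n)) \<le> (x + 1) / sqrt v"
      unfolding q_def c_def using eps D n nD by (intro Qinv_le_of_Qfun_le) (auto simp: field_simps)
    then have "(q - 2 * (D / sqrt (real n))) * sqrt v \<le> x + 1"
      using v_pos by (simp add: pos_le_divide_eq)
    moreover have "D / sqrt (real n) * sqrt v \<le> D"
      using D v_le n by (simp add: divide_le_eq mult_left_mono)
    ultimately have x_ge: "q * sqrt v - 2 * D - 1 \<le> x" by (simp add: left_diff_distrib)
    \<comment> \<open>Rationalizing the difference of roots leaves |v - n V| over a denominator of
      at least b0/2. The error is then bounded in n, so it contributes O(1/n) to the rate.\<close>
    have sq: "\<bar>sqrt v - sqrt (real n * V)\<bar> \<le> 2 * C3 / b0"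
    proof -
      have "(b0 / 2)\<^sup>2 \<le> v"
      proof -
        have "1 * b0\<^sup>2 \<le> real n * b0\<^sup>2" using n by (intro mult_right_mono) auto
        then show ?thesis using v_ge v_pos by (simp add: power_divide)
      qed
      then have "b0 / 2 \<le> sqrt v" by (rule real_le_rsqrt)
      then have den: "b0 / 2 \<le> sqrt v + sqrt (real n * V)" using \<open>V \<ge> 0\<close> by (smt (verit) real_sqrt_ge_zero mult_nonneg_nonneg of_nat_0_le_iff)
      have "(sqrt v - sqrt (real n * V)) * (sqrt v + sqrt (real n * V)) = v - real n * V"
        using v_pos \<open>V \<ge> 0\<close> by (simp add: algebra_simps)
      then have "\<bar>sqrt v - sqrt (real n * V)\<bar> * (sqrt v + sqrt (real n * V)) = \<bar>v - real n * V\<bar>"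
        using den b0 by (metis abs_mult abs_of_nonneg half_gt_zero less_imp_le order_trans)
      also have "\<dots> \<le> C3" using C3[of n] by (simp add: v_def V_def)
      finally have "\<bar>sqrt v - sqrt (real n * V)\<bar> * (b0 / 2) \<le> C3"
        using den by (smt (verit) abs_ge_zero mult_left_mono)
      then show ?thesis using b0 by (simp add: field_simps)
    qed
    have "q * sqrt (real n * V) - q * sqrt v \<le> \<bar>q\<bar> * \<bar>sqrt v - sqrt (real n * V)\<bar>"
      by (metis abs_ge_self abs_minus_commute abs_mult right_diff_distrib)
    also have "\<dots> \<le> \<bar>q\<bar> * (2 * C3 / b0)" by (intro mult_left_mono sq) simp
    finally have qs: "q * sqrt (real n * V) - \<bar>q\<bar> * (2 * C3 / b0) \<le> q * sqrt v" by simp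
    \<comment> \<open>The distortion budget n d/(2 theta) inside \<open>t\<close> meets half the sum
      of the weights, the mean of the tilted sum; up to C2/2 they cancel.\<close>
    define Z where "Z = real n * d / (2 * \<theta>)"
    have "(real n * d / \<theta> - C2) / 2 \<le> B / 2" unfolding B_def by (intro divide_right_mono C2) simp
    moreover have "(real n * d / \<theta> - C2) / 2 = Z - C2 / 2" by (simp add: Z_def diff_divide_distrib)
    ultimately have Z: "Z - C2 / 2 \<le> B / 2" by simp
    have x_eq: "x = ln (real M) + ln (real n) / 2 - L + Z - B / 2" by (simp add: x_def t_def Z_def)
    have "real n * RU a s2 \<theta> + q * sqrt (real n * V) - ln (real n) / 2 - C \<le> ln (real M)"
      using x_ge qs C1[of n, folded L_def] Z unfolding x_eq C_def by linarith
    then have "(real n * RU a s2 \<theta> + q * sqrt (real n * V) - ln (real n) / 2 - C) / real n \<le> Rate a s2 n d eps"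
      unfolding Rate_def M_def using n by (intro divide_right_mono) auto
    moreover have sqrt_eq: "sqrt (V / real n) = sqrt (real n * V) / real n"
    proof -
      have "sqrt (real n) * sqrt (real n) = real n" by simp
      then show ?thesis using n by (simp add: real_sqrt_mult real_sqrt_divide field_simps)
    qed
    ultimately show ?thesis
      unfolding sqrt_eq using n by (simp add: add_divide_distrib diff_divide_distrib mult.commute)
  qed
  have "\<forall>\<^sub>F n in sequentially. 2 * D \<le> sqrt (real n)"
    by (rule filterlim_at_top[THEN iffD1, rule_format], rule filterlim_compose[OF sqrt_at_top filterlim_real_sequentially])
  then have "\<forall>\<^sub>F n in sequentially.
           Rate a s2 n d eps \<ge> RU a s2 \<theta> + sqrt (VU a s2 \<theta> / real n) * Qinv eps
                                - ln (real n) / (2 * real n) - C / real n"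
    using eventually_ge_at_top[of 16] by eventually_elim (use bound in \<open>auto simp: V_def q_def\<close>)
  then show ?thesis by blast
qed

end
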